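(* Let $(M,\{,\ldots,\})$ be a Nambu-Poisson manifold of order $n$ with associated Nambu tensor $\Pi$, let $N\subset M$ be a submanifold, and let $E\subset TM|_N$ be a canonical vector subbundle such that $F:=E\cap TN$ is a regular, integrable distribution on $N$ and such that the restriction map $i^*:C^\infty(M)_E\to C^\infty(N)_F$ is surjective. Then either $\Pi^\sharp(Ann^1 E)\subseteq TN$ or $E=0$.
   Context: A Nambu-Poisson manifold of order $n$ is a smooth manifold $M$ ($n\le\dim M$) with an $n$-multilinear skew-symmetric bracket $\{,\ldots,\}$ on $C^\infty(M)$ satisfying the Leibniz rule $\{f_1,\ldots,f_{n-1},gh\}=g\{f_1,\ldots,f_{n-1},h\}+\{f_1,\ldots,f_{n-1},g\}h$ and the fundamental identity $\{g_1,\ldots,g_{n-1},\{f_1,\ldots,f_n\}\}=\sum_{k=1}^n\{f_1,\ldots,f_{k-1},\{g_1,\ldots,g_{n-1},f_k\},\ldots,f_n\}$. The Nambu tensor $\Pi\in\Gamma(\Lambda^nTM)$ is defined by $\Pi(df_1,\ldots,df_n)=\{f_1,\ldots,f_n\}$, and $\Pi^\sharp:\Lambda^{n-1}T^*M\to TM$ by $\langle\beta,\Pi^\sharp(\alpha_1\wedge\cdots\wedge\alpha_{n-1})\rangle=\Pi(\alpha_1,\ldots,\alpha_{n-1},\beta)$. Let $i:N\hookrightarrow M$ be the inclusion. "$F$ is a regular, integrable distribution on $N$" means that $F$ is a smooth integrable distribution of constant rank on $N$ such that the leaf space $\underline N=N/\mathcal F$ of the induced foliation $\mathcal F$ is a smooth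 manifold and the projection $\pi:N\to\underline N$ is a submersion. $C^\infty(M)_E$ denotes the functions on $M$ whose differential vanishes on $E$ (at points of $N$); $C^\infty(N)_F$ denotes the functions on $N$ whose differential vanishes on $F$. $E$ is canonical if $F_1,\ldots,F_n\in C^\infty(M)_E$ implies $\{F_1,\ldots,F_n\}\in C^\infty(M)_E$. For $p\in N$, $Ann^1E_p=\{\eta\in\Lambda^{n-1}T_p^*M\mid i_v\eta=0\ \forall v\in E_p\}$. The inclusion $\Pi^\sharp(Ann^1E)\subseteq TN$ is meant pointwise at all $p\in N$. *)

theory Defs
  imports
    "HOL-Analysis.Analysis"
    "HOL-Library.Function_Algebras"
    "HOL-Library.NList"
begin

section \<open>Functions as a vector space\<close>

instantiation "fun" :: (type, real_vector) real_vector
begin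

definition scaleR_fun :: "real \<Rightarrow> ('a \<Rightarrow> 'b) \<Rightarrow> 'a \<Rightarrow> 'b"
  where "scaleR_fun c f = (\<lambda>x. c *\<^sub>R f x)"

instance
  by standard (simp_all add: scaleR_fun_def fun_eq_iff algebra_simps)

end

lemma scaleR_fun_apply [simp]: "(c *\<^sub>R f) x = c *\<^sub>R f x"
  by (simp add: scaleR_fun_def)

text \<open>Linear maps between linear subspaces, represented by total functions that are zero outside
  the source, so that equality of maps is equality in HOL.\<close>

definition linear_between ::
  "'a::real_vector set \<Rightarrow> 'b::real_vector set \<Rightarrow> ('a \<Rightarrow> 'b) \<Rightarrow> bool"
  where "linear_between S T L \<longleftrightarrow>
    (\<forall>x\<in>S. L x \<in> T) \<and>
    (\<forall>x\<in>S. \<forall>y\<in>S. L (x + y) = L x + L y) \<and>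
    (\<forall>c. \<forall>x\<in>S. L (c *\<^sub>R x) = c *\<^sub>R L x) \<and>
    (\<forall>x. x \<notin> S \<longrightarrow> L x = 0)"

section \<open>Smooth manifolds\<close>

primrec Ck_on ::
  "nat \<Rightarrow> 'a::real_normed_vector set \<Rightarrow> ('a \<Rightarrow> 'b::real_normed_vector) \<Rightarrow> bool"
  where
    "Ck_on 0 U f \<longleftrightarrow> continuous_on U f"
  | "Ck_on (Suc k) U f \<longleftrightarrow> (\<forall>x\<in>U. f differentiable (at x)) \<and>
       (\<forall>v. Ck_on k U (\<lambda>x. frechet_derivative f (at x) v))"

text \<open>\<open>S\<close> need not be open: it is typically relatively open in a proper linear subspace.\<close>

definition smooth_on ::
  "'a::real_normed_vector set \<Rightarrow> ('a \<Rightarrow> 'b::real_normed_vector) \<Rightarrow> bool"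
  where "smooth_on S f \<longleftrightarrow>
    (\<forall>x\<in>S. \<exists>U g. open U \<and> x \<in> U \<and> (\<forall>k. Ck_on k U g) \<and> (\<forall>y\<in>S \<inter> U. g y = f y))"

text \<open>The model space is a linear subspace of a Euclidean space \<^typ>\<open>'a\<close>, so that manifolds of
  all dimensions from \<open>0\<close> to \<open>DIM('a)\<close> live in one type. A chart is a pair of its domain and a
  coordinate map, the values of the latter off the domain being irrelevant.\<close>

type_synonym ('p, 'a) chart = "'p set \<times> ('p \<Rightarrow> 'a)"

record ('p, 'a) mfd =
  topol :: "'p topology"
  model :: "'a set"
  atlas :: "('p, 'a) chart set"

abbreviation carr :: "('p, 'a, 'z) mfd_scheme \<Rightarrow> 'p set"
  where "carr M \<equiv> topspace (topol M)"

definition mdim :: "('p, 'a::euclidean_space) mfd \<Rightarrow> nat"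
  where "mdim M = dim (model M)"

definition is_chart :: "('p, 'a::euclidean_space) mfd \<Rightarrow> ('p, 'a) chart \<Rightarrow> bool"
  where "is_chart M = (\<lambda>(U, \<phi>).
    openin (topol M) U \<and>
    openin (top_of_set (model M)) (\<phi> ` U) \<and>
    homeomorphic_map (subtopology (topol M) U) (top_of_set (\<phi> ` U)) \<phi>)"

definition compatible :: "('p, 'a::euclidean_space) chart \<Rightarrow> ('p, 'a) chart \<Rightarrow> bool"
  where "compatible = (\<lambda>(U, \<phi>) (W, \<psi>).
    smooth_on (\<phi> ` (U \<inter> W)) (\<psi> \<circ> inv_into U \<phi>) \<and>
    smooth_on (\<psi> ` (U \<inter> W)) (\<phi> \<circ> inv_into W \<psi>))"

definition smooth_manifold :: "('p, 'a::euclidean_space) mfd \<Rightarrow> bool"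
  where "smooth_manifold M \<longleftrightarrow>
    subspace (model M) \<and> Hausdorff_space (topol M) \<and> second_countable (topol M) \<and>
    (\<forall>c\<in>atlas M. is_chart M c) \<and>
    (\<forall>c\<in>atlas M. \<forall>d\<in>atlas M. compatible c d) \<and>
    (\<Union>c\<in>atlas M. fst c) = carr M"

definition max_atlas :: "('p, 'a::euclidean_space) mfd \<Rightarrow> ('p, 'a) chart set"
  where "max_atlas M = {c. is_chart M c \<and> (\<forall>d\<in>atlas M. compatible c d)}"

definition smooth_fun_on :: "('p, 'a::euclidean_space) mfd \<Rightarrow> 'p set \<Rightarrow> ('p \<Rightarrow> real) \<Rightarrow> bool"
  where "smooth_fun_on M S f \<longleftrightarrow>
    (\<forall>(U, \<phi>)\<in>atlas M. smooth_on (\<phi> ` (U \<inter> S)) (f \<circ> inv_into U \<phi>))"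

text \<open>Elements of \<open>C\<^sup>\<infinity>(M)\<close> are total functions whose values off the carrier are arbitrary.\<close>

definition Cinf :: "('p, 'a::euclidean_space) mfd \<Rightarrow> ('p \<Rightarrow> real) set"
  where "Cinf M = {f. smooth_fun_on M (carr M) f}"

definition smooth_map ::
  "('p, 'a::euclidean_space) mfd \<Rightarrow> ('q, 'b::euclidean_space) mfd \<Rightarrow> ('p \<Rightarrow> 'q) \<Rightarrow> bool"
  where "smooth_map M M' h \<longleftrightarrow>
    continuous_map (topol M) (topol M') h \<and>
    (\<forall>(U, \<phi>)\<in>atlas M. \<forall>(W, \<psi>)\<in>atlas M'.
      smooth_on (\<phi> ` (U \<inter> h -` W)) (\<psi> \<circ> h \<circ> inv_into U \<phi>))"

section \<open>Tangent vectors and forms\<close>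

text \<open>Tangent vectors are derivations of \<open>C\<^sup>\<infinity>(M)\<close> at a point, set to zero outside \<open>C\<^sup>\<infinity>(M)\<close>.
  The Leibniz rule makes them blind to the values of functions off the carrier, because the
  indicator function of the complement of the carrier belongs to \<^const>\<open>Cinf\<close>.\<close>

type_synonym 'p tvec = "('p \<Rightarrow> real) \<Rightarrow> real"

definition tangent_space :: "('p, 'a::euclidean_space) mfd \<Rightarrow> 'p \<Rightarrow> 'p tvec set"
  where "tangent_space M p = {D. linear_between (Cinf M) UNIV D \<and>
    (\<forall>f\<in>Cinf M. \<forall>g\<in>Cinf M. D (f * g) = f p * D g + g p * D f)}"

definition push_forward ::
  "('q, 'b::euclidean_space) mfd \<Rightarrow> ('p \<Rightarrow> 'q) \<Rightarrow> 'p tvec \<Rightarrow> 'q tvec"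
  where "push_forward M' h D = (\<lambda>g. if g \<in> Cinf M' then D (g \<circ> h) else 0)"

definition submersion ::
  "('p, 'a::euclidean_space) mfd \<Rightarrow> ('q, 'b::euclidean_space) mfd \<Rightarrow> ('p \<Rightarrow> 'q) \<Rightarrow> bool"
  where "submersion M M' h \<longleftrightarrow> smooth_map M M' h \<and>
    (\<forall>p\<in>carr M. push_forward M' h ` tangent_space M p = tangent_space M' (h p))"

text \<open>The tangent vector at \<open>q\<close> with constant coordinates \<open>x\<close> in a chart.\<close>

definition coord_vec ::
  "('p, 'a::euclidean_space) mfd \<Rightarrow> ('p, 'a) chart \<Rightarrow> 'p \<Rightarrow> 'a \<Rightarrow> 'p tvec"
  where "coord_vec M = (\<lambda>(U, \<phi>) q x f.
    if f \<in> Cinf M then deriv (\<lambda>t::real. f (inv_into U \<phi> (\<phi> q + t *\<^sub>R x))) 0 else 0)"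

type_synonym 'p covec = "'p tvec \<Rightarrow> real"

definition cotangent_space :: "('p, 'a::euclidean_space) mfd \<Rightarrow> 'p \<Rightarrow> 'p covec set"
  where "cotangent_space M p = {\<alpha>. linear_between (tangent_space M p) UNIV \<alpha>}"

definition differential :: "('p, 'a::euclidean_space) mfd \<Rightarrow> 'p \<Rightarrow> ('p \<Rightarrow> real) \<Rightarrow> 'p covec"
  where "differential M p f = (\<lambda>v. if v \<in> tangent_space M p then v f else 0)"

text \<open>\<open>\<Lambda>\<^sup>kT\<^sub>p\<^sup>*M\<close> as alternating multilinear functions on \<open>k\<close>-tuples of tangent vectors,
  set to zero elsewhere.\<close>

type_synonym 'p form = "'p tvec list \<Rightarrow> real"

definition forms :: "('p, 'a::euclidean_space) mfd \<Rightarrow> 'p \<Rightarrow> nat \<Rightarrow> 'p form set"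
  where "forms M p k = {\<eta>.
    (\<forall>vs\<in>nlists k (tangent_space M p). \<forall>i<k.
      (\<forall>v\<in>tangent_space M p. \<forall>w\<in>tangent_space M p.
        \<eta> (vs[i := v + w]) = \<eta> (vs[i := v]) + \<eta> (vs[i := w])) \<and>
      (\<forall>c. \<forall>v\<in>tangent_space M p. \<eta> (vs[i := c *\<^sub>R v]) = c * \<eta> (vs[i := v])) \<and>
      (\<forall>j<k. i \<noteq> j \<and> vs ! i = vs ! j \<longrightarrow> \<eta> vs = 0)) \<and>
    (\<forall>vs. vs \<notin> nlists k (tangent_space M p) \<longrightarrow> \<eta> vs = 0)}"

definition wedge :: "('p, 'a::euclidean_space) mfd \<Rightarrow> 'p \<Rightarrow> 'p covec list \<Rightarrow> 'p form"
  where "wedge M p \<alpha>s = (\<lambda>vs.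
    if vs \<in> nlists (length \<alpha>s) (tangent_space M p)
    then \<Sum>\<sigma> | \<sigma> permutes {..<length \<alpha>s}.
           of_int (sign \<sigma>) * (\<Prod>i<length \<alpha>s. (\<alpha>s ! i) (vs ! \<sigma> i))
    else 0)"

definition interior_prod :: "'p tvec \<Rightarrow> 'p form \<Rightarrow> 'p form"
  where "interior_prod v \<eta> = (\<lambda>vs. \<eta> (v # vs))"

section \<open>Submanifolds, subbundles and distributions\<close>

text \<open>Embedded submanifolds, by slice charts; the model space of \<open>N\<close> is the subspace \<open>W\<close>.\<close>

definition slice_charts ::
  "('p, 'a::euclidean_space) mfd \<Rightarrow> 'p set \<Rightarrow> 'a set \<Rightarrow> ('p, 'a) chart set"
  where "slice_charts M N W = {(U, \<phi>) \<in> max_atlas M. \<phi> ` (U \<inter> N) = \<phi> ` U \<inter> W}"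

definition submanifold :: "('p, 'a::euclidean_space) mfd \<Rightarrow> 'p set \<Rightarrow> 'a set \<Rightarrow> bool"
  where "submanifold M N W \<longleftrightarrow> N \<subseteq> carr M \<and> subspace W \<and> W \<subseteq> model M \<and>
    (\<forall>p\<in>N. \<exists>c\<in>slice_charts M N W. p \<in> fst c)"

definition induced_mfd ::
  "('p, 'a::euclidean_space) mfd \<Rightarrow> 'p set \<Rightarrow> 'a set \<Rightarrow> ('p, 'a) mfd"
  where "induced_mfd M N W = \<lparr>topol = subtopology (topol M) N, model = W,
    atlas = (\<lambda>(U, \<phi>). (U \<inter> N, \<phi>)) ` slice_charts M N W\<rparr>"

text \<open>A smooth subbundle of rank \<open>r\<close> of the restriction of \<open>TM\<close> to \<open>Y\<close>, where the carrier of \<open>Y\<close>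
  is contained in that of \<open>M\<close>. A section is smooth iff it maps every smooth function on \<open>M\<close> to a
  smooth function on its domain.\<close>

definition subbundle_along ::
  "('p, 'a::euclidean_space) mfd \<Rightarrow> ('p, 'a) mfd \<Rightarrow> nat \<Rightarrow> ('p \<Rightarrow> 'p tvec set) \<Rightarrow> bool"
  where "subbundle_along M Y r E \<longleftrightarrow>
    (\<forall>p\<in>carr Y. subspace (E p) \<and> E p \<subseteq> tangent_space M p \<and> dim (E p) = r) \<and>
    (\<forall>p\<in>carr Y. \<exists>U s. openin (topol Y) U \<and> p \<in> U \<and>
      (\<forall>q\<in>U. span ((\<lambda>i. s i q) ` {..<r}) = E q) \<and>
      (\<forall>i<r. \<forall>f\<in>Cinf M. smooth_fun_on Y U (\<lambda>q. s i q f)))"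

definition tangent_image ::
  "('p, 'a::euclidean_space) mfd \<Rightarrow> ('p, 'a) mfd \<Rightarrow> 'p \<Rightarrow> 'p tvec set"
  where "tangent_image M Y p = push_forward M id ` tangent_space Y p"

text \<open>\<open>E \<inter> TY\<close>, as a family of subspaces of the tangent spaces of \<open>Y\<close>.\<close>

definition tangential_part ::
  "('p, 'a::euclidean_space) mfd \<Rightarrow> ('p, 'a) mfd \<Rightarrow> ('p \<Rightarrow> 'p tvec set) \<Rightarrow> 'p \<Rightarrow> 'p tvec set"
  where "tangential_part M Y E p = {w \<in> tangent_space Y p. push_forward M id w \<in> E p}"

definition Cinf_ann ::
  "('p, 'a::euclidean_space) mfd \<Rightarrow> 'p set \<Rightarrow> ('p \<Rightarrow> 'p tvec set) \<Rightarrow> ('p \<Rightarrow> real) set"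
  where "Cinf_ann M N E = {f \<in> Cinf M. \<forall>p\<in>N. \<forall>v\<in>E p. differential M p f v = 0}"

text \<open>A foliated chart: \<open>F\<close> is spanned by the coordinate directions in \<open>W\<close>. Its plaques are the
  sets of points whose coordinates agree modulo \<open>W\<close>; they are connected since the image of the
  chart is convex.\<close>

definition foliated_chart ::
  "('p, 'a::euclidean_space) mfd \<Rightarrow> ('p \<Rightarrow> 'p tvec set) \<Rightarrow> ('p, 'a) chart \<Rightarrow> 'a set \<Rightarrow> bool"
  where "foliated_chart Y F c W \<longleftrightarrow> c \<in> max_atlas Y \<and> convex (snd c ` fst c) \<and>
    subspace W \<and> W \<subseteq> model Y \<and> (\<forall>q\<in>fst c. F q = coord_vec Y c q ` W)"

definition integrable_distribution ::
  "('p, 'a::euclidean_space) mfd \<Rightarrow> ('p \<Rightarrow> 'p tvec set) \<Rightarrow> bool"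
  where "integrable_distribution Y F \<longleftrightarrow>
    (\<forall>p\<in>carr Y. \<exists>c W. foliated_chart Y F c W \<and> p \<in> fst c)"

text \<open>Two points lie on the same leaf iff they are joined by a finite chain of plaques.\<close>

definition same_plaque ::
  "('p, 'a::euclidean_space) mfd \<Rightarrow> ('p \<Rightarrow> 'p tvec set) \<Rightarrow> ('p \<times> 'p) set"
  where "same_plaque Y F = {(q, q'). \<exists>c W. foliated_chart Y F c W \<and>
    q \<in> fst c \<and> q' \<in> fst c \<and> snd c q - snd c q' \<in> W}"

definition leaf :: "('p, 'a::euclidean_space) mfd \<Rightarrow> ('p \<Rightarrow> 'p tvec set) \<Rightarrow> 'p \<Rightarrow> 'p set"
  where "leaf Y F p = (same_plaque Y F)\<^sup>* `` {p}"

text \<open>The leaf space is the set of leaves with the quotient topology, and \<^term>\<open>leaf Y F\<close> is the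
  projection onto it.\<close>

definition regular_integrable_distribution ::
  "('p, 'a::euclidean_space) mfd \<Rightarrow> ('p \<Rightarrow> 'p tvec set) \<Rightarrow> bool"
  where "regular_integrable_distribution Y F \<longleftrightarrow>
    (\<exists>s. subbundle_along Y Y s F) \<and> integrable_distribution Y F \<and>
    (\<exists>Q :: ('p set, 'a) mfd. smooth_manifold Q \<and>
      quotient_map (topol Y) (topol Q) (leaf Y F) \<and> submersion Y Q (leaf Y F))"

section \<open>Nambu-Poisson structures\<close>

definition nambu_poisson ::
  "nat \<Rightarrow> ('p, 'a::euclidean_space) mfd \<Rightarrow> (('p \<Rightarrow> real) list \<Rightarrow> 'p \<Rightarrow> real) \<Rightarrow> bool"
  where "nambu_poisson n M br \<longleftrightarrow>
    smooth_manifold M \<and> 1 \<le> n \<and> n \<le> mdim M \<and>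
    (\<forall>fs\<in>nlists n (Cinf M). br fs \<in> Cinf M) \<and>
    (\<forall>fs\<in>nlists n (Cinf M). \<forall>i<n. \<forall>f\<in>Cinf M. \<forall>g\<in>Cinf M. \<forall>x\<in>carr M.
      br (fs[i := f + g]) x = br (fs[i := f]) x + br (fs[i := g]) x) \<and>
    (\<forall>fs\<in>nlists n (Cinf M). \<forall>i<n. \<forall>c. \<forall>f\<in>Cinf M. \<forall>x\<in>carr M.
      br (fs[i := c *\<^sub>R f]) x = c * br (fs[i := f]) x) \<and>
    (\<forall>fs\<in>nlists n (Cinf M). \<forall>i<n. \<forall>j<n. i \<noteq> j \<longrightarrow>
      (\<forall>x\<in>carr M. br (fs[i := fs ! j, j := fs ! i]) x = - br fs x)) \<and>
    (\<forall>fs\<in>nlists (n - 1) (Cinf M). \<forall>g\<in>Cinf M. \<forall>h\<in>Cinf M. \<forall>x\<in>carr M.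
      br (fs @ [g * h]) x = g x * br (fs @ [h]) x + br (fs @ [g]) x * h x) \<and>
    (\<forall>gs\<in>nlists (n - 1) (Cinf M). \<forall>fs\<in>nlists n (Cinf M). \<forall>x\<in>carr M.
      br (gs @ [br fs]) x = (\<Sum>k<n. br (fs[k := br (gs @ [fs ! k])]) x))"

text \<open>The tensor \<open>\<Pi>\<close>, determined by \<open>\<Pi>(df\<^sub>1,\<dots>,df\<^sub>n) = {f\<^sub>1,\<dots>,f\<^sub>n}\<close>.\<close>

definition nambu_tensor ::
  "nat \<Rightarrow> ('p, 'a::euclidean_space) mfd \<Rightarrow> (('p \<Rightarrow> real) list \<Rightarrow> 'p \<Rightarrow> real) \<Rightarrow>
    'p \<Rightarrow> 'p covec list \<Rightarrow> real"
  where "nambu_tensor n M br p \<alpha>s =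
    (THE c. \<exists>fs\<in>nlists n (Cinf M). map (differential M p) fs = \<alpha>s \<and> br fs p = c)"

text \<open>\<open>\<Pi>\<^sup>\<sharp>\<close> at \<open>p\<close>, the linear map \<open>\<Lambda>\<^sup>n\<^sup>-\<^sup>1T\<^sub>p\<^sup>*M \<rightarrow> T\<^sub>pM\<close> determined by its values on
  decomposable forms.\<close>

definition nambu_sharp ::
  "nat \<Rightarrow> ('p, 'a::euclidean_space) mfd \<Rightarrow> (('p \<Rightarrow> real) list \<Rightarrow> 'p \<Rightarrow> real) \<Rightarrow>
    'p \<Rightarrow> 'p form \<Rightarrow> 'p tvec"
  where "nambu_sharp n M br p =
    (THE S. linear_between (forms M p (n - 1)) (tangent_space M p) S \<and>
      (\<forall>\<alpha>s\<in>nlists (n - 1) (cotangent_space M p). \<forall>\<beta>\<in>cotangent_space M p.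
        \<beta> (S (wedge M p \<alpha>s)) = nambu_tensor n M br p (\<alpha>s @ [\<beta>])))"

definition Ann1 ::
  "nat \<Rightarrow> ('p, 'a::euclidean_space) mfd \<Rightarrow> ('p \<Rightarrow> 'p tvec set) \<Rightarrow> 'p \<Rightarrow> 'p form set"
  where "Ann1 n M E p = {\<eta> \<in> forms M p (n - 1). \<forall>v\<in>E p. interior_prod v \<eta> = 0}"

definition canonical_along ::
  "nat \<Rightarrow> ('p, 'a::euclidean_space) mfd \<Rightarrow> (('p \<Rightarrow> real) list \<Rightarrow> 'p \<Rightarrow> real) \<Rightarrow> 'p set \<Rightarrow>
    ('p \<Rightarrow> 'p tvec set) \<Rightarrow> bool"
  where "canonical_along n M br N E \<longleftrightarrow>
    (\<forall>fs\<in>nlists n (Cinf_ann M N E). br fs \<in> Cinf_ann M N E)"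

end

theory Submission
  imports Defs
begin

text \<open>Let \<open>I\<close> be the ideal of smooth functions on \<open>M\<close> that vanish on \<open>N\<close>. A tangent vector of \<open>M\<close> at a point
  \<open>p\<close> of \<open>N\<close> is tangent to \<open>N\<close> iff it kills \<open>I\<close> (\<open>tangent_image_iff\<close>). So the first alternative says that
  \<open>{f\<^sub>1,\<dots>,f\<^sub>n\<^sub>-\<^sub>1,f}(p) = 0\<close> whenever \<open>f\<close> is in \<open>I\<close> and the differentials of \<open>f\<^sub>1,\<dots>,f\<^sub>n\<^sub>-\<^sub>1\<close> at \<open>p\<close> annihilate
  \<open>E\<^sub>p\<close>. Since \<open>E\<close> has constant rank, one may assume that \<open>E\<^sub>p\<close> is nonzero at all points.

  Suppose first that \<open>f\<^sub>1,\<dots>,f\<^sub>n\<^sub>-\<^sub>1\<close> are in \<open>C\<^sup>\<infinity>(M)\<^sub>E\<close> (\<open>bracket_vanishes\<close>). As \<open>F = E \<inter> TN\<close> has constant rank too,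
  \<open>E\<close> is contained in \<open>TN\<close> either at all points of \<open>N\<close> or at none. In the latter case, a product \<open>f f'\<close> of two functions in
  \<open>I\<close> has zero differential along \<open>N\<close>, so it is in \<open>C\<^sup>\<infinity>(M)\<^sub>E\<close>. By canonicity and the Leibniz rule, any \<open>v\<close> in \<open>E\<^sub>p\<close>
  satisfies \<open>{..,f}(p) v(f') + {..,f'}(p) v(f) = 0\<close>. Choose \<open>v\<close> outside \<open>TN\<close> and \<open>f'\<close> with \<open>v(f') \<noteq> 0\<close>: the case
  \<open>f = f'\<close> gives \<open>{..,f'}(p) = 0\<close>, and then \<open>{..,f}(p) = 0\<close> for all \<open>f\<close>. In the former case \<open>I\<close> is contained in
  \<open>C\<^sup>\<infinity>(M)\<^sub>E\<close>, so this set contains \<open>f h\<close> for all \<open>f\<close> in \<open>I\<close> and all smooth \<open>h\<close>. Differentiating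
  \<open>{..,f h} = f {..,h} + {..,f} h\<close> along \<open>v\<close> in \<open>E\<^sub>p\<close> leaves \<open>{..,f}(p) v(h) = 0\<close>, and some \<open>h\<close> has \<open>v(h) \<noteq> 0\<close> if \<open>v \<noteq> 0\<close>.

  It remains to see that every covector at \<open>p\<close> that annihilates \<open>E\<^sub>p\<close> is the differential of a function in \<open>C\<^sup>\<infinity>(M)\<^sub>E\<close>
  (\<open>annihilator_lift\<close>). Its restriction to \<open>T\<^sub>pN\<close> annihilates \<open>F\<^sub>p\<close>, hence is the differential of a function pulled back
  from the leaf space, provided that the differential of the projection has no kernel beyond \<open>F\<close> (\<open>leaf_kernel\<close>). This proviso
  rests on second countability: a leaf meets only countably many plaques of a foliated chart
  (\<open>leaf_meets_countably_many_plaques\<close>), while a larger kernel would make a fibre of the projection meet uncountably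
  many. By surjectivity of the restriction map, the function on \<open>N\<close> extends to one in \<open>C\<^sup>\<infinity>(M)\<^sub>E\<close>, and the remaining covector annihilates
  \<open>E\<^sub>p + T\<^sub>pN\<close>. The annihilator of \<open>E + TN\<close> is a vector bundle, because the ranks are constant, and a local section of it yields a
  function in \<open>I\<close> and in \<open>C\<^sup>\<infinity>(M)\<^sub>E\<close> with the required differential (\<open>conormal_function\<close>).

  Finally, \<open>\<Pi>\<^sup>\<sharp>\<close> and the forms in \<open>Ann\<^sup>1E\<^sub>p\<close> are expressed in a basis of \<open>T\<^sub>pM\<close> that extends a basis of \<open>E\<^sub>p\<close>
  (\<open>nambu_sharp_eq\<close>): only wedge products of covectors annihilating \<open>E\<^sub>p\<close> occur in such a form. Tangent spaces, being spaces of
  derivations, have finite bases by Hadamard's lemma (\<open>tangent_space_coord\<close>).\<close>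

section \<open>Calculus of smooth functions on open sets\<close>

lemma Ck_on_subset: "Ck_on k U f \<Longrightarrow> V \<subseteq> U \<Longrightarrow> Ck_on k V f"
  by (induction k arbitrary: f) (auto intro: continuous_on_subset)

text \<open>Derivatives at a point depend only on the values nearby, so that openness of \<open>U\<close> is
  essential.\<close>

lemma Ck_on_cong:
  assumes "open U" "\<And>x. x \<in> U \<Longrightarrow> f x = g x"
  shows "Ck_on k U f \<longleftrightarrow> Ck_on k U g"
  using assms(2)
proof (induction k arbitrary: f g)
  case 0
  then show ?case by (simp cong: continuous_on_cong)
next
  case (Suc k)
  have ev: "eventually (\<lambda>y. f y = g y) (nhds x)" if "x \<in> U" for x
    using assms(1) that Suc.prems by (auto simp: eventually_nhds)
  have hd: "(f has_derivative L) (at x) \<longleftrightarrow> (g has_derivative L) (at x)" if "x \<in> U" for x L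
    using has_derivative_transform_within_open[OF _ assms(1) that] Suc.prems by metis
  have d: "f differentiable (at x) \<longleftrightarrow> g differentiable (at x)" if "x \<in> U" for x
    using hd[OF that] by (simp add: differentiable_def)
  have fd: "frechet_derivative f (at x) = frechet_derivative g (at x)" if "x \<in> U" for x
    unfolding frechet_derivative_def using hd[OF that] by simp
  have "Ck_on k U (\<lambda>x. frechet_derivative f (at x) v) \<longleftrightarrow>
        Ck_on k U (\<lambda>x. frechet_derivative g (at x) v)" for v
    by (rule Suc.IH) (simp add: fd)
  then show ?case using d by auto
qed

text \<open>Unlike the defining equation, this form lets the derivative be any family \<open>f'\<close> that
  one can write down, instead of \<^const>\<open>frechet_derivative\<close>.\<close>

lemma Ck_on_SucI:
  assumes "open U" "\<And>x. x \<in> U \<Longrightarrow> (f has_derivative f' x) (at x)"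
    and "\<And>v. Ck_on k U (\<lambda>x. f' x v)"
  shows "Ck_on (Suc k) U f"
proof -
  have "Ck_on k U (\<lambda>x. frechet_derivative f (at x) v)" for v
  proof -
    have "f' x v = frechet_derivative f (at x) v" if "x \<in> U" for x
      using frechet_derivative_at[OF assms(2)[OF that]] by simp
    then show ?thesis
      using Ck_on_cong[OF assms(1), of "\<lambda>x. f' x v" "\<lambda>x. frechet_derivative f (at x) v"] assms(3)
      by blast
  qed
  then show ?thesis using assms(2) by (auto simp: differentiable_def)
qed

lemma Ck_on_SucD: "Ck_on (Suc k) U f \<Longrightarrow> Ck_on k U f"
proof (induction k arbitrary: f)
  case 0
  then show ?case
    by (auto intro!: continuous_at_imp_continuous_on differentiable_imp_continuous_within)
next
  case (Suc k)
  then show ?case by (metis Ck_on.simps(2))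
qed

lemma Ck_on_continuous_on: "Ck_on k U f \<Longrightarrow> continuous_on U f"
proof (induction k)
  case (Suc k)
  show ?case by (rule Suc.IH[OF Ck_on_SucD[OF Suc.prems]])
qed simp

lemma Ck_on_has_derivative:
  "Ck_on (Suc k) U f \<Longrightarrow> x \<in> U \<Longrightarrow> (f has_derivative frechet_derivative f (at x)) (at x)"
  by (simp add: frechet_derivative_works)

lemma Ck_on_local:
  assumes "\<And>x. x \<in> U \<Longrightarrow> \<exists>V. open V \<and> x \<in> V \<and> Ck_on k V f"
  shows "Ck_on k U f"
  using assms
proof (induction k arbitrary: f)
  case 0
  then have "continuous (at x) f" if "x \<in> U" for x
    using that by (metis Ck_on.simps(1) continuous_on_eq_continuous_at)
  then show ?case by (auto intro: continuous_at_imp_continuous_on)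
next
  case (Suc k)
  have "Ck_on k U (\<lambda>x. frechet_derivative f (at x) v)" for v
    by (rule Suc.IH) (metis Suc.prems Ck_on.simps(2))
  moreover have "f differentiable (at x)" if "x \<in> U" for x
    using Suc.prems[OF that] by auto
  ultimately show ?case by auto
qed

lemma Ck_on_const [simp]: "open U \<Longrightarrow> Ck_on k U (\<lambda>x. c)"
  by (induction k arbitrary: c) (auto simp: frechet_derivative_const)

lemma Ck_on_bounded_linear:
  assumes "open U" "bounded_linear f"
  shows "Ck_on k U f"
proof (cases k)
  case 0
  then show ?thesis using assms by (simp add: linear_continuous_on)
next
  case (Suc m)
  show ?thesis unfolding Suc
    by (rule Ck_on_SucI[where f' = "\<lambda>x. f"])
      (use assms in \<open>auto intro: bounded_linear_imp_has_derivative\<close>)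
qed

lemma Ck_on_add:
  assumes "open U" "Ck_on k U f" "Ck_on k U g"
  shows "Ck_on k U (\<lambda>x. f x + g x)"
  using assms(2,3)
proof (induction k arbitrary: f g)
  case 0
  then show ?case by (auto intro: continuous_intros)
next
  case (Suc k)
  have "Ck_on k U (\<lambda>x. frechet_derivative f (at x) v + frechet_derivative g (at x) v)" for v
    by (rule Suc.IH) (use Suc.prems in simp_all)
  moreover have "((\<lambda>x. f x + g x) has_derivative
      (\<lambda>v. frechet_derivative f (at x) v + frechet_derivative g (at x) v)) (at x)" if "x \<in> U" for x
    using Suc.prems that by (intro has_derivative_add Ck_on_has_derivative)
  ultimately show ?case
    by (intro Ck_on_SucI[OF assms(1), where f' = "\<lambda>x v. frechet_derivative f (at x) v + frechet_derivative g (at x) v"])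
qed

lemma Ck_on_sum:
  assumes "open U" "\<And>i. i \<in> I \<Longrightarrow> Ck_on k U (f i)"
  shows "Ck_on k U (\<lambda>x. \<Sum>i\<in>I. f i x)"
  using assms(2)
  by (induction I rule: infinite_finite_induct) (auto simp: assms(1) intro!: Ck_on_add)

lemma Ck_on_bilinear:
  assumes "bounded_bilinear p" "open U" "Ck_on k U f" "Ck_on k U g"
  shows "Ck_on k U (\<lambda>x. p (f x) (g x))"
  using assms(3,4)
proof (induction k arbitrary: f g)
  case 0
  then show ?case by (auto intro: bounded_bilinear.continuous_on[OF assms(1)])
next
  case (Suc k)
  have "Ck_on k U f" "Ck_on k U g" using Suc.prems by (blast intro: Ck_on_SucD)+
  then have *: "Ck_on k U (\<lambda>x. p (f x) (frechet_derivative g (at x) v) + p (frechet_derivative f (at x) v) (g x))" for v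
    by (intro Ck_on_add Suc.IH assms(2)) (use Suc.prems in auto)
  have "((\<lambda>x. p (f x) (g x)) has_derivative
      (\<lambda>v. p (f x) (frechet_derivative g (at x) v) + p (frechet_derivative f (at x) v) (g x))) (at x)"
    if "x \<in> U" for x
    using Suc.prems that by (intro bounded_bilinear.FDERIV[OF assms(1)] Ck_on_has_derivative)
  with * show ?case
    by (intro Ck_on_SucI[OF assms(2), where f' = "\<lambda>x v. p (f x) (frechet_derivative g (at x) v) + p (frechet_derivative f (at x) v) (g x)"])
qed

lemma Ck_on_compose:
  fixes f :: "'a::real_normed_vector \<Rightarrow> 'b::euclidean_space"
    and g :: "'b \<Rightarrow> 'c::real_normed_vector"
  assumes "open U" "open V" "f ` U \<subseteq> V" "Ck_on k U f" "Ck_on k V g"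
  shows "Ck_on k U (\<lambda>x. g (f x))"
  using assms(4,5)
proof (induction k arbitrary: g)
  case 0
  then show ?case using assms(3) by (auto intro: continuous_on_compose2)
next
  case (Suc k)
  have fk: "Ck_on k U f" using Suc.prems by (blast intro: Ck_on_SucD)
  have der: "((\<lambda>x. g (f x)) has_derivative
      (\<lambda>v. frechet_derivative g (at (f x)) (frechet_derivative f (at x) v))) (at x)" if "x \<in> U" for x
    using diff_chain_at[OF Ck_on_has_derivative[OF Suc.prems(1) that]
      Ck_on_has_derivative[OF Suc.prems(2)]] that assms(3) by (auto simp: o_def)
  \<comment> \<open>Expanding the inner derivative in a basis makes the chain rule a sum of products of
    functions of the lower class.\<close>
  have eq: "frechet_derivative g (at (f x)) (frechet_derivative f (at x) v) =
      (\<Sum>b\<in>Basis. (frechet_derivative f (at x) v \<bullet> b) *\<^sub>R frechet_derivative g (at (f x)) b)"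
    if "x \<in> U" for x v
  proof -
    interpret bounded_linear "frechet_derivative g (at (f x))"
      using Ck_on_has_derivative[OF Suc.prems(2), of "f x"] that assms(3)
      by (auto intro: has_derivative_bounded_linear)
    show ?thesis
      by (subst euclidean_representation[symmetric, of "frechet_derivative f (at x) v"])
        (simp only: sum scaleR)
  qed
  have "Ck_on k U (\<lambda>x. \<Sum>b\<in>Basis. (frechet_derivative f (at x) v \<bullet> b) *\<^sub>R frechet_derivative g (at (f x)) b)" for v
    by (intro Ck_on_sum Ck_on_bilinear[OF bounded_bilinear_scaleR] assms(1)
          Ck_on_bilinear[OF bounded_bilinear_inner] Ck_on_const Suc.IH)
      (use Suc.prems fk in auto)
  then have "Ck_on k U (\<lambda>x. frechet_derivative g (at (f x)) (frechet_derivative f (at x) v))" for v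
    by (subst Ck_on_cong[OF assms(1) eq]) auto
  then show ?case
    by (intro Ck_on_SucI[OF assms(1), where f' = "\<lambda>x v. frechet_derivative g (at (f x)) (frechet_derivative f (at x) v)"] der)
qed

lemma Ck_on_inverse: "Ck_on k (- {0::real}) inverse"
proof (induction k)
  case 0
  then show ?case by (auto intro!: continuous_intros)
next
  case (Suc k)
  have o: "open (- {0::real})" by auto
  have "Ck_on k (- {0::real}) (\<lambda>x. (inverse x * ((-1) * v)) * inverse x)" for v
    by (intro Ck_on_bilinear[OF bounded_bilinear_mult o] Suc Ck_on_const o)
  then have *: "Ck_on k (- {0::real}) (\<lambda>x. - (inverse x * v * inverse x))" for v
    by simp
  show ?case
  proof (rule Ck_on_SucI[OF o _ *])
    show "(inverse has_derivative (\<lambda>v. - (inverse x * v * inverse x))) (at x)" if "x \<in> - {0}" for x :: real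
      using that by (intro has_derivative_inverse') simp
  qed
qed

text \<open>In contrast to \<^const>\<open>smooth_on\<close> there is no local extension here: the notion is
  meant for open sets.\<close>

definition smooth_in :: "'a::real_normed_vector set \<Rightarrow> ('a \<Rightarrow> 'b::real_normed_vector) \<Rightarrow> bool"
  where "smooth_in U f \<longleftrightarrow> (\<forall>k. Ck_on k U f)"

lemma smooth_in_subset: "smooth_in U f \<Longrightarrow> V \<subseteq> U \<Longrightarrow> smooth_in V f"
  unfolding smooth_in_def using Ck_on_subset by blast

lemma smooth_in_cong: "open U \<Longrightarrow> (\<And>x. x \<in> U \<Longrightarrow> f x = g x) \<Longrightarrow> smooth_in U f \<longleftrightarrow> smooth_in U g"
  unfolding smooth_in_def using Ck_on_cong by blast

lemma smooth_in_local: "(\<And>x. x \<in> U \<Longrightarrow> \<exists>V. open V \<and> x \<in> V \<and> smooth_in V f) \<Longrightarrow> smooth_in U f"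
  unfolding smooth_in_def by (meson Ck_on_local)

lemma smooth_in_const [simp]: "open U \<Longrightarrow> smooth_in U (\<lambda>x. c)"
  by (simp add: smooth_in_def)

lemma smooth_in_bounded_linear: "open U \<Longrightarrow> bounded_linear f \<Longrightarrow> smooth_in U f"
  by (simp add: smooth_in_def Ck_on_bounded_linear)

lemma smooth_in_linear:
  fixes f :: "'a::euclidean_space \<Rightarrow> 'b::real_normed_vector"
  shows "open U \<Longrightarrow> linear f \<Longrightarrow> smooth_in U f"
  by (simp add: linear_conv_bounded_linear smooth_in_bounded_linear)

lemma smooth_in_add: "open U \<Longrightarrow> smooth_in U f \<Longrightarrow> smooth_in U g \<Longrightarrow> smooth_in U (\<lambda>x. f x + g x)"
  by (simp add: smooth_in_def Ck_on_add)

lemma smooth_in_sum: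
  "open U \<Longrightarrow> (\<And>i. i \<in> I \<Longrightarrow> smooth_in U (f i)) \<Longrightarrow> smooth_in U (\<lambda>x. \<Sum>i\<in>I. f i x)"
  by (simp add: smooth_in_def Ck_on_sum)

lemma smooth_in_bilinear:
  "bounded_bilinear p \<Longrightarrow> open U \<Longrightarrow> smooth_in U f \<Longrightarrow> smooth_in U g \<Longrightarrow> smooth_in U (\<lambda>x. p (f x) (g x))"
  by (simp add: smooth_in_def Ck_on_bilinear)

lemmas smooth_in_mult = smooth_in_bilinear[OF bounded_bilinear_mult]
  and smooth_in_scaleR = smooth_in_bilinear[OF bounded_bilinear_scaleR]
  and smooth_in_inner = smooth_in_bilinear[OF bounded_bilinear_inner]

lemma smooth_in_diff:
  assumes "open U" "smooth_in U f" "smooth_in U g"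
  shows "smooth_in U (\<lambda>x. f x - g x)"
proof -
  have "smooth_in U (\<lambda>x. f x + (-1) *\<^sub>R g x)"
    using assms by (intro smooth_in_add smooth_in_scaleR) auto
  then show ?thesis by simp
qed

lemma smooth_in_compose:
  fixes f :: "'a::real_normed_vector \<Rightarrow> 'b::euclidean_space"
  shows "open U \<Longrightarrow> open V \<Longrightarrow> f ` U \<subseteq> V \<Longrightarrow> smooth_in U f \<Longrightarrow> smooth_in V g \<Longrightarrow> smooth_in U (\<lambda>x. g (f x))"
  unfolding smooth_in_def using Ck_on_compose by blast

lemma smooth_in_divide:
  fixes f g :: "'a::real_normed_vector \<Rightarrow> real"
  assumes "open U" "smooth_in U f" "smooth_in U g" "\<And>x. x \<in> U \<Longrightarrow> g x \<noteq> 0"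
  shows "smooth_in U (\<lambda>x. f x / g x)"
proof -
  have "smooth_in U (\<lambda>x. inverse (g x))"
    by (rule smooth_in_compose[where V = "- {0}"])
      (use assms in \<open>auto simp: smooth_in_def Ck_on_inverse\<close>)
  then show ?thesis
    using assms by (simp add: divide_inverse smooth_in_mult)
qed

lemma smooth_in_has_derivative:
  "smooth_in U f \<Longrightarrow> x \<in> U \<Longrightarrow> (f has_derivative frechet_derivative f (at x)) (at x)"
  unfolding smooth_in_def using Ck_on_has_derivative by blast

lemma smooth_in_continuous_on: "smooth_in U f \<Longrightarrow> continuous_on U f"
  unfolding smooth_in_def using Ck_on.simps(1) by blast

lemma smooth_in_frechet_derivative:
  "smooth_in U f \<Longrightarrow> smooth_in U (\<lambda>x. frechet_derivative f (at x) v)"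
  unfolding smooth_in_def using Ck_on.simps(2) by blast

lemma smooth_on_iff:
  "smooth_on S f \<longleftrightarrow> (\<forall>x\<in>S. \<exists>U g. open U \<and> x \<in> U \<and> smooth_in U g \<and> (\<forall>y\<in>S \<inter> U. g y = f y))"
  by (simp add: smooth_on_def smooth_in_def)

section \<open>Bump functions\<close>

text \<open>The functions \<open>x\<^sup>-\<^sup>n exp(-1/x)\<close>, extended by \<open>0\<close> to
  \<open>x \<le> 0\<close>. The whole family is needed because the derivative of its
  \<open>n\<close>-th member is a linear combination of the members \<open>n + 1\<close> and
  \<open>n + 2\<close>.\<close>

definition flat_exp :: "nat \<Rightarrow> real \<Rightarrow> real"
  where "flat_exp n x = (if x > 0 then inverse x ^ n * exp (- inverse x) else 0)"

lemma flat_exp_tendsto_0: "(flat_exp n \<longlongrightarrow> 0) (at 0)"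
proof -
  have "((\<lambda>x. x ^ n / exp x) \<longlongrightarrow> (0::real)) at_top" by (rule tendsto_power_div_exp_0)
  then have "((\<lambda>x. inverse x ^ n / exp (inverse x)) \<longlongrightarrow> (0::real)) (at_right 0)"
    by (rule filterlim_compose[OF _ filterlim_inverse_at_top_right])
  moreover have "eventually (\<lambda>x. inverse x ^ n / exp (inverse x) = flat_exp n x) (at_right 0)"
    by (auto simp: flat_exp_def exp_minus divide_inverse eventually_at_filter)
  ultimately have r: "(flat_exp n \<longlongrightarrow> 0) (at_right 0)" by (rule Lim_transform_eventually)
  have "eventually (\<lambda>x. 0 = flat_exp n x) (at_left 0)"
    by (auto simp: flat_exp_def eventually_at_filter)
  then have "(flat_exp n \<longlongrightarrow> 0) (at_left 0)" by (rule Lim_transform_eventually[OF tendsto_const])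
  with r show ?thesis by (simp add: filterlim_split_at)
qed

lemma flat_exp_has_derivative:
  "(flat_exp n has_real_derivative (flat_exp (n + 2) x - of_nat n * flat_exp (n + 1) x)) (at x)"
proof -
  consider "x < 0" | "x = 0" | "x > 0" by linarith
  then show ?thesis
  proof cases
    case 1
    have "((\<lambda>x. 0) has_real_derivative 0) (at x)" by simp
    then have "(flat_exp n has_real_derivative 0) (at x)"
      by (rule DERIV_cong_ev[THEN iffD1, rotated -1])
        (use 1 in \<open>auto simp: flat_exp_def eventually_nhds intro!: exI[of _ "{..<0}"]\<close>)
    then show ?thesis using 1 by (simp add: flat_exp_def)
  next
    case 2
    have "((\<lambda>y. (flat_exp n y - flat_exp n 0) / (y - 0)) \<longlongrightarrow> 0) (at 0)"
      by (rule Lim_transform_eventually[OF flat_exp_tendsto_0[of "Suc n"]])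
        (auto simp: flat_exp_def eventually_at_filter divide_inverse)
    then have "(flat_exp n has_real_derivative 0) (at 0)"
      by (simp add: has_field_derivative_iff)
    then show ?thesis using 2 by (simp add: flat_exp_def)
  next
    case 3
    have "((\<lambda>x. inverse x ^ n * exp (- inverse x)) has_real_derivative
        (of_nat n * (- (inverse x ^ (n + 1))) * exp (- inverse x) + inverse x ^ (n + 2) * exp (- inverse x))) (at x)"
      using 3
      by (cases n) (auto intro!: derivative_eq_intros simp: field_simps power2_eq_square power_add,
        metis One_nat_def gr0I mult.commute power_minus_mult)
    then have "(flat_exp n has_real_derivative
        (of_nat n * (- (inverse x ^ (n + 1))) * exp (- inverse x) + inverse x ^ (n + 2) * exp (- inverse x))) (at x)"
      by (rule DERIV_cong_ev[THEN iffD1, rotated -1])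
        (use 3 in \<open>auto simp: flat_exp_def eventually_nhds intro!: exI[of _ "{0<..}"]\<close>)
    then show ?thesis using 3 by (simp add: flat_exp_def algebra_simps)
  qed
qed

lemma smooth_in_flat_exp: "smooth_in UNIV (flat_exp n)"
proof -
  have "Ck_on k UNIV (flat_exp n)" for k
  proof (induction k arbitrary: n)
    case 0
    then show ?case
      using flat_exp_has_derivative[THEN DERIV_isCont] by (simp add: continuous_at_imp_continuous_on)
  next
    case (Suc k)
    have "Ck_on k UNIV (\<lambda>x. (flat_exp (n + 2) x + (- of_nat n) * flat_exp (n + 1) x) * v)" for v
      by (intro Ck_on_bilinear[OF bounded_bilinear_mult] Ck_on_add Suc Ck_on_const open_UNIV)
    then show ?case
      by (intro Ck_on_SucI[OF open_UNIV flat_exp_has_derivative[unfolded has_field_derivative_def]]) simp_all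
  qed
  then show ?thesis by (simp add: smooth_in_def)
qed

text \<open>The quotient \<open>p / (p + q)\<close>, where \<open>p\<close> vanishes outside the large ball
  and \<open>q\<close> inside the small one, and where \<open>p\<close> and \<open>q\<close> have
  no common zero.\<close>

lemma bump_function:
  fixes x0 :: "'a::euclidean_space"
  assumes "\<rho> > 0"
  obtains b :: "'a \<Rightarrow> real" where "smooth_in UNIV b"
    "\<And>x. x \<in> ball x0 (\<rho> / 2) \<Longrightarrow> b x = 1" "\<And>x. x \<notin> ball x0 \<rho> \<Longrightarrow> b x = 0"
proof -
  let ?e = "flat_exp 0"
  let ?d = "\<lambda>x::'a. (x - x0) \<bullet> (x - x0)"
  let ?p = "\<lambda>x. ?e (\<rho>\<^sup>2 - ?d x)" and ?q = "\<lambda>x. ?e (?d x - (\<rho> / 2)\<^sup>2)"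
  have d: "?d x = (dist x0 x)\<^sup>2" for x
    by (simp add: dist_norm power2_norm_eq_inner inner_diff_left inner_diff_right inner_commute)
  have lt: "(dist x0 x)\<^sup>2 < r\<^sup>2 \<longleftrightarrow> dist x0 x < r" if "r > 0" for r x
    using that by (auto intro: power_strict_mono power_less_imp_less_base[of _ 2])
  have sd: "smooth_in UNIV ?d"
    by (intro smooth_in_inner smooth_in_diff smooth_in_const smooth_in_bounded_linear bounded_linear_ident open_UNIV)
  have sp: "smooth_in UNIV ?p" and sq: "smooth_in UNIV ?q"
    by (rule smooth_in_compose[where V = UNIV and g = ?e]; intro smooth_in_flat_exp smooth_in_diff smooth_in_const sd open_UNIV subset_UNIV)+
  have nn: "?p x \<ge> 0" "?q x \<ge> 0" for x by (simp_all add: flat_exp_def)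
  have pos: "?p x + ?q x > 0" for x
  proof (cases "dist x0 x < \<rho>")
    case True
    then have "?p x > 0" using lt[OF assms] d by (simp add: flat_exp_def)
    then show ?thesis using nn(2)[of x] by linarith
  next
    case False
    then have "(\<rho> / 2)\<^sup>2 < (dist x0 x)\<^sup>2"
      using assms by (intro power_strict_mono) auto
    then have "?q x > 0" using d by (simp add: flat_exp_def)
    then show ?thesis using nn(1)[of x] by linarith
  qed
  show thesis
  proof (rule that[of "\<lambda>x. ?p x / (?p x + ?q x)"])
    show "smooth_in UNIV (\<lambda>x. ?p x / (?p x + ?q x))"
      by (intro smooth_in_divide smooth_in_add sp sq open_UNIV) (use pos in \<open>simp add: less_imp_neq[symmetric] pos_less_minus_divide_eq\<close>)
    show "?p x / (?p x + ?q x) = 1" if "x \<in> ball x0 (\<rho> / 2)" for x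
    proof -
      have "?q x = 0" using that lt[of "\<rho>/2" x] assms d by (auto simp: flat_exp_def)
      then show ?thesis using pos[of x] by simp
    qed
    show "?p x / (?p x + ?q x) = 0" if "x \<notin> ball x0 \<rho>" for x
    proof -
      have "?p x = 0" using that lt[of \<rho> x] assms d by (auto simp: flat_exp_def)
      then show ?thesis by simp
    qed
  qed
qed

lemma bump_times_smooth:
  fixes u :: "'a::euclidean_space \<Rightarrow> real"
  assumes "smooth_in UNIV b" "smooth_in (ball x0 (2 * \<rho>)) u" "\<rho> > 0" "\<And>x. x \<notin> ball x0 \<rho> \<Longrightarrow> b x = 0"
  shows "smooth_in UNIV (\<lambda>x. b x * u x)"
proof (rule smooth_in_local)
  fix x :: 'a
  show "\<exists>V. open V \<and> x \<in> V \<and> smooth_in V (\<lambda>x. b x * u x)"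
  proof (cases "x \<in> ball x0 (2 * \<rho>)")
    case True
    then show ?thesis
      by (intro exI[of _ "ball x0 (2 * \<rho>)"] conjI smooth_in_mult assms smooth_in_subset[OF assms(1)]) auto
  next
    case False
    have "smooth_in (- cball x0 \<rho>) (\<lambda>x. b x * u x)"
      using assms(4) by (subst smooth_in_cong[where g = "\<lambda>x. 0"]) (auto simp: open_Compl)
    then show ?thesis using False assms(3) by (intro exI[of _ "- cball x0 \<rho>"]) auto
  qed
qed

section \<open>Hadamard's lemma\<close>

text \<open>Differentiation under the integral sign. The weight \<open>c\<close> makes the induction work: a
  derivative of the integrand brings out a factor \<open>t\<close>, which turns \<open>c\<close>
  into another continuous weight.\<close>

lemma Ck_on_integral_scaled:
  fixes h :: "'a::euclidean_space \<Rightarrow> real"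
  assumes "continuous_on {0..1} c" "Ck_on k (ball x0 \<rho>) h"
  shows "Ck_on k (ball x0 \<rho>) (\<lambda>x. integral {0..1} (\<lambda>t. c t * h (x0 + t *\<^sub>R (x - x0))))"
  using assms
proof (induction k arbitrary: c h)
  case 0
  have "continuous_on (ball x0 \<rho>) (\<lambda>x. integral (cbox 0 1) (\<lambda>t. c t * h (x0 + t *\<^sub>R (x - x0))))"
  proof (rule integral_continuous_on_param)
    have "continuous_on (ball x0 \<rho> \<times> {0..1}) (\<lambda>z. h (x0 + snd z *\<^sub>R (fst z - x0)))"
    proof (rule continuous_on_compose2[where t = "ball x0 \<rho>" and g = h])
      show "(\<lambda>z. x0 + snd z *\<^sub>R (fst z - x0)) ` (ball x0 \<rho> \<times> {0..1}) \<subseteq> ball x0 \<rho>"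
      proof clarsimp
        fix x t assume "dist x0 x < \<rho>" "0 \<le> t" "t \<le> (1::real)"
        then show "dist x0 (x0 + t *\<^sub>R (x - x0)) < \<rho>"
          by (simp add: dist_norm norm_minus_commute)
            (metis mult_left_le_one_le norm_ge_zero order_le_less_trans)
      qed
    qed (use 0 in \<open>auto intro!: continuous_intros\<close>)
    moreover have "continuous_on (ball x0 \<rho> \<times> {0..1}) (\<lambda>z. c (snd z))"
      by (rule continuous_on_compose2[OF 0(1)]) (auto intro!: continuous_intros)
    ultimately show "continuous_on (ball x0 \<rho> \<times> cbox 0 1) (\<lambda>(x, t). c t * h (x0 + t *\<^sub>R (x - x0)))"
      by (auto simp: split_beta intro!: continuous_intros)
  qed
  then show ?case by (simp add: cbox_interval)
next
  case (Suc k)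
  let ?B = "ball x0 \<rho>"
  have inB: "x0 + t *\<^sub>R (x - x0) \<in> ?B" if "x \<in> ?B" "t \<in> {0..1}" for x t
    using that by (simp add: dist_norm norm_minus_commute)
      (metis mult_left_le_one_le norm_ge_zero order_le_less_trans)
  have hcont: "continuous_on ?B h" by (rule Ck_on_continuous_on[OF Suc.prems(2)])
  let ?h' = "\<lambda>v x. frechet_derivative h (at x) v"
  have bl: "bounded_linear (frechet_derivative h (at x))" if "x \<in> ?B" for x
    using Ck_on_has_derivative[OF Suc.prems(2) that] by (rule has_derivative_bounded_linear)
  have h'k: "Ck_on k ?B (?h' v)" for v using Suc.prems(2) by simp
  have h'0: "continuous_on ?B (?h' v)" for v by (rule Ck_on_continuous_on[OF h'k])
  let ?D = "\<lambda>x t v. c t * (t * ?h' v (x0 + t *\<^sub>R (x - x0)))"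
  have blD: "bounded_linear (?D x t)" if "x \<in> ?B" "t \<in> {0..1}" for x t
    using bl[OF inB[OF that]] by (intro bounded_linear_intros)
  let ?F = "\<lambda>x t. Blinfun (?D x t)"
  have F: "blinfun_apply (?F x t) = ?D x t" if "x \<in> ?B" "t \<in> {0..1}" for x t
    using blD[OF that] by (rule bounded_linear_Blinfun_apply)
  have der: "((\<lambda>x. c t * h (x0 + t *\<^sub>R (x - x0))) has_derivative ?D x t) (at x)"
    if "x \<in> ?B" "t \<in> {0..1}" for x t
  proof -
    interpret bounded_linear "frechet_derivative h (at (x0 + t *\<^sub>R (x - x0)))"
      using bl[OF inB[OF that]] .
    have "((\<lambda>x. x0 + t *\<^sub>R (x - x0)) has_derivative (\<lambda>v. t *\<^sub>R v)) (at x)"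
      by (auto intro!: derivative_eq_intros)
    from diff_chain_at[OF this Ck_on_has_derivative[OF Suc.prems(2) inB[OF that]]]
    have "((\<lambda>x. h (x0 + t *\<^sub>R (x - x0))) has_derivative (\<lambda>v. t * ?h' v (x0 + t *\<^sub>R (x - x0)))) (at x)"
      by (simp add: o_def scaleR)
    then show ?thesis by (auto intro!: derivative_eq_intros)
  qed
  have contc: "continuous_on (?B \<times> {0..1}) (\<lambda>z. c (snd z))"
    by (rule continuous_on_compose2[OF Suc.prems(1)]) (auto intro!: continuous_intros)
  have contg: "continuous_on (?B \<times> {0..1}) (\<lambda>z. g (x0 + snd z *\<^sub>R (fst z - x0)))"
    if "continuous_on ?B g" for g :: "'a \<Rightarrow> real"
    by (rule continuous_on_compose2[OF that]) (use inB in \<open>auto intro!: continuous_intros\<close>)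
  have L: "((\<lambda>x. integral (cbox 0 1) (\<lambda>t. c t * h (x0 + t *\<^sub>R (x - x0)))) has_derivative
      blinfun_apply (integral (cbox 0 1) (?F x))) (at x within ?B)" if "x \<in> ?B" for x
  proof (rule leibniz_rule[OF _ _ _ that convex_ball])
    show "((\<lambda>x. c t * h (x0 + t *\<^sub>R (x - x0))) has_derivative blinfun_apply (?F x t)) (at x within ?B)"
      if "x \<in> ?B" "t \<in> cbox 0 1" for x t
      using der[OF that(1)] F[OF that(1)] that(2) by (auto intro: has_derivative_at_withinI)
    show "(\<lambda>t. c t * h (x0 + t *\<^sub>R (x - x0))) integrable_on cbox 0 1" if "x \<in> ?B" for x
      using Suc.prems(1) inB[OF that]
      by (intro integrable_continuous continuous_on_mult continuous_on_compose2[OF hcont])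
         (auto intro!: continuous_intros)
    have "continuous_on (?B \<times> {0..1}) (\<lambda>z. ?F (fst z) (snd z))"
    proof (rule continuous_on_blinfun_componentwise)
      fix i :: 'a assume "i \<in> Basis"
      have "continuous_on (?B \<times> {0..1}) (\<lambda>z. ?D (fst z) (snd z) i)"
        by (intro continuous_intros contc contg h'0)
      then show "continuous_on (?B \<times> {0..1}) (\<lambda>z. blinfun_apply (?F (fst z) (snd z)) i)"
        by (rule continuous_on_eq) (auto simp: F)
    qed
    then show "continuous_on (?B \<times> cbox 0 1) (\<lambda>(x, t). ?F x t)"
      by (simp add: split_beta)
  qed
  have intF: "blinfun_apply (integral (cbox 0 1) (?F x)) v =
      integral {0..1} (\<lambda>t. (c t * t) * ?h' v (x0 + t *\<^sub>R (x - x0)))" if "x \<in> ?B" for x v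
  proof -
    have "continuous_on {0..1} (?F x)"
    proof (rule continuous_on_blinfun_componentwise)
      fix i :: 'a assume "i \<in> Basis"
      have "continuous_on {0..1} (\<lambda>t. ?D x t i)"
        using Suc.prems(1) inB[OF that]
        by (intro continuous_on_mult continuous_on_id continuous_on_compose2[OF h'0]) (auto intro!: continuous_intros)
      then show "continuous_on {0..1} (\<lambda>t. blinfun_apply (?F x t) i)"
        by (rule continuous_on_eq) (simp add: fun_cong[OF F[OF that]])
    qed
    then have "?F x integrable_on cbox 0 1" by (intro integrable_continuous) simp
    then have "blinfun_apply (integral (cbox 0 1) (?F x)) v = integral (cbox 0 1) (\<lambda>t. blinfun_apply (?F x t) v)"
      by (rule blinfun_apply_integral)
    also have "\<dots> = integral {0..1} (\<lambda>t. (c t * t) * ?h' v (x0 + t *\<^sub>R (x - x0)))"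
      unfolding cbox_interval by (rule integral_cong) (simp add: fun_cong[OF F[OF that]] mult.assoc)
    finally show ?thesis .
  qed
  have "Ck_on k ?B (\<lambda>x. integral {0..1} (\<lambda>t. (c t * t) * ?h' v (x0 + t *\<^sub>R (x - x0))))" for v
    by (rule Suc.IH[OF _ h'k]) (use Suc.prems(1) in \<open>auto intro!: continuous_intros\<close>)
  then have "Ck_on k ?B (\<lambda>x. blinfun_apply (integral (cbox 0 1) (?F x)) v)" for v
    by (subst Ck_on_cong[OF open_ball intF]) auto
  moreover have "((\<lambda>x. integral (cbox 0 1) (\<lambda>t. c t * h (x0 + t *\<^sub>R (x - x0)))) has_derivative
      blinfun_apply (integral (cbox 0 1) (?F x))) (at x)" if "x \<in> ?B" for x
    using L[OF that] at_within_open[OF that open_ball] by simp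
  ultimately have "Ck_on (Suc k) ?B (\<lambda>x. integral (cbox 0 1) (\<lambda>t. c t * h (x0 + t *\<^sub>R (x - x0))))"
    by (rule Ck_on_SucI[OF open_ball, rotated])
  then show ?case unfolding cbox_interval .
qed

text \<open>The fundamental theorem of calculus along the segment from \<open>x0\<close> to
  \<open>x\<close>, with \<open>G b x = \<integral>\<^sub>0\<^sup>1 (\<partial>\<^sub>b f)(x0 + t
  (x - x0)) dt\<close>.\<close>

lemma hadamard:
  fixes f :: "'a::euclidean_space \<Rightarrow> real"
  assumes "smooth_in (ball x0 \<rho>) f" "\<rho> > 0"
  obtains G where "\<And>b. smooth_in (ball x0 \<rho>) (G b)"
    "\<And>b. G b x0 = frechet_derivative f (at x0) b"
    "\<And>x. x \<in> ball x0 \<rho> \<Longrightarrow> f x = f x0 + (\<Sum>b\<in>Basis. ((x - x0) \<bullet> b) * G b x)"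
proof -
  let ?B = "ball x0 \<rho>"
  let ?f' = "\<lambda>v x. frechet_derivative f (at x) v"
  define G where "G b x = integral {0..1} (\<lambda>t. 1 * ?f' b (x0 + t *\<^sub>R (x - x0)))" for b x
  have "smooth_in ?B (G b)" for b
  proof -
    have "Ck_on k ?B (G b)" for k
      unfolding G_def
      by (rule Ck_on_integral_scaled[OF continuous_on_const])
        (use smooth_in_frechet_derivative[OF assms(1), of b] in \<open>simp only: smooth_in_def\<close>)
    then show ?thesis unfolding smooth_in_def by blast
  qed
  moreover have "G b x0 = frechet_derivative f (at x0) b" for b
    by (simp add: G_def)
  moreover have "f x = f x0 + (\<Sum>b\<in>Basis. ((x - x0) \<bullet> b) * G b x)" if x: "x \<in> ?B" for x
  proof -
    have inB: "x0 + t *\<^sub>R (x - x0) \<in> ?B" if "t \<in> {0..1}" for t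
      using that x by (simp add: dist_norm norm_minus_commute)
        (metis mult_left_le_one_le norm_ge_zero order_le_less_trans)
    have ci: "(\<lambda>t. ?f' b (x0 + t *\<^sub>R (x - x0))) integrable_on {0..1}" for b
      using inB by (intro integrable_continuous_interval
        continuous_on_compose2[OF smooth_in_continuous_on[OF smooth_in_frechet_derivative[OF assms(1), of b]]])
        (auto intro!: continuous_intros)
    have "((\<lambda>t. f (x0 + t *\<^sub>R (x - x0))) has_vector_derivative ?f' (x - x0) (x0 + t *\<^sub>R (x - x0))) (at t within {0..1})"
      if t: "t \<in> {0..1}" for t
    proof -
      have "((\<lambda>t. x0 + t *\<^sub>R (x - x0)) has_derivative (\<lambda>s. s *\<^sub>R (x - x0))) (at t)"
        by (auto intro!: derivative_eq_intros)
      from diff_chain_at[OF this smooth_in_has_derivative[OF assms(1) inB[OF t]]]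
      have "((\<lambda>t. f (x0 + t *\<^sub>R (x - x0))) has_derivative (\<lambda>s. ?f' (s *\<^sub>R (x - x0)) (x0 + t *\<^sub>R (x - x0)))) (at t)"
        by (simp add: o_def)
      then show ?thesis
        using linear_cmul[OF has_derivative_linear[OF smooth_in_has_derivative[OF assms(1) inB[OF t]]]]
        by (auto simp: has_vector_derivative_def intro: has_derivative_at_withinI)
    qed
    then have "((\<lambda>t. ?f' (x - x0) (x0 + t *\<^sub>R (x - x0))) has_integral f x - f x0) {0..1}"
      using fundamental_theorem_of_calculus[of 0 1 "\<lambda>t. f (x0 + t *\<^sub>R (x - x0))"] by simp
    then have "f x - f x0 = integral {0..1} (\<lambda>t. ?f' (x - x0) (x0 + t *\<^sub>R (x - x0)))"
      by (simp add: integral_unique)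
    also have "\<dots> = integral {0..1} (\<lambda>t. \<Sum>b\<in>Basis. ((x - x0) \<bullet> b) * ?f' b (x0 + t *\<^sub>R (x - x0)))"
    proof (rule integral_cong)
      fix t :: real assume t: "t \<in> {0..1}"
      have l: "linear (frechet_derivative f (at (x0 + t *\<^sub>R (x - x0))))"
        using has_derivative_linear[OF smooth_in_has_derivative[OF assms(1) inB[OF t]]] .
      show "?f' (x - x0) (x0 + t *\<^sub>R (x - x0)) = (\<Sum>b\<in>Basis. ((x - x0) \<bullet> b) * ?f' b (x0 + t *\<^sub>R (x - x0)))"
        by (subst euclidean_representation[symmetric, of "x - x0"])
          (simp only: linear_sum[OF l] linear_cmul[OF l] real_scaleR_def)
    qed
    also have "\<dots> = (\<Sum>b\<in>Basis. ((x - x0) \<bullet> b) * G b x)"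
    proof -
      have "(\<lambda>t. a * ?f' b (x0 + t *\<^sub>R (x - x0))) integrable_on {0..1}" for a b
        using integrable_cmul[OF ci, of a b] by simp
      then show ?thesis unfolding G_def by (simp add: integral_sum)
    qed
    finally show ?thesis by simp
  qed
  ultimately show thesis using that by blast
qed

section \<open>Charts and smooth functions on manifolds\<close>

lemma max_atlasD:
  assumes "(U, \<phi>) \<in> max_atlas M"
  shows "openin (topol M) U" "U \<subseteq> carr M" "openin (top_of_set (model M)) (\<phi> ` U)"
    "\<phi> ` U \<subseteq> model M" "inj_on \<phi> U"
    "homeomorphic_map (subtopology (topol M) U) (top_of_set (\<phi> ` U)) \<phi>"
proof -
  show 1: "openin (topol M) U" and 2: "openin (top_of_set (model M)) (\<phi> ` U)"
    and 3: "homeomorphic_map (subtopology (topol M) U) (top_of_set (\<phi> ` U)) \<phi>"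
    using assms by (auto simp: max_atlas_def is_chart_def)
  show 4: "U \<subseteq> carr M" using 1 by (rule openin_subset)
  show "\<phi> ` U \<subseteq> model M" using openin_subset[OF 2] by simp
  show "inj_on \<phi> U" using 3 4 by (simp add: homeomorphic_eq_everything_map inf.absorb2)
qed

lemma smooth_manifoldD:
  assumes "smooth_manifold M"
  shows "subspace (model M)" "Hausdorff_space (topol M)" "second_countable (topol M)"
    "\<And>c. c \<in> atlas M \<Longrightarrow> is_chart M c"
    "\<And>c d. c \<in> atlas M \<Longrightarrow> d \<in> atlas M \<Longrightarrow> compatible c d"
    "(\<Union>c\<in>atlas M. fst c) = carr M"
  using assms by (auto simp: smooth_manifold_def)

lemma atlas_subset_max_atlas: "smooth_manifold M \<Longrightarrow> atlas M \<subseteq> max_atlas M"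
  by (auto simp: smooth_manifold_def max_atlas_def)

lemma chart_at:
  assumes "smooth_manifold M" "p \<in> carr M"
  obtains U \<phi> where "(U, \<phi>) \<in> atlas M" "(U, \<phi>) \<in> max_atlas M" "p \<in> U"
proof -
  obtain c where "c \<in> atlas M" "p \<in> fst c"
    using assms(2) smooth_manifoldD(6)[OF assms(1)] by blast
  then show thesis using that[of "fst c" "snd c"] atlas_subset_max_atlas[OF assms(1)] by auto
qed

lemma chart_preimage_open:
  assumes "(U, \<phi>) \<in> max_atlas M" "open B"
  shows "openin (topol M) {q \<in> U. \<phi> q \<in> B}"
proof -
  note c = max_atlasD[OF assms(1)]
  have "continuous_map (subtopology (topol M) U) (top_of_set (\<phi> ` U)) \<phi>"
    using c(6) by (rule homeomorphic_imp_continuous_map)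
  moreover have "openin (top_of_set (\<phi> ` U)) (\<phi> ` U \<inter> B)"
    using assms(2) by (simp add: openin_open_Int)
  ultimately have "openin (subtopology (topol M) U) {q \<in> topspace (subtopology (topol M) U). \<phi> q \<in> \<phi> ` U \<inter> B}"
    by (rule openin_continuous_map_preimage)
  moreover have "{q \<in> topspace (subtopology (topol M) U). \<phi> q \<in> \<phi> ` U \<inter> B} = {q \<in> U. \<phi> q \<in> B}"
    using c(2) by auto
  ultimately show ?thesis using c(1) by (simp add: openin_open_subtopology)
qed

lemma chart_image_open:
  assumes "(U, \<phi>) \<in> max_atlas M" "openin (topol M) V"
  shows "openin (top_of_set (model M)) (\<phi> ` (U \<inter> V))"
proof -
  note c = max_atlasD[OF assms(1)]
  have "openin (subtopology (topol M) U) (U \<inter> V)"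
    using assms(2) by (rule openin_subtopology_Int2)
  then have "openin (top_of_set (\<phi> ` U)) (\<phi> ` (U \<inter> V))"
    using homeomorphic_imp_open_map[OF c(6)] by (simp add: open_map_def)
  then show ?thesis using c(3) openin_trans by blast
qed

lemma chart_ball:
  assumes "(U, \<phi>) \<in> max_atlas M" "openin (topol M) V" "q \<in> U" "q \<in> V"
  obtains \<rho> where "\<rho> > 0" "cball (\<phi> q) \<rho> \<inter> model M \<subseteq> \<phi> ` (U \<inter> V)"
proof -
  have "\<phi> q \<in> \<phi> ` (U \<inter> V)" using assms by auto
  then obtain e where e: "e > 0" "ball (\<phi> q) e \<inter> model M \<subseteq> \<phi> ` (U \<inter> V)"
    using chart_image_open[OF assms(1,2)] unfolding openin_contains_ball by blast
  then show thesis by (intro that[of "e / 2"]) (auto simp: subset_iff)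
qed

text \<open>Smoothness of \<open>f\<close> on \<open>S\<close> at the point \<open>q\<close>, read in one
  chart: near \<open>q\<close>, on \<open>S\<close>, the function factors through the coordinate
  map by a function that is smooth on an open subset of the ambient Euclidean space. Stated with
  \<open>snd c y\<close> for points \<open>y\<close>, it does without the inverses of coordinate
  maps.\<close>

definition smooth_near :: "'p set \<times> ('p \<Rightarrow> 'a::euclidean_space) \<Rightarrow> 'p set \<Rightarrow> ('p \<Rightarrow> 'b::real_normed_vector) \<Rightarrow> 'p \<Rightarrow> bool"
  where "smooth_near c S f q \<longleftrightarrow> (\<exists>B g. open B \<and> snd c q \<in> B \<and> smooth_in B g \<and>
    (\<forall>y\<in>fst c \<inter> S. snd c y \<in> B \<longrightarrow> f y = g (snd c y)))"

lemma smooth_nearI: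
  assumes "open B" "\<phi> q \<in> B" "smooth_in B g" "\<And>y. y \<in> U \<Longrightarrow> y \<in> S \<Longrightarrow> \<phi> y \<in> B \<Longrightarrow> f y = g (\<phi> y)"
  shows "smooth_near (U, \<phi>) S f q"
  using assms unfolding smooth_near_def by (intro exI[of _ B] exI[of _ g]) auto

lemma smooth_nearE:
  assumes "smooth_near (U, \<phi>) S f q"
  obtains B g where "open B" "\<phi> q \<in> B" "smooth_in B g"
    "\<And>y. y \<in> U \<Longrightarrow> y \<in> S \<Longrightarrow> \<phi> y \<in> B \<Longrightarrow> f y = g (\<phi> y)"
  using assms unfolding smooth_near_def by auto

lemma smooth_on_chart_iff:
  assumes "inj_on \<phi> U"
  shows "smooth_on (\<phi> ` (U \<inter> S)) (f \<circ> inv_into U \<phi>) \<longleftrightarrow> (\<forall>q\<in>U \<inter> S. smooth_near (U, \<phi>) S f q)"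
proof -
  have "(\<forall>y\<in>\<phi> ` (U \<inter> S) \<inter> B. g y = (f \<circ> inv_into U \<phi>) y) \<longleftrightarrow>
      (\<forall>y\<in>U \<inter> S. \<phi> y \<in> B \<longrightarrow> f y = g (\<phi> y))" for B :: "'b set" and g
    using assms by auto
  then show ?thesis
    unfolding smooth_on_iff smooth_near_def by auto
qed

lemma compatible_iff:
  assumes "inj_on \<phi> U" "inj_on \<psi> V"
  shows "compatible (U, \<phi>) (V, \<psi>) \<longleftrightarrow>
    (\<forall>q\<in>U \<inter> V. smooth_near (U, \<phi>) V \<psi> q \<and> smooth_near (V, \<psi>) U \<phi> q)"
proof -
  have "\<psi> ` (U \<inter> V) = \<psi> ` (V \<inter> U)" by (simp add: Int_commute)
  then show ?thesis
    unfolding compatible_def prod.case smooth_on_chart_iff[OF assms(1), symmetric]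
    using smooth_on_chart_iff[OF assms(1), of V \<psi>] smooth_on_chart_iff[OF assms(2), of U \<phi>] by auto
qed

lemma smooth_near_mono:
  assumes "smooth_near (U, \<phi>) S f q" "U' \<inter> S' \<subseteq> U \<inter> S"
  shows "smooth_near (U', \<phi>) S' f q"
  using assms unfolding smooth_near_def by (metis (no_types, lifting) fst_conv snd_conv subsetD)

text \<open>The chain rule for germs: \<open>\<pi>\<close> is smooth at \<open>q\<close> and
  \<open>f\<close> is smooth at \<open>\<pi> q\<close>. For \<open>\<pi>\<close> the identity this
  compares two charts of one manifold.\<close>

lemma smooth_near_compose_map:
  fixes \<psi> :: "'p \<Rightarrow> 'a::euclidean_space" and \<phi> :: "'q \<Rightarrow> 'b::euclidean_space" and \<pi> :: "'p \<Rightarrow> 'q"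
  assumes f: "smooth_near (U, \<phi>) S f (\<pi> q)" and \<phi>: "smooth_near (V, \<psi>) T (\<lambda>y. \<phi> (\<pi> y)) q"
    and B: "open B" "\<psi> q \<in> B"
      "\<And>y. y \<in> V \<Longrightarrow> y \<in> S' \<Longrightarrow> \<psi> y \<in> B \<Longrightarrow> y \<in> T \<and> \<pi> y \<in> U \<and> \<pi> y \<in> S"
    and q: "q \<in> V" "q \<in> T"
  shows "smooth_near (V, \<psi>) S' (\<lambda>y. f (\<pi> y)) q"
proof -
  obtain B1 g where g: "open B1" "\<phi> (\<pi> q) \<in> B1" "smooth_in B1 g"
    "\<And>y. y \<in> U \<Longrightarrow> y \<in> S \<Longrightarrow> \<phi> y \<in> B1 \<Longrightarrow> f y = g (\<phi> y)"
    using f by (rule smooth_nearE) blast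
  obtain B2 h where h: "open B2" "\<psi> q \<in> B2" "smooth_in B2 h"
    "\<And>y. y \<in> V \<Longrightarrow> y \<in> T \<Longrightarrow> \<psi> y \<in> B2 \<Longrightarrow> \<phi> (\<pi> y) = h (\<psi> y)"
    using \<phi> by (rule smooth_nearE) blast
  have B3: "open (B2 \<inter> h -` B1)"
    using continuous_on_open_vimage[OF h(1)] smooth_in_continuous_on[OF h(3)] g(1) by (metis Int_commute)
  show ?thesis
  proof (rule smooth_nearI[where g = "\<lambda>x. g (h x)"])
    show "open (B \<inter> (B2 \<inter> h -` B1))" using B(1) B3 by (rule open_Int)
    show "\<psi> q \<in> B \<inter> (B2 \<inter> h -` B1)" using B(2) h(2,4) g(2) q by (auto simp: h(4)[symmetric])
    have "smooth_in (B2 \<inter> h -` B1) (\<lambda>x. g (h x))"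
      by (rule smooth_in_compose[OF B3 g(1) _ smooth_in_subset[OF h(3)] g(3)]) auto
    then show "smooth_in (B \<inter> (B2 \<inter> h -` B1)) (\<lambda>x. g (h x))" by (rule smooth_in_subset) auto
    show "f (\<pi> y) = g (h (\<psi> y))" if "y \<in> V" "y \<in> S'" "\<psi> y \<in> B \<inter> (B2 \<inter> h -` B1)" for y
      using that B(3)[of y] h(4)[of y] g(4)[of "\<pi> y"] by auto
  qed
qed

lemmas smooth_near_compose = smooth_near_compose_map[where \<pi> = "\<lambda>x. x"]

text \<open>Every neighbourhood of a point is described by an open condition on the coordinates, so that
  germs on the manifold and germs in the ambient Euclidean space correspond.\<close>

lemma chart_nbhd:
  assumes "(U, \<phi>) \<in> max_atlas M" "openin (topol M) V" "q \<in> U" "q \<in> V"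
  obtains B where "open B" "\<phi> q \<in> B" "\<And>y. y \<in> U \<Longrightarrow> \<phi> y \<in> B \<Longrightarrow> y \<in> V"
proof -
  obtain B where "open B" "\<phi> ` (U \<inter> V) = model M \<inter> B"
    using chart_image_open[OF assms(1,2)] by (auto simp: openin_open)
  moreover have "y \<in> V" if "y \<in> U" "\<phi> y \<in> \<phi> ` (U \<inter> V)" for y
    using that max_atlasD(5)[OF assms(1)] by (auto dest: inj_onD)
  ultimately show thesis
    using assms(3,4) max_atlasD(4)[OF assms(1)] by (intro that[of B]) (auto simp: subset_iff)
qed

text \<open>Charts of the maximal atlas are compatible with the atlas by definition; with each other they
  are so by passing through a chart of the atlas.\<close>

lemma max_atlas_smooth_near:
  assumes "smooth_manifold M" "(U, \<phi>) \<in> max_atlas M" "(V, \<psi>) \<in> max_atlas M" "q \<in> U" "q \<in> V"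
  shows "smooth_near (U, \<phi>) V \<psi> q"
proof -
  note u = max_atlasD[OF assms(2)] and v = max_atlasD[OF assms(3)]
  obtain A \<alpha> where A: "(A, \<alpha>) \<in> atlas M" "(A, \<alpha>) \<in> max_atlas M" "q \<in> A"
    using chart_at[OF assms(1), of q] u(2) assms(4) by blast
  note a = max_atlasD[OF A(2)]
  have "compatible (U, \<phi>) (A, \<alpha>)" "compatible (V, \<psi>) (A, \<alpha>)"
    using A(1) assms(2,3) by (auto simp: max_atlas_def)
  then have 1: "smooth_near (U, \<phi>) A \<alpha> q" and 2: "smooth_near (A, \<alpha>) V \<psi> q"
    using assms(4,5) A(3) compatible_iff[OF u(5) a(5)] compatible_iff[OF v(5) a(5)] by auto
  obtain B where "open B" "\<phi> q \<in> B" "\<And>y. y \<in> U \<Longrightarrow> \<phi> y \<in> B \<Longrightarrow> y \<in> A"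
    using chart_nbhd[OF assms(2) a(1) assms(4) A(3)] by blast
  then show ?thesis
    by (intro smooth_near_compose[OF 2 1]) (use assms A in auto)
qed

lemma smooth_near_change_chart:
  assumes "smooth_manifold M" "(U, \<phi>) \<in> max_atlas M" "(V, \<psi>) \<in> max_atlas M" "q \<in> U" "q \<in> V"
    and "smooth_near (U, \<phi>) S f q"
  shows "smooth_near (V, \<psi>) S f q"
proof -
  obtain B where "open B" "\<psi> q \<in> B" "\<And>y. y \<in> V \<Longrightarrow> \<psi> y \<in> B \<Longrightarrow> y \<in> U"
    using chart_nbhd[OF assms(3) max_atlasD(1)[OF assms(2)] assms(5,4)] by blast
  then show ?thesis
    by (intro smooth_near_compose[OF assms(6) max_atlas_smooth_near[OF assms(1,3,2,5,4)]])
      (use assms in auto)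
qed

lemma smooth_fun_on_iff:
  assumes "smooth_manifold M" "S \<subseteq> carr M"
  shows "smooth_fun_on M S f \<longleftrightarrow> (\<forall>q\<in>S. \<forall>c\<in>max_atlas M. q \<in> fst c \<longrightarrow> smooth_near c S f q)"
    and "smooth_fun_on M S f \<longleftrightarrow> (\<forall>q\<in>S. \<exists>c\<in>max_atlas M. q \<in> fst c \<and> smooth_near c S f q)"
proof -
  let ?A = "\<forall>q\<in>S. \<forall>c\<in>max_atlas M. q \<in> fst c \<longrightarrow> smooth_near c S f q"
  let ?B = "\<forall>q\<in>S. \<exists>c\<in>max_atlas M. q \<in> fst c \<and> smooth_near c S f q"
  have sub: "atlas M \<subseteq> max_atlas M" by (rule atlas_subset_max_atlas[OF assms(1)])
  have C: "smooth_fun_on M S f \<longleftrightarrow> (\<forall>(U, \<phi>)\<in>atlas M. \<forall>q\<in>U \<inter> S. smooth_near (U, \<phi>) S f q)"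
  proof -
    have "smooth_on (\<phi> ` (U \<inter> S)) (f \<circ> inv_into U \<phi>) \<longleftrightarrow> (\<forall>q\<in>U \<inter> S. smooth_near (U, \<phi>) S f q)"
      if "(U, \<phi>) \<in> atlas M" for U \<phi>
      using that sub by (intro smooth_on_chart_iff max_atlasD(5)) blast
    then show ?thesis unfolding smooth_fun_on_def by (intro ball_cong refl) (clarsimp split: prod.split)
  qed
  have "?A" if "?B"
  proof (intro ballI impI)
    fix q d assume "q \<in> S" and d: "d \<in> max_atlas M" "q \<in> fst d"
    with that obtain c where c: "c \<in> max_atlas M" "q \<in> fst c" "smooth_near c S f q" by blast
    show "smooth_near d S f q"
      using smooth_near_change_chart[OF assms(1), of "fst c" "snd c" "fst d" "snd d"] c d by simp
  qed
  moreover have "smooth_fun_on M S f" if "?A"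
    unfolding C using that sub by auto
  moreover have "?B" if "smooth_fun_on M S f"
  proof
    fix q assume "q \<in> S"
    then obtain U \<phi> where "(U, \<phi>) \<in> atlas M" "(U, \<phi>) \<in> max_atlas M" "q \<in> U"
      using chart_at[OF assms(1)] assms(2) by blast
    then show "\<exists>c\<in>max_atlas M. q \<in> fst c \<and> smooth_near c S f q"
      using that \<open>q \<in> S\<close> unfolding C by (intro bexI[of _ "(U, \<phi>)"]) auto
  qed
  ultimately show "smooth_fun_on M S f \<longleftrightarrow> ?A" "smooth_fun_on M S f \<longleftrightarrow> ?B" by blast+
qed

lemma smooth_near_carr:
  assumes "(U, \<phi>) \<in> max_atlas M"
  shows "smooth_near (U, \<phi>) (carr M) f q \<longleftrightarrow> smooth_near (U, \<phi>) UNIV f q"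
  using max_atlasD(2)[OF assms] by (auto elim!: smooth_near_mono)

lemma CinfD:
  assumes "smooth_manifold M" "f \<in> Cinf M" "(U, \<phi>) \<in> max_atlas M" "q \<in> U"
  shows "smooth_near (U, \<phi>) UNIV f q"
  using assms smooth_fun_on_iff(1)[OF assms(1), of "carr M" f] max_atlasD(2)[OF assms(3)]
    smooth_near_carr[OF assms(3)] by (fastforce simp: Cinf_def)

lemma CinfI:
  assumes "smooth_manifold M"
    "\<And>q. q \<in> carr M \<Longrightarrow> \<exists>U \<phi>. (U, \<phi>) \<in> max_atlas M \<and> q \<in> U \<and> smooth_near (U, \<phi>) UNIV f q"
  shows "f \<in> Cinf M"
proof -
  have "\<exists>c\<in>max_atlas M. q \<in> fst c \<and> smooth_near c (carr M) f q" if q: "q \<in> carr M" for q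
  proof -
    obtain U \<phi> where "(U, \<phi>) \<in> max_atlas M" "q \<in> U" "smooth_near (U, \<phi>) UNIV f q"
      using assms(2)[OF q] by blast
    then show ?thesis using smooth_near_carr[of U \<phi> M f q] by (intro bexI[of _ "(U, \<phi>)"]) auto
  qed
  then show ?thesis
    unfolding Cinf_def using smooth_fun_on_iff(2)[OF assms(1) subset_refl] by blast
qed

lemma Cinf_local:
  assumes "smooth_manifold M" "f \<in> Cinf M" "(U, \<phi>) \<in> max_atlas M" "q \<in> U"
  obtains B g where "open B" "\<phi> q \<in> B" "smooth_in B g" "\<And>y. y \<in> U \<Longrightarrow> \<phi> y \<in> B \<Longrightarrow> f y = g (\<phi> y)"
  using CinfD[OF assms] by (rule smooth_nearE) (auto intro: that)

lemma smooth_near_binop: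
  fixes \<phi> :: "'p \<Rightarrow> 'a::euclidean_space"
  assumes "smooth_near (U, \<phi>) S f q" "smooth_near (U, \<phi>) S g q"
    and p: "\<And>B u v. open B \<Longrightarrow> smooth_in B u \<Longrightarrow> smooth_in B v \<Longrightarrow> smooth_in B (\<lambda>x::'a. p (u x) (v x))"
  shows "smooth_near (U, \<phi>) S (\<lambda>y. p (f y) (g y)) q"
proof -
  obtain B u where u: "open B" "\<phi> q \<in> B" "smooth_in B u"
    "\<And>y. y \<in> U \<Longrightarrow> y \<in> S \<Longrightarrow> \<phi> y \<in> B \<Longrightarrow> f y = u (\<phi> y)"
    using assms(1) by (rule smooth_nearE) blast
  obtain B' v where v: "open B'" "\<phi> q \<in> B'" "smooth_in B' v"
    "\<And>y. y \<in> U \<Longrightarrow> y \<in> S \<Longrightarrow> \<phi> y \<in> B' \<Longrightarrow> g y = v (\<phi> y)"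
    using assms(2) by (rule smooth_nearE) blast
  have "smooth_in (B \<inter> B') (\<lambda>x. p (u x) (v x))"
    using u(1,3) v(1,3) by (intro p open_Int) (auto intro: smooth_in_subset)
  then show ?thesis
    using u v by (intro smooth_nearI[of "B \<inter> B'" _ _ "\<lambda>x. p (u x) (v x)"]) auto
qed

lemma Cinf_binop:
  assumes "smooth_manifold M" "f \<in> Cinf M" "g \<in> Cinf M"
    and p: "\<And>B u v. open B \<Longrightarrow> smooth_in B u \<Longrightarrow> smooth_in B v \<Longrightarrow> smooth_in B (\<lambda>x::'a::euclidean_space. p (u x) (v x))"
  shows "(\<lambda>y. p (f y) (g y)) \<in> Cinf (M :: ('p, 'a) mfd)"
proof (rule CinfI[OF assms(1)])
  fix q assume "q \<in> carr M"
  then obtain U \<phi> where c: "(U, \<phi>) \<in> max_atlas M" "q \<in> U" using chart_at[OF assms(1)] by metis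
  have "smooth_near (U, \<phi>) UNIV (\<lambda>y. p (f y) (g y)) q"
    by (rule smooth_near_binop[OF CinfD[OF assms(1,2) c] CinfD[OF assms(1,3) c] p])
  then show "\<exists>U \<phi>. (U, \<phi>) \<in> max_atlas M \<and> q \<in> U \<and> smooth_near (U, \<phi>) UNIV (\<lambda>y. p (f y) (g y)) q"
    using c by blast
qed

lemma Cinf_const: "smooth_manifold M \<Longrightarrow> (\<lambda>x. c) \<in> Cinf M"
  by (rule CinfI, assumption) (metis UNIV_I chart_at open_UNIV smooth_in_const smooth_nearI)

lemma Cinf_add: "smooth_manifold M \<Longrightarrow> f \<in> Cinf M \<Longrightarrow> g \<in> Cinf M \<Longrightarrow> f + g \<in> Cinf M"
  unfolding plus_fun_def by (rule Cinf_binop) (auto intro: smooth_in_add)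

lemma Cinf_mult: "smooth_manifold M \<Longrightarrow> f \<in> Cinf M \<Longrightarrow> g \<in> Cinf M \<Longrightarrow> f * g \<in> Cinf M"
  unfolding times_fun_def by (rule Cinf_binop) (auto intro: smooth_in_mult)

lemma Cinf_scaleR: "smooth_manifold M \<Longrightarrow> f \<in> Cinf M \<Longrightarrow> c *\<^sub>R f \<in> Cinf M"
  using Cinf_mult[OF _ Cinf_const, of M f c] by (simp add: times_fun_def scaleR_fun_def mult.commute)

lemma Cinf_diff: "smooth_manifold M \<Longrightarrow> f \<in> Cinf M \<Longrightarrow> g \<in> Cinf M \<Longrightarrow> f - g \<in> Cinf M"
  unfolding fun_diff_def by (rule Cinf_binop) (auto intro: smooth_in_diff)

lemma Cinf_zero: "smooth_manifold M \<Longrightarrow> 0 \<in> Cinf M"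
  using Cinf_const[of M 0] by (simp add: zero_fun_def)

lemma Cinf_sum:
  "smooth_manifold M \<Longrightarrow> (\<And>i. i \<in> I \<Longrightarrow> f i \<in> Cinf M) \<Longrightarrow> (\<Sum>i\<in>I. f i) \<in> Cinf M"
  by (induction I rule: infinite_finite_induct) (auto intro: Cinf_add Cinf_zero)

text \<open>A function given in a chart, cut off by a bump function \<open>b\<close>, extends by zero to a
  smooth function on the whole manifold. At points off the chart domain this needs the Hausdorff
  axiom: the support of the bump corresponds to a compact set, which is therefore closed. One bump
  function serves all functions \<open>u\<close> that are smooth on \<open>B\<close>, and the set
  \<open>C\<close> containing its support is part of the conclusion so that differentials of the
  extension can be computed everywhere.\<close>

lemma chart_bump:
  fixes M :: "('p, 'a::euclidean_space) mfd"
  assumes M: "smooth_manifold M" and c: "(U, \<phi>) \<in> max_atlas M" and q: "q \<in> U"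
    and B: "open B" "\<phi> q \<in> B" and V: "openin (topol M) V" "q \<in> V"
  obtains b :: "'a \<Rightarrow> real" and C V' where
    "closed C" "C \<subseteq> B" "\<And>x. x \<notin> C \<Longrightarrow> b x = 0"
    "openin (topol M) V'" "q \<in> V'" "V' \<subseteq> U" "V' \<subseteq> V" "\<And>y. y \<in> V' \<Longrightarrow> b (\<phi> y) = 1" "\<And>y. y \<in> V' \<Longrightarrow> \<phi> y \<in> B"
    "\<And>y. y \<in> U \<Longrightarrow> \<phi> y \<in> C \<Longrightarrow> y \<in> V"
    "\<And>u. smooth_in B u \<Longrightarrow> smooth_in UNIV (\<lambda>x. b x * u x)"
    "\<And>u. smooth_in B u \<Longrightarrow> (\<lambda>y. if y \<in> U then b (\<phi> y) * u (\<phi> y) else 0) \<in> Cinf M"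
    "\<And>y. y \<in> carr M - U \<Longrightarrow> \<exists>Z. openin (topol M) Z \<and> y \<in> Z \<and> (\<forall>z\<in>Z \<inter> U. \<phi> z \<notin> C)"
proof -
  note cD = max_atlasD[OF c]
  obtain \<rho>1 where \<rho>1: "\<rho>1 > 0" "cball (\<phi> q) \<rho>1 \<inter> model M \<subseteq> \<phi> ` (U \<inter> V)"
    using chart_ball[OF c V(1) q V(2)] by blast
  obtain \<rho>2 where \<rho>2: "\<rho>2 > 0" "ball (\<phi> q) \<rho>2 \<subseteq> B"
    using B open_contains_ball by blast
  define \<rho> where "\<rho> = min \<rho>1 (\<rho>2 / 2)"
  let ?C = "cball (\<phi> q) \<rho>"
  have \<rho>: "\<rho> > 0" "?C \<inter> model M \<subseteq> \<phi> ` (U \<inter> V)" "ball (\<phi> q) (2 * \<rho>) \<subseteq> B"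
    using \<rho>1 \<rho>2 by (auto simp: \<rho>_def subset_iff)
  obtain b :: "'a \<Rightarrow> real" where b: "smooth_in UNIV b"
    "\<And>x. x \<in> ball (\<phi> q) (\<rho> / 2) \<Longrightarrow> b x = 1" "\<And>x. x \<notin> ball (\<phi> q) \<rho> \<Longrightarrow> b x = 0"
    using bump_function[OF \<rho>(1)] by blast
  have CB: "?C \<subseteq> B" using \<rho>(1,3) by (auto simp: subset_iff)
  have b0: "b x = 0" if "x \<notin> ?C" for x using b(3) that by auto
  let ?V' = "{y \<in> U. \<phi> y \<in> ball (\<phi> q) (\<rho> / 2)}"
  have inV: "y \<in> V" if "y \<in> U" "\<phi> y \<in> ?C" for y
  proof -
    have "\<phi> y \<in> \<phi> ` (U \<inter> V)" by (rule subsetD[OF \<rho>(2)]) (use that cD(4) in auto)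
    then show ?thesis using cD(5) that(1) by (auto dest: inj_onD)
  qed
  have sm: "smooth_in UNIV (\<lambda>x. b x * u x)" if "smooth_in B u" for u
    by (rule bump_times_smooth[OF b(1) smooth_in_subset[OF that \<rho>(3)] \<rho>(1) b(3)])
  have far: "\<exists>Z. openin (topol M) Z \<and> y \<in> Z \<and> (\<forall>z\<in>Z \<inter> U. \<phi> z \<notin> ?C)" if "y \<in> carr M - U" for y
  proof -
    let ?K = "{z \<in> U. \<phi> z \<in> ?C}"
    have im: "\<phi> ` ?K = ?C \<inter> model M" using \<rho>(2) cD(4) by auto
    have "compact (\<phi> ` ?K)"
      unfolding im by (intro compact_Int_closed closed_subspace smooth_manifoldD(1)[OF M]) simp
    then have "compactin (top_of_set (\<phi> ` U)) (\<phi> ` ?K)" by (auto simp: compactin_subtopology)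
    then have "compactin (subtopology (topol M) U) ?K"
      using homeomorphic_map_compactness[OF cD(6), of ?K] cD(2) by auto
    then have "closedin (topol M) ?K"
      using compactin_imp_closedin smooth_manifoldD(2)[OF M] by (auto simp: compactin_subtopology)
    then have "openin (topol M) (carr M - ?K)" by blast
    then show ?thesis using that by (intro exI[of _ "carr M - ?K"]) auto
  qed
  have ext: "(\<lambda>y. if y \<in> U then b (\<phi> y) * u (\<phi> y) else 0) \<in> Cinf M" (is "?f \<in> _")
    if "smooth_in B u" for u
  proof (rule CinfI[OF M])
    fix y assume y: "y \<in> carr M"
    show "\<exists>V \<psi>. (V, \<psi>) \<in> max_atlas M \<and> y \<in> V \<and> smooth_near (V, \<psi>) UNIV ?f y"
    proof (cases "y \<in> U")
      case True
      have "smooth_near (U, \<phi>) UNIV ?f y"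
        by (rule smooth_nearI[OF open_UNIV UNIV_I sm[OF that]]) simp
      then show ?thesis using True c by blast
    next
      case False
      then obtain Z where Z: "openin (topol M) Z" "y \<in> Z" "\<forall>z\<in>Z \<inter> U. \<phi> z \<notin> ?C"
        using far y by blast
      obtain A \<psi> where A: "(A, \<psi>) \<in> max_atlas M" "y \<in> A" using chart_at[OF M y] by metis
      obtain B' where B': "open B'" "\<psi> y \<in> B'" "\<And>z. z \<in> A \<Longrightarrow> \<psi> z \<in> B' \<Longrightarrow> z \<in> Z"
        using chart_nbhd[OF A(1) Z(1) A(2) Z(2)] by blast
      have "smooth_near (A, \<psi>) UNIV ?f y"
      proof (rule smooth_nearI[where B = B' and g = "\<lambda>x. 0"])
        show "open B'" "\<psi> y \<in> B'" using B' by auto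
        show "smooth_in B' (\<lambda>x. 0::real)" using B'(1) by simp
        show "?f z = 0" if "z \<in> A" "\<psi> z \<in> B'" for z
          using Z(3) b0[of "\<phi> z"] B'(3)[OF that] by auto
      qed
      then show ?thesis using A by blast
    qed
  qed
  show thesis
  proof (rule that[of ?C b ?V'])
    show "openin (topol M) ?V'" by (rule chart_preimage_open[OF c open_ball])
    show "?V' \<subseteq> V" using inV \<rho>(1) by auto
    show "b (\<phi> y) = 1" if "y \<in> ?V'" for y using that b(2) by auto
    show "\<phi> y \<in> B" if "y \<in> ?V'" for y using that \<rho>(1,3) by (auto simp: subset_iff)
  qed (use q \<rho>(1) CB b0 inV sm ext far in auto)
qed

section \<open>Linear algebra in the ambient Euclidean space\<close>

lemma sum_fun_apply: "(\<Sum>i\<in>I. f i) x = (\<Sum>i\<in>I. f i x)"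
  for f :: "'i \<Rightarrow> 'b \<Rightarrow> 'c::comm_monoid_add"
  by (induction I rule: infinite_finite_induct) auto

lemma orthogonal_projection:
  fixes S :: "'a::euclidean_space set"
  assumes "subspace S"
  obtains P where "linear P" "\<And>x. P x \<in> S" "\<And>x y. y \<in> S \<Longrightarrow> (x - P x) \<bullet> y = 0" "\<And>x. x \<in> S \<Longrightarrow> P x = x"
proof -
  obtain B where B: "B \<subseteq> S" "pairwise orthogonal B" "\<And>x. x \<in> B \<Longrightarrow> norm x = 1"
    "independent B" "span B = S"
    using orthonormal_basis_subspace[OF assms] by metis
  have fin: "finite B" using B(4) by (rule independent_imp_finite)
  define P where "P x = (\<Sum>b\<in>B. (x \<bullet> b) *\<^sub>R b)" for x
  have lin: "linear P"
    unfolding P_def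
    by (intro linearI) (simp_all add: inner_add_left scaleR_add_left sum.distrib scaleR_sum_right)
  have PS: "P x \<in> S" for x
    unfolding P_def using assms B(1) by (intro subspace_sum subspace_scale) auto
  have Pb: "P x \<bullet> b = x \<bullet> b" if "b \<in> B" for x b
  proof -
    have "P x \<bullet> b = (\<Sum>c\<in>B. if c = b then x \<bullet> b else 0)"
      unfolding P_def inner_sum_left
    proof (rule sum.cong[OF refl])
      fix c assume "c \<in> B"
      show "((x \<bullet> c) *\<^sub>R c) \<bullet> b = (if c = b then x \<bullet> b else 0)"
        using B(2,3) that \<open>c \<in> B\<close>
        by (auto simp: pairwise_def orthogonal_def) (metis norm_eq_1 mult.right_neutral)
    qed
    then show ?thesis using that fin by simp
  qed
  have orth: "(x - P x) \<bullet> y = 0" if "y \<in> S" for x y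
  proof -
    have "y \<in> span B" using that B(5) by simp
    then show ?thesis
      by (induction rule: span_induct_alt) (simp_all add: Pb inner_diff_left inner_add_right)
  qed
  have "P x = x" if "x \<in> S" for x
  proof -
    have "x - P x \<in> S" using that PS assms by (simp add: subspace_diff)
    then have "(x - P x) \<bullet> (x - P x) = 0" by (rule orth)
    then show ?thesis by simp
  qed
  then show thesis using that lin PS orth by blast
qed

text \<open>The double orthogonal complement of a subspace of a Euclidean space is the subspace itself.\<close>

lemma mem_subspace_if_orthogonal:
  fixes S :: "'a::euclidean_space set"
  assumes "subspace S" "\<And>u. (\<And>y. y \<in> S \<Longrightarrow> y \<bullet> u = 0) \<Longrightarrow> x \<bullet> u = 0"
  shows "x \<in> S"
proof -
  obtain P where P: "linear P" "\<And>x. P x \<in> S" "\<And>x y. y \<in> S \<Longrightarrow> (x - P x) \<bullet> y = 0"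
    using orthogonal_projection[OF assms(1)] by metis
  have "x \<bullet> (x - P x) = 0" using P(3) by (intro assms(2)) (simp add: inner_commute)
  moreover have "P x \<bullet> (x - P x) = 0" using P(2,3) by (simp add: inner_commute)
  ultimately have "(x - P x) \<bullet> (x - P x) = 0" by (simp add: inner_diff_left)
  then show ?thesis using P(2)[of x] by simp
qed

lemma linear_functional_inner:
  fixes L :: "'a::euclidean_space \<Rightarrow> real"
  assumes "linear L"
  obtains \<beta> where "\<And>x. L x = x \<bullet> \<beta>"
proof (rule that)
  fix x
  have "L x = L (\<Sum>b\<in>Basis. (x \<bullet> b) *\<^sub>R b)" by (simp add: euclidean_representation)
  also have "\<dots> = (\<Sum>b\<in>Basis. (x \<bullet> b) * L b)"
    by (simp add: linear_sum[OF assms] linear_cmul[OF assms])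
  also have "\<dots> = x \<bullet> (\<Sum>b\<in>Basis. L b *\<^sub>R b)"
    by (simp add: inner_sum_right mult.commute)
  finally show "L x = x \<bullet> (\<Sum>b\<in>Basis. L b *\<^sub>R b)" .
qed

section \<open>Tangent vectors in coordinates\<close>

lemma tangent_spaceD:
  assumes "v \<in> tangent_space M q"
  shows "\<And>f g. f \<in> Cinf M \<Longrightarrow> g \<in> Cinf M \<Longrightarrow> v (f + g) = v f + v g"
    "\<And>c f. f \<in> Cinf M \<Longrightarrow> v (c *\<^sub>R f) = c * v f"
    "\<And>f g. f \<in> Cinf M \<Longrightarrow> g \<in> Cinf M \<Longrightarrow> v (f * g) = f q * v g + g q * v f"
    "\<And>f. f \<notin> Cinf M \<Longrightarrow> v f = 0"
  using assms by (auto simp: tangent_space_def linear_between_def)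

lemma tangent_spaceI:
  assumes "\<And>f g. f \<in> Cinf M \<Longrightarrow> g \<in> Cinf M \<Longrightarrow> v (f + g) = v f + v g"
    "\<And>c f. f \<in> Cinf M \<Longrightarrow> v (c *\<^sub>R f) = c * v f"
    "\<And>f g. f \<in> Cinf M \<Longrightarrow> g \<in> Cinf M \<Longrightarrow> v (f * g) = f q * v g + g q * v f"
    "\<And>f. f \<notin> Cinf M \<Longrightarrow> v f = 0"
  shows "v \<in> tangent_space M q"
  using assms by (auto simp: tangent_space_def linear_between_def)

lemma subspace_tangent_space:
  assumes "smooth_manifold M"
  shows "subspace (tangent_space M q)"
proof (intro subspaceI)
  show "0 \<in> tangent_space M q" by (rule tangent_spaceI) auto
  show "v + w \<in> tangent_space M q" if "v \<in> tangent_space M q" "w \<in> tangent_space M q" for v w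
    using tangent_spaceD[OF that(1)] tangent_spaceD[OF that(2)]
    by (intro tangent_spaceI) (auto simp: algebra_simps)
  show "c *\<^sub>R v \<in> tangent_space M q" if "v \<in> tangent_space M q" for c v
    using tangent_spaceD[OF that] by (intro tangent_spaceI) (auto simp: algebra_simps)
qed

lemma tangent_diff:
  assumes "smooth_manifold M" "v \<in> tangent_space M q" "f \<in> Cinf M" "g \<in> Cinf M"
  shows "v (f - g) = v f - v g"
proof -
  have "f - g = f + (-1) *\<^sub>R g" by (simp add: fun_eq_iff)
  then have "v (f - g) = v (f + (-1) *\<^sub>R g)" by (rule arg_cong)
  also have "\<dots> = v f + v ((-1) *\<^sub>R g)"
    using assms by (intro tangent_spaceD(1)[OF assms(2)] Cinf_scaleR)
  also have "v ((-1) *\<^sub>R g) = (-1) * v g" by (rule tangent_spaceD(2)[OF assms(2,4)])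
  finally show ?thesis by linarith
qed

lemma tangent_zero: "smooth_manifold M \<Longrightarrow> v \<in> tangent_space M q \<Longrightarrow> v 0 = 0"
  using tangent_spaceD(2)[of v M q 0 0] by (simp add: Cinf_zero)

lemma tangent_sum:
  assumes "smooth_manifold M" "v \<in> tangent_space M q" "\<And>i. i \<in> I \<Longrightarrow> f i \<in> Cinf M"
  shows "v (\<Sum>i\<in>I. f i) = (\<Sum>i\<in>I. v (f i))"
  using assms(3)
  by (induction I rule: infinite_finite_induct)
    (auto simp: tangent_zero[OF assms(1,2)] tangent_spaceD(1)[OF assms(2)] Cinf_sum[OF assms(1)])

lemma tangent_const: 
  assumes "smooth_manifold M" "v \<in> tangent_space M q"
  shows "v (\<lambda>x. c) = 0"
proof -
  have 1: "(\<lambda>x. 1) \<in> Cinf M" by (rule Cinf_const[OF assms(1)])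
  have "v ((\<lambda>x. 1) * (\<lambda>x. 1)) = v (\<lambda>x. 1) + v (\<lambda>x. 1)"
    using tangent_spaceD(3)[OF assms(2) 1 1] by simp
  moreover have "v ((\<lambda>x. 1) * (\<lambda>x. 1)) = v (\<lambda>x. 1)"
    by (rule arg_cong[where f = v]) (simp add: fun_eq_iff)
  ultimately have "v (\<lambda>x. 1) = 0" by linarith
  moreover have "v (\<lambda>x. c) = v (c *\<^sub>R (\<lambda>x. 1::real))"
    by (rule arg_cong[where f = v]) (simp add: fun_eq_iff)
  ultimately show ?thesis using tangent_spaceD(2)[OF assms(2) 1, of c] by simp
qed

text \<open>Multiply \<open>f - g\<close> by a bump function supported in \<open>V\<close>: the product is
  zero, and the Leibniz rule extracts \<open>v (f - g)\<close> from it.\<close>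

lemma tangent_local:
  assumes M: "smooth_manifold M" and v: "v \<in> tangent_space M q" and fg: "f \<in> Cinf M" "g \<in> Cinf M"
    and V: "openin (topol M) V" "q \<in> V" "\<And>y. y \<in> V \<Longrightarrow> f y = g y"
  shows "v f = v g"
proof -
  have "q \<in> carr M" using V openin_subset by blast
  then obtain U \<phi> where c: "(U, \<phi>) \<in> max_atlas M" "q \<in> U" using chart_at[OF M] by metis
  obtain b :: "'b \<Rightarrow> real" and C V' where b: "C \<subseteq> UNIV" "\<And>x. x \<notin> C \<Longrightarrow> b x = 0"
    "q \<in> V'" "\<And>y. y \<in> V' \<Longrightarrow> b (\<phi> y) = 1" "\<And>y. y \<in> U \<Longrightarrow> \<phi> y \<in> C \<Longrightarrow> y \<in> V"
    "\<And>u. smooth_in UNIV u \<Longrightarrow> (\<lambda>y. if y \<in> U then b (\<phi> y) * u (\<phi> y) else 0) \<in> Cinf M"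
    by (rule chart_bump[OF M c open_UNIV UNIV_I V(1,2)]) (rule that, assumption+)
  define \<kappa> where "\<kappa> = (\<lambda>y. if y \<in> U then b (\<phi> y) * 1 else 0)"
  have \<kappa>: "\<kappa> \<in> Cinf M" unfolding \<kappa>_def by (rule b(6)) simp
  have "\<kappa> y * (f - g) y = 0" for y
    using V(3) b(2,5) by (auto simp: \<kappa>_def)
  then have "\<kappa> * (f - g) = 0" by (simp add: fun_eq_iff)
  then have "\<kappa> q * v (f - g) + (f - g) q * v \<kappa> = 0"
    using tangent_spaceD(3)[OF v \<kappa> Cinf_diff[OF M fg]] tangent_zero[OF M v] by simp
  moreover have "\<kappa> q = 1" using b(3,4) c(2) by (simp add: \<kappa>_def)
  moreover have "(f - g) q = 0" using V by simp
  ultimately show ?thesis using tangent_diff[OF M v fg] by simp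
qed

text \<open>The derivative may be computed from any local representative \<open>g\<close> of
  \<open>f\<close> in the ambient Euclidean space, because \<open>x\<close> is a direction in the
  model space, on which \<open>g\<close> is determined by \<open>f\<close>.\<close>

lemma coord_vec_eqI:
  assumes c: "(U, \<phi>) \<in> max_atlas M" and S: "subspace (model M)" and q: "q \<in> U" and x: "x \<in> model M"
    and f: "f \<in> Cinf M" and B: "open B" "\<phi> q \<in> B" "\<And>y. y \<in> U \<Longrightarrow> \<phi> y \<in> B \<Longrightarrow> f y = g (\<phi> y)"
    and g: "(g has_derivative g') (at (\<phi> q))"
  shows "coord_vec M (U, \<phi>) q x f = g' x"
proof -
  note cD = max_atlasD[OF c]
  obtain A where A: "open A" "\<phi> ` U = model M \<inter> A" using cD(3) by (auto simp: openin_open)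
  let ?\<gamma> = "\<lambda>t::real. \<phi> q + t *\<^sub>R x"
  have \<gamma>: "continuous_on UNIV ?\<gamma>" by (intro continuous_intros)
  have o: "open (?\<gamma> -` (A \<inter> B))"
    using A(1) B(1) \<gamma> by (intro open_vimage) auto
  have 0: "0 \<in> ?\<gamma> -` (A \<inter> B)" using A(2) B(2) q by auto
  have eq: "f (inv_into U \<phi> (?\<gamma> t)) = g (?\<gamma> t)" if "t \<in> ?\<gamma> -` (A \<inter> B)" for t
  proof -
    have "?\<gamma> t \<in> model M" using S x cD(4) q by (auto intro!: subspace_add subspace_scale)
    then have "?\<gamma> t \<in> \<phi> ` U" using that A(2) by auto
    then show ?thesis using that B(3)[of "inv_into U \<phi> (?\<gamma> t)"] by (simp add: inv_into_into f_inv_into_f)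
  qed
  have "(?\<gamma> has_derivative (\<lambda>t. t *\<^sub>R x)) (at 0)" by (auto intro!: derivative_eq_intros)
  then have "((g \<circ> ?\<gamma>) has_derivative (g' \<circ> (\<lambda>t. t *\<^sub>R x))) (at 0)"
    using g by (intro diff_chain_at) auto
  then have "((\<lambda>t. g (?\<gamma> t)) has_derivative (\<lambda>t. g' x * t)) (at 0)"
    using linear_cmul[OF has_derivative_linear[OF g]] by (simp add: o_def mult.commute)
  then have "((\<lambda>t. g (?\<gamma> t)) has_real_derivative g' x) (at 0)"
    by (simp add: has_field_derivative_def)
  then have "((\<lambda>t. f (inv_into U \<phi> (?\<gamma> t))) has_real_derivative g' x) (at 0)"
    by (rule has_field_derivative_transform_within_open[OF _ o 0]) (simp add: eq)
  then show ?thesis using f by (simp add: coord_vec_def DERIV_imp_deriv)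
qed

lemma coord_vec_not_Cinf: "f \<notin> Cinf M \<Longrightarrow> coord_vec M c q x f = 0"
  by (simp add: coord_vec_def split_beta)

lemma coord_vec_linear:
  assumes M: "smooth_manifold M" and c: "(U, \<phi>) \<in> max_atlas M" and q: "q \<in> U"
    and x: "x \<in> model M" "y \<in> model M"
  shows "coord_vec M (U, \<phi>) q (x + y) = coord_vec M (U, \<phi>) q x + coord_vec M (U, \<phi>) q y"
    and "coord_vec M (U, \<phi>) q (a *\<^sub>R x) = a *\<^sub>R coord_vec M (U, \<phi>) q x"
proof -
  note S = smooth_manifoldD(1)[OF M]
  have "coord_vec M (U, \<phi>) q (x + y) f = coord_vec M (U, \<phi>) q x f + coord_vec M (U, \<phi>) q y f \<and>
    coord_vec M (U, \<phi>) q (a *\<^sub>R x) f = a * coord_vec M (U, \<phi>) q x f" for f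
  proof (cases "f \<in> Cinf M")
    case True
    obtain B g where B: "open B" "\<phi> q \<in> B" "smooth_in B g" "\<And>y. y \<in> U \<Longrightarrow> \<phi> y \<in> B \<Longrightarrow> f y = g (\<phi> y)"
      using Cinf_local[OF M True c q] by blast
    note d = smooth_in_has_derivative[OF B(3,2)]
    have e: "coord_vec M (U, \<phi>) q z f = frechet_derivative g (at (\<phi> q)) z" if "z \<in> model M" for z
      by (rule coord_vec_eqI[OF c S q that True B(1,2,4) d])
    show ?thesis
      using x S linear_add[OF has_derivative_linear[OF d]] linear_cmul[OF has_derivative_linear[OF d]]
      by (simp add: e subspace_add subspace_scale)
  qed (simp add: coord_vec_not_Cinf)
  then show "coord_vec M (U, \<phi>) q (x + y) = coord_vec M (U, \<phi>) q x + coord_vec M (U, \<phi>) q y"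
    and "coord_vec M (U, \<phi>) q (a *\<^sub>R x) = a *\<^sub>R coord_vec M (U, \<phi>) q x"
    by (simp_all add: fun_eq_iff)
qed

lemma coord_vec_tangent:
  assumes M: "smooth_manifold M" and c: "(U, \<phi>) \<in> max_atlas M" and q: "q \<in> U" and x: "x \<in> model M"
  shows "coord_vec M (U, \<phi>) q x \<in> tangent_space M q"
proof -
  note S = smooth_manifoldD(1)[OF M]
  let ?D = "coord_vec M (U, \<phi>) q x"
  have *: "?D (f + k) = ?D f + ?D k \<and> ?D (a *\<^sub>R f) = a * ?D f \<and>
      ?D (f * k) = f q * ?D k + k q * ?D f" if f: "f \<in> Cinf M" and k: "k \<in> Cinf M" for f k a
  proof -
    obtain B g where B: "open B" "\<phi> q \<in> B" "smooth_in B g" "\<And>y. y \<in> U \<Longrightarrow> \<phi> y \<in> B \<Longrightarrow> f y = g (\<phi> y)"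
      using Cinf_local[OF M f c q] by blast
    obtain A h where A: "open A" "\<phi> q \<in> A" "smooth_in A h" "\<And>y. y \<in> U \<Longrightarrow> \<phi> y \<in> A \<Longrightarrow> k y = h (\<phi> y)"
      using Cinf_local[OF M k c q] by blast
    let ?g = "frechet_derivative g (at (\<phi> q))" and ?h = "frechet_derivative h (at (\<phi> q))"
    have d: "(g has_derivative ?g) (at (\<phi> q))" "(h has_derivative ?h) (at (\<phi> q))"
      using A B by (auto intro: smooth_in_has_derivative)
    have o: "open (A \<inter> B)" "\<phi> q \<in> A \<inter> B" using A B by auto
    note e = coord_vec_eqI[OF c S q x _ o]
    have "?D f = ?g x" by (rule e[OF f _ d(1)]) (use B in auto)
    moreover have "?D k = ?h x" by (rule e[OF k _ d(2)]) (use A in auto)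
    moreover have "?D (f + k) = ?g x + ?h x"
      by (rule e[OF Cinf_add[OF M f k] _ has_derivative_add[OF d]]) (use A B in auto)
    moreover have "?D (a *\<^sub>R f) = a * ?g x"
      by (rule e[OF Cinf_scaleR[OF M f] _ has_derivative_scaleR_right[OF d(1), of a], unfolded real_scaleR_def]) (use A B in auto)
    moreover have "?D (f * k) = g (\<phi> q) * ?h x + ?g x * h (\<phi> q)"
      by (rule e[OF Cinf_mult[OF M f k] _ has_derivative_mult[OF d]]) (use A B in auto)
    ultimately show ?thesis using A B q by (auto simp: mult.commute)
  qed
  show ?thesis
  proof (rule tangent_spaceI)
    show "?D (a *\<^sub>R f) = a * ?D f" if "f \<in> Cinf M" for a f using *[OF that that] by blast
  qed (use * coord_vec_not_Cinf in auto)
qed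

lemma coord_vec_zero:
  assumes "smooth_manifold M" "(U, \<phi>) \<in> max_atlas M" "q \<in> U"
  shows "coord_vec M (U, \<phi>) q 0 = 0"
proof -
  have "0 \<in> model M" by (rule subspace_0[OF smooth_manifoldD(1)[OF assms(1)]])
  from coord_vec_linear(2)[OF assms this this, of 0] show ?thesis by simp
qed

lemma chart_gradient:
  fixes M :: "('p, 'a::euclidean_space) mfd"
  assumes M: "smooth_manifold M" and c: "(U, \<phi>) \<in> max_atlas M" "q \<in> U" and f: "f \<in> Cinf M"
  obtains \<beta> where "\<And>x. x \<in> model M \<Longrightarrow> coord_vec M (U, \<phi>) q x f = x \<bullet> \<beta>"
proof -
  obtain B g where B: "open B" "\<phi> q \<in> B" "smooth_in B g" "\<And>y. y \<in> U \<Longrightarrow> \<phi> y \<in> B \<Longrightarrow> f y = g (\<phi> y)"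
    using Cinf_local[OF M f c] by blast
  note d = smooth_in_has_derivative[OF B(3,2)]
  obtain \<beta> where \<beta>: "\<And>x. frechet_derivative g (at (\<phi> q)) x = x \<bullet> \<beta>"
    using linear_functional_inner[OF has_derivative_linear[OF d]] by blast
  have "coord_vec M (U, \<phi>) q x f = x \<bullet> \<beta>" if "x \<in> model M" for x
    using coord_vec_eqI[OF c(1) smooth_manifoldD(1)[OF M] c(2) that f B(1,2,4) d] \<beta> by simp
  then show thesis by (rule that)
qed

text \<open>The linear functionals of the coordinates, cut off to become global functions. They are indexed
  by all vectors \<open>b\<close> of the ambient Euclidean space, with one neighbourhood
  \<open>V'\<close> for all of them, and they vanish wherever the functional itself does.\<close>

lemma chart_coordinates:
  fixes M :: "('p, 'a::euclidean_space) mfd"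
  assumes M: "smooth_manifold M" and c: "(U, \<phi>) \<in> max_atlas M" and q: "q \<in> U"
    and V: "openin (topol M) V" "q \<in> V"
  obtains X :: "'a \<Rightarrow> 'p \<Rightarrow> real" and V' where
    "\<And>b. X b \<in> Cinf M" "openin (topol M) V'" "q \<in> V'" "V' \<subseteq> U" "V' \<subseteq> V"
    "\<And>b y. y \<in> V' \<Longrightarrow> X b y = \<phi> y \<bullet> b"
    "\<And>b y. y \<notin> U \<Longrightarrow> X b y = 0" "\<And>b y. y \<in> U \<Longrightarrow> \<phi> y \<bullet> b = 0 \<Longrightarrow> X b y = 0"
    "\<And>b y x. y \<in> V' \<Longrightarrow> x \<in> model M \<Longrightarrow> coord_vec M (U, \<phi>) y x (X b) = x \<bullet> b"
proof -
  obtain b :: "'a \<Rightarrow> real" and C V' where b: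
    "openin (topol M) V'" "q \<in> V'" "V' \<subseteq> U" "V' \<subseteq> V" "\<And>y. y \<in> V' \<Longrightarrow> b (\<phi> y) = 1"
    "\<And>u. smooth_in UNIV u \<Longrightarrow> (\<lambda>y. if y \<in> U then b (\<phi> y) * u (\<phi> y) else 0) \<in> Cinf M"
    by (rule chart_bump[OF M c q open_UNIV UNIV_I V]) (rule that, assumption+)
  define X where "X e = (\<lambda>y. if y \<in> U then b (\<phi> y) * (\<phi> y \<bullet> e) else 0)" for e
  have X: "X e \<in> Cinf M" for e
    unfolding X_def by (rule b(6)) (intro smooth_in_linear open_UNIV bounded_linear.linear bounded_linear_inner_left)
  have XV: "X e y = \<phi> y \<bullet> e" if "y \<in> V'" for e y using that b(3,5) by (auto simp: X_def)
  have "coord_vec M (U, \<phi>) y x (X e) = x \<bullet> e" if y: "y \<in> V'" and x: "x \<in> model M" for e x y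
  proof -
    have yU: "y \<in> U" using y b(3) by auto
    obtain B where "open B" "\<phi> y \<in> B" "\<And>z. z \<in> U \<Longrightarrow> \<phi> z \<in> B \<Longrightarrow> z \<in> V'"
      using chart_nbhd[OF c b(1) yU y] by blast
    then show ?thesis
      by (intro coord_vec_eqI[OF c smooth_manifoldD(1)[OF M] yU x X, where B = B and g = "\<lambda>z. z \<bullet> e"])
        (auto simp: XV intro!: derivative_eq_intros)
  qed
  then show thesis
    using X b XV by (intro that[of X V']) (auto simp: X_def)
qed

lemma coord_vec_inj:
  assumes M: "smooth_manifold M" and c: "(U, \<phi>) \<in> max_atlas M" and q: "q \<in> U"
  shows "inj_on (coord_vec M (U, \<phi>) q) (model M)"
proof (rule inj_onI)
  fix x y assume xy: "x \<in> model M" "y \<in> model M" "coord_vec M (U, \<phi>) q x = coord_vec M (U, \<phi>) q y"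
  obtain X V' where X: "q \<in> V'"
    "\<And>b y x. y \<in> V' \<Longrightarrow> x \<in> model M \<Longrightarrow> coord_vec M (U, \<phi>) y x (X b) = x \<bullet> b"
    by (rule chart_coordinates[OF M c q max_atlasD(1)[OF c] q]) (rule that, assumption+)
  have eq: "x \<bullet> b = y \<bullet> b" for b using X(2)[OF X(1) xy(1)] X(2)[OF X(1) xy(2)] xy(3) by simp
  show "x = y" by (rule euclidean_eqI) (rule eq)
qed

text \<open>Let \<open>D\<close> be a derivation and let \<open>x\<close> have the components
  \<open>D(X\<^sub>b)\<close>, where \<open>X\<^sub>b\<close> are the cut-off coordinates.
  Hadamard's lemma writes a function near \<open>q\<close> as a constant plus \<open>\<Sum>
  (X\<^sub>b - X\<^sub>b(q)) G\<^sub>b\<close>, and the Leibniz rule then gives \<open>D f =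
  \<Sum> D(X\<^sub>b) G\<^sub>b(q)\<close>, which is the derivative of \<open>f\<close> in
  direction \<open>x\<close>. That \<open>x\<close> lies in the model space holds because a
  functional that vanishes on the model space gives a function that vanishes near
  \<open>q\<close>.\<close>

lemma tangent_space_coord:
  fixes M :: "('p, 'a::euclidean_space) mfd"
  assumes M: "smooth_manifold M" and c: "(U, \<phi>) \<in> max_atlas M" and q: "q \<in> U"
  shows "tangent_space M q = coord_vec M (U, \<phi>) q ` model M"
proof
  note S = smooth_manifoldD(1)[OF M] and cD = max_atlasD[OF c]
  show "coord_vec M (U, \<phi>) q ` model M \<subseteq> tangent_space M q"
    using coord_vec_tangent[OF M c q] by auto
  show "tangent_space M q \<subseteq> coord_vec M (U, \<phi>) q ` model M"
  proof
    fix D assume D: "D \<in> tangent_space M q"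
    note DD = tangent_spaceD[OF D]
    obtain X V where X: "\<And>b. X b \<in> Cinf M" "openin (topol M) V" "q \<in> V" "V \<subseteq> U"
      "\<And>b y. y \<in> V \<Longrightarrow> X b y = \<phi> y \<bullet> b"
      "\<And>b y x. y \<in> V \<Longrightarrow> x \<in> model M \<Longrightarrow> coord_vec M (U, \<phi>) y x (X b) = x \<bullet> b"
      by (rule chart_coordinates[OF M c q cD(1) q]) (rule that, assumption+)
    define x where "x = (\<Sum>b\<in>Basis. D (X b) *\<^sub>R b)"
    have xm: "x \<in> model M"
    proof (rule mem_subspace_if_orthogonal[OF S])
      fix u assume u: "\<And>y. y \<in> model M \<Longrightarrow> y \<bullet> u = 0"
      have "D (\<Sum>b\<in>Basis. (u \<bullet> b) *\<^sub>R X b) = D 0"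
      proof (rule tangent_local[OF M D Cinf_sum[OF M] Cinf_zero[OF M] X(2,3)])
        show "(\<Sum>b\<in>Basis. (u \<bullet> b) *\<^sub>R X b) y = 0 y" if "y \<in> V" for y
        proof -
          have "(\<Sum>b\<in>Basis. (u \<bullet> b) *\<^sub>R X b) y = (\<Sum>b\<in>Basis. (u \<bullet> b) * (\<phi> y \<bullet> b))"
            using X(5)[OF that] by (simp add: sum_fun_apply)
          also have "\<dots> = \<phi> y \<bullet> u" by (subst euclidean_inner) (simp add: mult.commute)
          also have "\<dots> = 0" using that X(4) cD(4) by (intro u) auto
          finally show ?thesis by simp
        qed
      qed (use X(1) Cinf_scaleR[OF M] in auto)
      moreover have "D (\<Sum>b\<in>Basis. (u \<bullet> b) *\<^sub>R X b) = (\<Sum>b\<in>Basis. (u \<bullet> b) * D (X b))"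
        using X(1) by (subst tangent_sum[OF M D]) (auto simp: DD Cinf_scaleR[OF M])
      moreover have "x \<bullet> u = (\<Sum>b\<in>Basis. (u \<bullet> b) * D (X b))"
        unfolding x_def by (simp add: inner_sum_left mult.commute inner_commute[of u])
      ultimately show "x \<bullet> u = 0" using tangent_zero[OF M D] by simp
    qed
    have "D f = coord_vec M (U, \<phi>) q x f" for f
    proof (cases "f \<in> Cinf M")
      case True
      obtain B g where B: "open B" "\<phi> q \<in> B" "smooth_in B g" "\<And>y. y \<in> U \<Longrightarrow> \<phi> y \<in> B \<Longrightarrow> f y = g (\<phi> y)"
        using Cinf_local[OF M True c q] by blast
      obtain \<rho> where \<rho>: "\<rho> > 0" "ball (\<phi> q) \<rho> \<subseteq> B" using B open_contains_ball by blast
      let ?B = "ball (\<phi> q) \<rho>"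
      obtain G where G: "\<And>b. smooth_in ?B (G b)" "\<And>b. G b (\<phi> q) = frechet_derivative g (at (\<phi> q)) b"
        "\<And>x. x \<in> ?B \<Longrightarrow> g x = g (\<phi> q) + (\<Sum>b\<in>Basis. ((x - \<phi> q) \<bullet> b) * G b x)"
        using hadamard[OF smooth_in_subset[OF B(3) \<rho>(2)] \<rho>(1)] by metis
      have qB: "\<phi> q \<in> ?B" using \<rho>(1) by simp
      obtain \<beta> :: "'a \<Rightarrow> real" and C V' where b:
        "openin (topol M) V'" "q \<in> V'" "V' \<subseteq> U" "V' \<subseteq> V" "\<And>y. y \<in> V' \<Longrightarrow> \<beta> (\<phi> y) = 1" "\<And>y. y \<in> V' \<Longrightarrow> \<phi> y \<in> ?B"
        "\<And>u. smooth_in ?B u \<Longrightarrow> (\<lambda>y. if y \<in> U then \<beta> (\<phi> y) * u (\<phi> y) else 0) \<in> Cinf M"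
        by (rule chart_bump[OF M c q open_ball qB X(2,3)]) (rule that, assumption+)
      define H where "H b = (\<lambda>y. if y \<in> U then \<beta> (\<phi> y) * G b (\<phi> y) else 0)" for b
      have H: "H b \<in> Cinf M" for b unfolding H_def by (rule b(7)) (rule G(1))
      have Hq: "H b q = frechet_derivative g (at (\<phi> q)) b" for b
        using b(2,5) q G(2) by (simp add: H_def)
      define Y where "Y b = X b - (\<lambda>y. \<phi> q \<bullet> b)" for b
      have Y: "Y b \<in> Cinf M" for b unfolding Y_def by (intro Cinf_diff Cinf_const M X(1))
      have DY: "D (Y b) = D (X b)" for b
        unfolding Y_def using tangent_diff[OF M D X(1) Cinf_const[OF M]] tangent_const[OF M D] by simp
      have YH: "Y b * H b \<in> Cinf M" for b by (rule Cinf_mult[OF M Y H])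
      have "D f = D ((\<lambda>y. f q) + (\<Sum>b\<in>Basis. Y b * H b))"
      proof (rule tangent_local[OF M D True _ b(1,2)])
        show "(\<lambda>y. f q) + (\<Sum>b\<in>Basis. Y b * H b) \<in> Cinf M"
          using YH by (intro Cinf_add Cinf_const Cinf_sum M)
        fix y assume y: "y \<in> V'"
        have "f y = g (\<phi> y)" using y b(3,6) \<rho>(2) by (intro B(4)) auto
        also have "\<dots> = g (\<phi> q) + (\<Sum>b\<in>Basis. ((\<phi> y - \<phi> q) \<bullet> b) * G b (\<phi> y))"
          using y b(6) by (intro G(3))
        also have "g (\<phi> q) = f q" using B(2,4) q by simp
        also have "(\<Sum>b\<in>Basis. ((\<phi> y - \<phi> q) \<bullet> b) * G b (\<phi> y)) = (\<Sum>b\<in>Basis. Y b * H b) y"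
        proof -
          have "((\<phi> y - \<phi> q) \<bullet> b) * G b (\<phi> y) = (Y b * H b) y" for b
            using X(5)[of y b] y b(3,4,5) by (auto simp: Y_def H_def inner_diff_left)
          then show ?thesis by (simp add: sum_fun_apply)
        qed
        finally show "f y = ((\<lambda>y. f q) + (\<Sum>b\<in>Basis. Y b * H b)) y" by simp
      qed
      also have "\<dots> = (\<Sum>b\<in>Basis. D (Y b * H b))"
        using DD(1)[OF Cinf_const[OF M, of "f q"] Cinf_sum[OF M, of Basis "\<lambda>b. Y b * H b"]] YH
          tangent_const[OF M D] tangent_sum[OF M D, of Basis "\<lambda>b. Y b * H b"] by simp
      also have "\<dots> = (\<Sum>b\<in>Basis. D (X b) * frechet_derivative g (at (\<phi> q)) b)"
      proof (rule sum.cong[OF refl])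
        fix b
        have "Y b q = 0" using X(3,5) by (simp add: Y_def)
        then show "D (Y b * H b) = D (X b) * frechet_derivative g (at (\<phi> q)) b"
          using DD(3)[OF Y H] DY Hq by simp
      qed
      also have "\<dots> = frechet_derivative g (at (\<phi> q)) x"
        unfolding x_def
        by (simp add: linear_sum[OF has_derivative_linear[OF smooth_in_has_derivative[OF B(3,2)]]]
          linear_cmul[OF has_derivative_linear[OF smooth_in_has_derivative[OF B(3,2)]]])
      also have "\<dots> = coord_vec M (U, \<phi>) q x f"
        by (rule coord_vec_eqI[OF c S q xm True B(1,2,4) smooth_in_has_derivative[OF B(3,2)], symmetric])
      finally show ?thesis .
    qed (simp add: DD coord_vec_not_Cinf)
    then have "D = coord_vec M (U, \<phi>) q x" by (simp add: fun_eq_iff)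
    then show "D \<in> coord_vec M (U, \<phi>) q ` model M" using xm by simp
  qed
qed

text \<open>\<^const>\<open>coord_vec\<close> is linear in its last argument only on the model space;
  composing it with the orthogonal projection gives a linear map on the whole type, to which
  results on dimensions and spans apply.\<close>

lemma coord_vec_linear_extension:
  fixes M :: "('p, 'a::euclidean_space) mfd"
  assumes M: "smooth_manifold M" and c: "(U, \<phi>) \<in> max_atlas M" and q: "q \<in> U"
  obtains \<iota> where "linear \<iota>" "\<And>x. x \<in> model M \<Longrightarrow> \<iota> x = coord_vec M (U, \<phi>) q x"
    "\<And>x. \<iota> x \<in> tangent_space M q"
proof -
  obtain P where P: "linear P" "\<And>x. P x \<in> model M" "\<And>x. x \<in> model M \<Longrightarrow> P x = x"
    using orthogonal_projection[OF smooth_manifoldD(1)[OF M]] by metis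
  show thesis
  proof (rule that)
    show "linear (\<lambda>x. coord_vec M (U, \<phi>) q (P x))"
      by (intro linearI) (simp_all only: linear_add[OF P(1)] linear_cmul[OF P(1)] coord_vec_linear[OF M c q P(2) P(2)])
    show "coord_vec M (U, \<phi>) q (P x) \<in> tangent_space M q" for x
      by (rule coord_vec_tangent[OF M c q P(2)])
  qed (simp add: P(3))
qed

lemma covector_gradient:
  fixes M :: "('p, 'a::euclidean_space) mfd"
  assumes M: "smooth_manifold M" and c: "(U, \<phi>) \<in> max_atlas M" and q: "q \<in> U"
    and \<alpha>: "\<alpha> \<in> cotangent_space M q"
  obtains \<beta> where "\<And>x. x \<in> model M \<Longrightarrow> \<alpha> (coord_vec M (U, \<phi>) q x) = x \<bullet> \<beta>"
proof -
  obtain \<iota> where \<iota>: "linear \<iota>" "\<And>x. x \<in> model M \<Longrightarrow> \<iota> x = coord_vec M (U, \<phi>) q x"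
    "\<And>x. \<iota> x \<in> tangent_space M q"
    by (rule coord_vec_linear_extension[OF M c q]) (rule that, assumption+)
  have "linear (\<lambda>x. \<alpha> (\<iota> x))"
    using \<alpha> \<iota>(3)
    by (intro linearI) (simp_all add: linear_add[OF \<iota>(1)] linear_cmul[OF \<iota>(1)] cotangent_space_def linear_between_def)
  then obtain \<beta> where "\<And>x. \<alpha> (\<iota> x) = x \<bullet> \<beta>" using linear_functional_inner by blast
  then show thesis using \<iota>(2) by (intro that[of \<beta>]) metis
qed

text \<open>A covector is linear in the coordinates, hence it is the differential of one cut-off linear
  functional.\<close>

lemma covector_differential:
  assumes M: "smooth_manifold M" and q: "q \<in> carr M" and \<alpha>: "\<alpha> \<in> cotangent_space M q"
  obtains f where "f \<in> Cinf M" "differential M q f = \<alpha>"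
proof -
  obtain U \<phi> where c: "(U, \<phi>) \<in> max_atlas M" "q \<in> U" using chart_at[OF M q] by metis
  obtain X V where X: "\<And>b. X b \<in> Cinf M" "q \<in> V"
    "\<And>b y x. y \<in> V \<Longrightarrow> x \<in> model M \<Longrightarrow> coord_vec M (U, \<phi>) y x (X b) = x \<bullet> b"
    by (rule chart_coordinates[OF M c max_atlasD(1)[OF c(1)] c(2)]) (rule that, assumption+)
  obtain \<beta> where \<beta>: "\<And>x. x \<in> model M \<Longrightarrow> \<alpha> (coord_vec M (U, \<phi>) q x) = x \<bullet> \<beta>"
    using covector_gradient[OF M c \<alpha>] by blast
  have "differential M q (X \<beta>) v = \<alpha> v" for v
  proof (cases "v \<in> tangent_space M q")
    case True
    then obtain x where x: "x \<in> model M" "v = coord_vec M (U, \<phi>) q x"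
      using tangent_space_coord[OF M c] by auto
    then show ?thesis using \<beta>[of x] X(3)[OF X(2), of x \<beta>] True by (simp add: differential_def)
  next
    case False
    then show ?thesis using \<alpha> by (simp add: differential_def cotangent_space_def linear_between_def)
  qed
  then show thesis using that X(1) by blast
qed

lemma dim_coord_vec:
  assumes M: "smooth_manifold M" and c: "(U, \<phi>) \<in> max_atlas M" and q: "q \<in> U"
    and S: "subspace S" "S \<subseteq> model M"
  shows "dim (coord_vec M (U, \<phi>) q ` S) = dim S"
proof -
  obtain f where f: "linear f" "\<And>x. x \<in> model M \<Longrightarrow> f x = coord_vec M (U, \<phi>) q x"
    by (rule coord_vec_linear_extension[OF M c q]) (rule that, assumption+)
  have eq: "f x = coord_vec M (U, \<phi>) q x" if "x \<in> S" for x using f(2) S(2) that by auto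
  have "inj_on f S"
    using inj_on_subset[OF coord_vec_inj[OF M c q] S(2)] eq by (simp cong: inj_on_cong)
  then have "dim (f ` S) = dim S"
    using S(1) by (intro eucl.dim_image_eq[OF f(1)]) (simp add: span_eq_iff[THEN iffD2])
  moreover have "f ` S = coord_vec M (U, \<phi>) q ` S" using eq by simp
  ultimately show ?thesis by simp
qed

section \<open>Submanifolds\<close>

lemma slice_chartsD:
  assumes "(U, \<phi>) \<in> slice_charts M N W"
  shows "(U, \<phi>) \<in> max_atlas M" "\<phi> ` (U \<inter> N) = \<phi> ` U \<inter> W" "\<And>y. y \<in> U \<Longrightarrow> y \<in> N \<longleftrightarrow> \<phi> y \<in> W"
proof -
  show c: "(U, \<phi>) \<in> max_atlas M" and e: "\<phi> ` (U \<inter> N) = \<phi> ` U \<inter> W"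
    using assms by (auto simp: slice_charts_def)
  fix y assume y: "y \<in> U"
  show "y \<in> N \<longleftrightarrow> \<phi> y \<in> W"
  proof
    assume "\<phi> y \<in> W"
    then have "\<phi> y \<in> \<phi> ` (U \<inter> N)" using e y by auto
    then show "y \<in> N" using max_atlasD(5)[OF c] y by (auto dest: inj_onD)
  qed (use e y in auto)
qed

context
  fixes M :: "('p, 'a::euclidean_space) mfd" and N :: "'p set" and W :: "'a set" and Y :: "('p, 'a) mfd"
  assumes M: "smooth_manifold M" and N: "submanifold M N W" and Y: "Y = induced_mfd M N W"
begin

lemma induced_simps: "topol Y = subtopology (topol M) N" "model Y = W" "carr Y = N"
  "atlas Y = (\<lambda>(U, \<phi>). (U \<inter> N, \<phi>)) ` slice_charts M N W"
  using N by (auto simp: Y induced_mfd_def submanifold_def)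

lemma submanifoldD: "N \<subseteq> carr M" "subspace W" "W \<subseteq> model M"
  using N by (auto simp: submanifold_def)

lemma induced_is_chart:
  assumes "(U, \<phi>) \<in> slice_charts M N W"
  shows "is_chart Y (U \<inter> N, \<phi>)"
proof -
  note s = slice_chartsD[OF assms]
  note c = max_atlasD[OF s(1)]
  have "openin (topol Y) (U \<inter> N)"
    unfolding induced_simps using c(1) by (rule openin_subtopology_Int)
  moreover have "openin (top_of_set W) (\<phi> ` (U \<inter> N))"
  proof -
    obtain A where A: "open A" "\<phi> ` U = model M \<inter> A" using c(3) by (auto simp: openin_open)
    then have "\<phi> ` (U \<inter> N) = W \<inter> A" using s(2) submanifoldD(3) by auto
    then show ?thesis using A(1) by (auto simp: openin_open)
  qed
  moreover have "homeomorphic_map (subtopology (topol Y) (U \<inter> N)) (top_of_set (\<phi> ` (U \<inter> N))) \<phi>"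
  proof -
    have "homeomorphic_map (subtopology (subtopology (topol M) U) (U \<inter> N))
        (subtopology (top_of_set (\<phi> ` U)) (\<phi> ` (U \<inter> N))) \<phi>"
      using c(2) by (intro homeomorphic_map_subtopologies[OF c(6)]) auto
    moreover have "subtopology (subtopology (topol M) U) (U \<inter> N) = subtopology (topol Y) (U \<inter> N)"
      unfolding induced_simps subtopology_subtopology by (simp add: Int_ac)
    moreover have "subtopology (top_of_set (\<phi> ` U)) (\<phi> ` (U \<inter> N)) = top_of_set (\<phi> ` (U \<inter> N))"
      unfolding subtopology_subtopology by (simp add: inf.absorb2 image_mono)
    ultimately show ?thesis by simp
  qed
  ultimately show ?thesis by (simp add: is_chart_def induced_simps(2))
qed

text \<open>All conditions are inherited from \<open>M\<close> by restriction; the slice condition makes the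
  images of the restricted charts open in \<open>W\<close>.\<close>

lemma smooth_manifold_induced: "smooth_manifold Y"
  unfolding smooth_manifold_def
proof (intro conjI)
  show "subspace (model Y)" by (simp add: induced_simps submanifoldD)
  show "Hausdorff_space (topol Y)"
    unfolding induced_simps using smooth_manifoldD(2)[OF M] by (rule Hausdorff_space_subtopology)
  show "second_countable (topol Y)"
    unfolding induced_simps using smooth_manifoldD(3)[OF M] by (rule second_countable_subtopology)
  show "\<forall>c\<in>atlas Y. is_chart Y c"
    unfolding induced_simps using induced_is_chart by auto
  show "\<forall>c\<in>atlas Y. \<forall>d\<in>atlas Y. compatible c d"
  proof (intro ballI)
    fix c d assume "c \<in> atlas Y" "d \<in> atlas Y"
    then obtain U \<phi> V \<psi> where c: "(U, \<phi>) \<in> slice_charts M N W" "c = (U \<inter> N, \<phi>)"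
      and d: "(V, \<psi>) \<in> slice_charts M N W" "d = (V \<inter> N, \<psi>)"
      unfolding induced_simps by auto
    note c' = slice_chartsD(1)[OF c(1)] and d' = slice_chartsD(1)[OF d(1)]
    have i: "inj_on \<phi> (U \<inter> N)" "inj_on \<psi> (V \<inter> N)"
      using max_atlasD(5)[OF c'] max_atlasD(5)[OF d'] by (auto intro: inj_on_subset)
    show "compatible c d"
      unfolding c(2) d(2) compatible_iff[OF i]
    proof (intro ballI conjI)
      fix q assume q: "q \<in> U \<inter> N \<inter> (V \<inter> N)"
      show "smooth_near (U \<inter> N, \<phi>) (V \<inter> N) \<psi> q"
        by (rule smooth_near_mono[OF max_atlas_smooth_near[OF M c' d']]) (use q in auto)
      show "smooth_near (V \<inter> N, \<psi>) (U \<inter> N) \<phi> q"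
        by (rule smooth_near_mono[OF max_atlas_smooth_near[OF M d' c']]) (use q in auto)
    qed
  qed
  have "\<exists>c\<in>slice_charts M N W. p \<in> fst c" if "p \<in> N" for p
    using N that by (auto simp: submanifold_def)
  then have "(\<Union>c\<in>slice_charts M N W. fst c \<inter> N) = N" by blast
  then show "(\<Union>c\<in>atlas Y. fst c) = carr Y"
    unfolding induced_simps(3,4) image_image by (simp add: split_beta)
qed

lemma slice_chart_at:
  assumes "p \<in> N"
  obtains U \<phi> where "(U, \<phi>) \<in> slice_charts M N W" "p \<in> U"
proof -
  obtain c where "c \<in> slice_charts M N W" "p \<in> fst c" using N assms by (auto simp: submanifold_def)
  then show thesis by (intro that[of "fst c" "snd c"]) auto
qed

lemma slice_chart_induced: "(U, \<phi>) \<in> slice_charts M N W \<Longrightarrow> (U \<inter> N, \<phi>) \<in> max_atlas Y"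
  using atlas_subset_max_atlas[OF smooth_manifold_induced] unfolding induced_simps by force

lemma Cinf_restrict:
  assumes "f \<in> Cinf M"
  shows "f \<in> Cinf Y"
proof (rule CinfI[OF smooth_manifold_induced])
  fix q assume "q \<in> carr Y"
  then have q: "q \<in> N" by (simp only: induced_simps(3))
  obtain U \<phi> where c: "(U, \<phi>) \<in> slice_charts M N W" "q \<in> U" using slice_chart_at[OF q] .
  have "smooth_near (U \<inter> N, \<phi>) UNIV f q"
    by (rule smooth_near_mono[OF CinfD[OF M assms slice_chartsD(1)[OF c(1)] c(2)]]) auto
  then show "\<exists>U \<phi>. (U, \<phi>) \<in> max_atlas Y \<and> q \<in> U \<and> smooth_near (U, \<phi>) UNIV f q"
    using slice_chart_induced[OF c(1)] c(2) q by blast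
qed

lemma push_coord_vec:
  assumes c: "(U, \<phi>) \<in> slice_charts M N W" and p: "p \<in> U" "p \<in> N" and x: "x \<in> W"
  shows "push_forward M id (coord_vec Y (U \<inter> N, \<phi>) p x) = coord_vec M (U, \<phi>) p x"
proof
  fix g
  note cM = slice_chartsD(1)[OF c] and cY = slice_chart_induced[OF c]
  show "push_forward M id (coord_vec Y (U \<inter> N, \<phi>) p x) g = coord_vec M (U, \<phi>) p x g"
  proof (cases "g \<in> Cinf M")
    case True
    obtain B h where B: "open B" "\<phi> p \<in> B" "smooth_in B h" "\<And>y. y \<in> U \<Longrightarrow> \<phi> y \<in> B \<Longrightarrow> g y = h (\<phi> y)"
      using Cinf_local[OF M True cM p(1)] by blast
    note d = smooth_in_has_derivative[OF B(3,2)]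
    have "coord_vec M (U, \<phi>) p x g = frechet_derivative h (at (\<phi> p)) x"
      by (rule coord_vec_eqI[OF cM smooth_manifoldD(1)[OF M] p(1) _ True B(1,2,4) d])
        (use x submanifoldD in auto)
    moreover have "coord_vec Y (U \<inter> N, \<phi>) p x g = frechet_derivative h (at (\<phi> p)) x"
      by (rule coord_vec_eqI[OF cY smooth_manifoldD(1)[OF smooth_manifold_induced] _ _ Cinf_restrict[OF True] B(1,2) _ d])
        (use x p B(4) in \<open>auto simp: induced_simps\<close>)
    ultimately show ?thesis using True by (simp add: push_forward_def)
  qed (simp add: push_forward_def coord_vec_not_Cinf)
qed

lemma tangent_induced_coord:
  assumes "(U, \<phi>) \<in> slice_charts M N W" "p \<in> U" "p \<in> N"
  shows "tangent_space Y p = coord_vec Y (U \<inter> N, \<phi>) p ` W"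
  using tangent_space_coord[OF smooth_manifold_induced slice_chart_induced[OF assms(1)], of p] assms
  by (simp add: induced_simps)

lemma tangent_image_coord:
  assumes "(U, \<phi>) \<in> slice_charts M N W" "p \<in> U" "p \<in> N"
  shows "tangent_image M Y p = coord_vec M (U, \<phi>) p ` W"
  unfolding tangent_image_def tangent_induced_coord[OF assms] image_image
  using push_coord_vec[OF assms] by simp

lemma tangent_induced_extend:
  assumes "w \<in> tangent_space Y p" "p \<in> N" "f \<in> Cinf Y" "f' \<in> Cinf Y" "openin (topol M) V" "p \<in> V"
    "\<And>y. y \<in> V \<Longrightarrow> y \<in> N \<Longrightarrow> f' y = f y"
  shows "w f' = w f"
  by (rule tangent_local[OF smooth_manifold_induced assms(1,4,3), of "V \<inter> N"])
    (use assms in \<open>auto simp: induced_simps openin_subtopology_Int\<close>)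

text \<open>A vector tangent to \<open>N\<close> kills the functions vanishing on \<open>N\<close>, as it
  only sees their restrictions. Conversely, in a slice chart the functionals orthogonal to
  \<open>W\<close> give functions vanishing on \<open>N\<close>, and a vector killed by all of
  them has its coordinates in \<open>W\<close>.\<close>

lemma tangent_image_iff:
  assumes p: "p \<in> N" and D: "D \<in> tangent_space M p"
  shows "D \<in> tangent_image M Y p \<longleftrightarrow> (\<forall>f\<in>Cinf M. (\<forall>y\<in>N. f y = 0) \<longrightarrow> D f = 0)"
proof
  assume "D \<in> tangent_image M Y p"
  then obtain w where w: "w \<in> tangent_space Y p" "D = push_forward M id w"
    by (auto simp: tangent_image_def)
  show "\<forall>f\<in>Cinf M. (\<forall>y\<in>N. f y = 0) \<longrightarrow> D f = 0"
  proof (intro ballI impI)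
    fix f assume f: "f \<in> Cinf M" "\<forall>y\<in>N. f y = 0"
    have "w f = w 0"
      using f(2) tangent_induced_extend[OF w(1) p Cinf_zero[OF smooth_manifold_induced] Cinf_restrict[OF f(1)] openin_topspace]
        p submanifoldD(1) by auto
    then show "D f = 0"
      using w f(1) tangent_zero[OF smooth_manifold_induced w(1)] by (simp add: push_forward_def)
  qed
next
  assume *: "\<forall>f\<in>Cinf M. (\<forall>y\<in>N. f y = 0) \<longrightarrow> D f = 0"
  obtain U \<phi> where c: "(U, \<phi>) \<in> slice_charts M N W" "p \<in> U" using slice_chart_at[OF p] .
  note s = slice_chartsD[OF c(1)]
  obtain x where x: "x \<in> model M" "D = coord_vec M (U, \<phi>) p x"
    using D tangent_space_coord[OF M s(1) c(2)] by auto
  obtain X V' where X: "\<And>b. X b \<in> Cinf M" "p \<in> V'"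
    "\<And>b y. y \<notin> U \<Longrightarrow> X b y = 0" "\<And>b y. y \<in> U \<Longrightarrow> \<phi> y \<bullet> b = 0 \<Longrightarrow> X b y = 0"
    "\<And>b y x. y \<in> V' \<Longrightarrow> x \<in> model M \<Longrightarrow> coord_vec M (U, \<phi>) y x (X b) = x \<bullet> b"
    by (rule chart_coordinates[OF M s(1) c(2) max_atlasD(1)[OF s(1)] c(2)]) (rule that, assumption+)
  have "x \<in> W"
  proof (rule mem_subspace_if_orthogonal[OF submanifoldD(2)])
    fix u assume u: "\<And>y. y \<in> W \<Longrightarrow> y \<bullet> u = 0"
    have "X u y = 0" if "y \<in> N" for y
      using X(3,4)[of y u] u s(3)[of y] that by (cases "y \<in> U") auto
    then have "D (X u) = 0" using * X(1) by blast
    then show "x \<bullet> u = 0" using X(5)[OF X(2) x(1)] x(2) by simp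
  qed
  then show "D \<in> tangent_image M Y p" using tangent_image_coord[OF c p] x(2) by simp
qed

lemma push_forward_tangent:
  assumes "p \<in> N" "w \<in> tangent_space Y p"
  shows "push_forward M id w \<in> tangent_space M p" 
    and "\<And>f. f \<in> Cinf M \<Longrightarrow> push_forward M id w f = w f"
proof -
  obtain U \<phi> where c: "(U, \<phi>) \<in> slice_charts M N W" "p \<in> U" using slice_chart_at[OF assms(1)] .
  obtain x where x: "x \<in> W" "w = coord_vec Y (U \<inter> N, \<phi>) p x"
    using tangent_induced_coord[OF c assms(1)] assms(2) by auto
  then show "push_forward M id w \<in> tangent_space M p"
    using push_coord_vec[OF c assms(1) x(1)] coord_vec_tangent[OF M slice_chartsD(1)[OF c(1)] c(2)] submanifoldD(3)
    by auto
qed (simp add: push_forward_def)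

end

section \<open>Plaques and leaves\<close>

lemma foliated_chartD:
  assumes "foliated_chart Y F (U, \<phi>) W"
  shows "(U, \<phi>) \<in> max_atlas Y" "convex (\<phi> ` U)" "subspace W" "W \<subseteq> model Y"
    "\<And>q. q \<in> U \<Longrightarrow> F q = coord_vec Y (U, \<phi>) q ` W"
  using assms by (auto simp: foliated_chart_def)

text \<open>The change between two foliated charts has its derivative mapping \<open>W\<close> to
  \<open>W'\<close>, since both subspaces describe the same distribution. Integrating along
  segments in direction \<open>W\<close> shows that a small piece of a plaque of one chart lies in
  a single plaque of the other.\<close>

lemma plaque_transition:
  fixes Y :: "('p, 'a::euclidean_space) mfd"
  assumes Y: "smooth_manifold Y"
    and c: "foliated_chart Y F (U, \<phi>) W" and c': "foliated_chart Y F (U', \<phi>') W'"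
    and x: "x \<in> U" "x \<in> U'"
  obtains Z where "openin (topol Y) Z" "x \<in> Z" "Z \<subseteq> U" "Z \<subseteq> U'"
    "\<And>y. y \<in> Z \<Longrightarrow> \<phi> y - \<phi> x \<in> W \<Longrightarrow> \<phi>' y - \<phi>' x \<in> W'"
proof -
  note cD = foliated_chartD[OF c] and cD' = foliated_chartD[OF c']
  note m = max_atlasD[OF cD(1)] and m' = max_atlasD[OF cD'(1)]
  note S = smooth_manifoldD(1)[OF Y]
  obtain X V where X: "\<And>b. X b \<in> Cinf Y" "openin (topol Y) V" "x \<in> V" "V \<subseteq> U'" "V \<subseteq> U"
    "\<And>b y. y \<in> V \<Longrightarrow> X b y = \<phi>' y \<bullet> b"
    "\<And>b y x. y \<in> V \<Longrightarrow> x \<in> model Y \<Longrightarrow> coord_vec Y (U', \<phi>') y x (X b) = x \<bullet> b"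
    by (rule chart_coordinates[OF Y cD'(1) x(2) m(1) x(1)]) (rule that, assumption+)
  obtain B h where B: "open B" "\<phi> x \<in> B" "smooth_in B h"
    "\<And>y. y \<in> U \<Longrightarrow> y \<in> U' \<Longrightarrow> \<phi> y \<in> B \<Longrightarrow> \<phi>' y = h (\<phi> y)"
    using max_atlas_smooth_near[OF Y cD(1) cD'(1) x] by (rule smooth_nearE) blast
  obtain B2 where B2: "open B2" "\<phi> x \<in> B2" "\<And>y. y \<in> U \<Longrightarrow> \<phi> y \<in> B2 \<Longrightarrow> y \<in> V"
    using chart_nbhd[OF cD(1) X(2) x(1) X(3)] by blast
  obtain \<rho>1 where \<rho>1: "\<rho>1 > 0" "cball (\<phi> x) \<rho>1 \<inter> model Y \<subseteq> \<phi> ` (U \<inter> U)"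
    using chart_ball[OF cD(1) m(1) x(1) x(1)] by blast
  obtain \<rho>2 where \<rho>2: "\<rho>2 > 0" "ball (\<phi> x) \<rho>2 \<subseteq> B \<inter> B2"
    using B(1,2) B2(1,2) open_contains_ball[of "B \<inter> B2"] by blast
  define \<rho> where "\<rho> = min \<rho>1 \<rho>2"
  let ?B = "ball (\<phi> x) \<rho>"
  have \<rho>: "\<rho> > 0" "?B \<inter> model Y \<subseteq> \<phi> ` U" "?B \<subseteq> B" "?B \<subseteq> B2"
    using \<rho>1 \<rho>2 by (auto simp: \<rho>_def subset_iff)
  have inV: "y \<in> V" if "y \<in> U" "\<phi> y \<in> ?B" for y using that B2(3) \<rho>(4) by blast
  have hV: "\<phi>' y = h (\<phi> y)" if "y \<in> U" "\<phi> y \<in> ?B" for y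
    using that B(4)[of y] inV[OF that] X(4) \<rho>(3) by blast
  \<comment> \<open>The same vector of \<open>F\<close> has coordinates in \<open>W\<close> and in \<open>W'\<close>; the functions \<open>X b\<close> compare them.\<close>
  have D: "frechet_derivative h (at (\<phi> y)) w \<in> W'" if y: "y \<in> U" "\<phi> y \<in> ?B" and w: "w \<in> W" for y w
  proof -
    have yV: "y \<in> V" by (rule inV[OF y])
    have "coord_vec Y (U, \<phi>) y w \<in> coord_vec Y (U', \<phi>') y ` W'"
      using cD(5)[of y] cD'(5)[of y] y(1) yV X(4) w by blast
    then obtain w' where w': "w' \<in> W'" "coord_vec Y (U, \<phi>) y w = coord_vec Y (U', \<phi>') y w'" by blast
    have "h differentiable (at (\<phi> y))"
      using smooth_in_has_derivative[OF B(3)] \<rho>(3) y(2) unfolding differentiable_def by blast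
    then have d: "(h has_derivative frechet_derivative h (at (\<phi> y))) (at (\<phi> y))"
      by (simp add: frechet_derivative_works)
    have eq: "frechet_derivative h (at (\<phi> y)) w \<bullet> b = w' \<bullet> b" for b
    proof -
      have "coord_vec Y (U, \<phi>) y w (X b) = frechet_derivative h (at (\<phi> y)) w \<bullet> b"
      proof (rule coord_vec_eqI[OF cD(1) S y(1) _ X(1) open_ball y(2)])
        show "w \<in> model Y" using w cD(4) by blast
        show "X b z = h (\<phi> z) \<bullet> b" if "z \<in> U" "\<phi> z \<in> ?B" for z
          using X(6)[OF inV[OF that], of b] hV[OF that] by simp
        show "((\<lambda>z. h z \<bullet> b) has_derivative (\<lambda>w. frechet_derivative h (at (\<phi> y)) w \<bullet> b)) (at (\<phi> y))"
          using d by (rule has_derivative_inner_left)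
      qed
      moreover have "coord_vec Y (U', \<phi>') y w' (X b) = w' \<bullet> b"
        using w'(1) cD'(4) by (intro X(7)[OF yV]) blast
      ultimately show ?thesis using w'(2) by simp
    qed
    have "frechet_derivative h (at (\<phi> y)) w = w'" by (rule euclidean_eqI) (rule eq)
    then show ?thesis using w'(1) by simp
  qed
  show thesis
  proof (rule that[of "{y \<in> U. \<phi> y \<in> ?B}"])
    show "openin (topol Y) {y \<in> U. \<phi> y \<in> ?B}" by (rule chart_preimage_open[OF cD(1) open_ball])
    show "x \<in> {y \<in> U. \<phi> y \<in> ?B}" using x \<rho>(1) by simp
    show "{y \<in> U. \<phi> y \<in> ?B} \<subseteq> U'" using inV X(4) by blast
    fix y assume y: "y \<in> {y \<in> U. \<phi> y \<in> ?B}" and w: "\<phi> y - \<phi> x \<in> W"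
    let ?w = "\<phi> y - \<phi> x"
    let ?\<gamma> = "\<lambda>t::real. \<phi> x + t *\<^sub>R ?w"
    have \<gamma>B: "?\<gamma> t \<in> ?B \<and> ?\<gamma> t \<in> \<phi> ` U" if "t \<in> {0..1}" for t
    proof -
      have "?\<gamma> t = (1 - t) *\<^sub>R \<phi> x + t *\<^sub>R \<phi> y" by (simp add: algebra_simps)
      moreover have "(1 - t) *\<^sub>R \<phi> x + t *\<^sub>R \<phi> y \<in> ?B"
        using y that \<rho>(1) by (intro convexD[OF convex_ball]) auto
      ultimately have "?\<gamma> t \<in> ?B" by simp
      moreover have "?\<gamma> t \<in> model Y"
        using w cD(4) m(4) x(1) S by (intro subspace_add subspace_scale) auto
      ultimately show ?thesis using \<rho>(2) by blast
    qed
    have "h (\<phi> y) - h (\<phi> x) \<in> W'"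
    proof (rule mem_subspace_if_orthogonal[OF cD'(3)])
      fix u assume u: "\<And>y. y \<in> W' \<Longrightarrow> y \<bullet> u = 0"
      have "((\<lambda>t. h (?\<gamma> t) \<bullet> u) has_derivative (\<lambda>s. 0)) (at t within {0..1})" if t: "t \<in> {0..1}" for t
      proof -
        obtain z where z: "z \<in> U" "?\<gamma> t = \<phi> z" using \<gamma>B[OF t] by blast
        have zB: "\<phi> z \<in> ?B" using \<gamma>B[OF t] z(2) by simp
        have d: "(h has_derivative frechet_derivative h (at (?\<gamma> t))) (at (?\<gamma> t))"
          using smooth_in_has_derivative[OF B(3)] \<rho>(3) \<gamma>B[OF t] by blast
        have "(?\<gamma> has_derivative (\<lambda>s. s *\<^sub>R ?w)) (at t)" by (auto intro!: derivative_eq_intros)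
        from diff_chain_at[OF this d]
        have "((\<lambda>t. h (?\<gamma> t)) has_derivative (\<lambda>s. frechet_derivative h (at (?\<gamma> t)) (s *\<^sub>R ?w))) (at t)"
          by (simp only: o_def)
        then have "((\<lambda>t. h (?\<gamma> t) \<bullet> u) has_derivative (\<lambda>s. frechet_derivative h (at (?\<gamma> t)) (s *\<^sub>R ?w) \<bullet> u)) (at t)"
          by (rule has_derivative_inner_left)
        moreover have "frechet_derivative h (at (?\<gamma> t)) (s *\<^sub>R ?w) \<bullet> u = 0" for s
        proof -
          have "s *\<^sub>R ?w \<in> W" by (rule subspace_scale[OF cD(3) w])
          from D[OF z(1) zB this] show ?thesis unfolding z(2) by (rule u)
        qed
        ultimately show ?thesis by (simp add: has_derivative_at_withinI)
      qed
      then obtain k where k: "\<And>t. t \<in> {0..1} \<Longrightarrow> h (?\<gamma> t) \<bullet> u = k"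
        using has_derivative_zero_constant[of "{0..1::real}" "\<lambda>t. h (?\<gamma> t) \<bullet> u"] by auto
      have "h (?\<gamma> 1) \<bullet> u = h (?\<gamma> 0) \<bullet> u" using k[of 1] k[of 0] by simp
      then show "(h (\<phi> y) - h (\<phi> x)) \<bullet> u = 0" by (simp add: inner_diff_left)
    qed
    then show "\<phi>' y - \<phi>' x \<in> W'" using hV[of y] hV[of x] y x \<rho>(1) by simp
  qed auto
qed

lemma countable_image_locally_constant:
  assumes "second_countable X" "\<And>x. x \<in> S \<Longrightarrow> \<exists>Z. openin X Z \<and> x \<in> Z \<and> (\<forall>y\<in>Z \<inter> S. f y = f x)"
  shows "countable (f ` S)"
proof -
  obtain \<B> where \<B>: "countable \<B>" "\<And>Z x. openin X Z \<Longrightarrow> x \<in> Z \<Longrightarrow> \<exists>V \<in> \<B>. x \<in> V \<and> V \<subseteq> Z"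
    using assms(1) by (auto simp: second_countable_def)
  have "f ` S \<subseteq> (\<lambda>V. f (SOME y. y \<in> V \<inter> S)) ` \<B>"
  proof
    fix z assume "z \<in> f ` S"
    then obtain x where x: "x \<in> S" "z = f x" by blast
    obtain Z where Z: "openin X Z" "x \<in> Z" "\<forall>y\<in>Z \<inter> S. f y = f x" using assms(2)[OF x(1)] by blast
    obtain V where V: "V \<in> \<B>" "x \<in> V" "V \<subseteq> Z" using \<B>(2)[OF Z(1,2)] by blast
    have "(SOME y. y \<in> V \<inter> S) \<in> V \<inter> S" using V(2) x(1) by (metis (no_types, lifting) IntI someI_ex)
    then have "f (SOME y. y \<in> V \<inter> S) = z" using Z(3) V(3) x(2) by blast
    then show "z \<in> (\<lambda>V. f (SOME y. y \<in> V \<inter> S)) ` \<B>" using V(1) by blast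
  qed
  then show ?thesis by (rule countable_subset) (intro countable_image \<B>(1))
qed

definition plaque :: "('p, 'a::euclidean_space) chart \<Rightarrow> 'a set \<Rightarrow> 'p \<Rightarrow> 'p set"
  where "plaque c W q = {y \<in> fst c. snd c y - snd c q \<in> W}"

lemma plaque_eq:
  assumes "subspace W" "y \<in> plaque c W q"
  shows "plaque c W y = plaque c W q"
proof -
  have w: "snd c y - snd c q \<in> W" using assms(2) by (simp add: plaque_def)
  have "snd c z - snd c y \<in> W \<longleftrightarrow> snd c z - snd c q \<in> W" for z
    using subspace_add[OF assms(1) _ w, of "snd c z - snd c y"]
      subspace_diff[OF assms(1) _ w, of "snd c z - snd c q"] by auto
  then show ?thesis by (simp add: plaque_def)
qed

lemma mem_plaque: "subspace W \<Longrightarrow> q \<in> fst c \<Longrightarrow> q \<in> plaque c W q"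
  by (simp add: plaque_def subspace_0)

text \<open>A plaque of \<open>c\<close> need not meet a chart domain in a connected set, and so it may meet
  many plaques of \<open>c'\<close>. The map from its points to plaques of \<open>c'\<close> is
  locally constant, hence has a countable image by second countability.\<close>

lemma countable_plaques_meeting_plaque:
  assumes Y: "smooth_manifold Y" and c: "foliated_chart Y F c W" and c': "foliated_chart Y F c' W'"
  shows "countable (plaque c' W' ` (plaque c W q \<inter> fst c'))"
proof (rule countable_image_locally_constant[OF smooth_manifoldD(3)[OF Y]])
  obtain U \<phi> U' \<phi>' where e: "c = (U, \<phi>)" "c' = (U', \<phi>')" by (metis prod.exhaust)
  fix x assume x: "x \<in> plaque c W q \<inter> fst c'"
  then have xU: "x \<in> U" "x \<in> U'" by (auto simp: plaque_def e)
  obtain Z where Z: "openin (topol Y) Z" "x \<in> Z" "Z \<subseteq> U" "Z \<subseteq> U'"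
    "\<And>y. y \<in> Z \<Longrightarrow> \<phi> y - \<phi> x \<in> W \<Longrightarrow> \<phi>' y - \<phi>' x \<in> W'"
    using plaque_transition[OF Y c[unfolded e] c'[unfolded e] xU] by blast
  have W: "subspace W" "subspace W'"
    using foliated_chartD(3)[OF c[unfolded e]] foliated_chartD(3)[OF c'[unfolded e]] by auto
  have "plaque c' W' y = plaque c' W' x" if y: "y \<in> Z \<inter> (plaque c W q \<inter> fst c')" for y
  proof -
    have "y \<in> plaque c W x" using plaque_eq[OF W(1), of x c q] x y by simp
    then have "\<phi>' y - \<phi>' x \<in> W'" using Z(5)[of y] y by (simp add: plaque_def e)
    then have "y \<in> plaque c' W' x" using y by (simp add: plaque_def e)
    then show ?thesis by (rule plaque_eq[OF W(2)])
  qed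
  then show "\<exists>Z. openin (topol Y) Z \<and> x \<in> Z \<and> (\<forall>y\<in>Z \<inter> (plaque c W q \<inter> fst c'). plaque c' W' y = plaque c' W' x)"
    using Z(1,2) by blast
qed

lemma sym_same_plaque: "sym (same_plaque Y F)"
proof (rule symI)
  fix q q' assume "(q, q') \<in> same_plaque Y F"
  then obtain c W where c: "foliated_chart Y F c W" "q \<in> fst c" "q' \<in> fst c" "snd c q - snd c q' \<in> W"
    unfolding same_plaque_def by blast
  have "subspace W" using c(1) by (simp add: foliated_chart_def)
  then have "snd c q' - snd c q \<in> W" using subspace_neg[OF _ c(4)] by simp
  then show "(q', q) \<in> same_plaque Y F" unfolding same_plaque_def using c by blast
qed

lemma leaf_eq:
  assumes "(q, q') \<in> same_plaque Y F"
  shows "leaf Y F q' = leaf Y F q"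
  using assms symD[OF sym_same_plaque assms] unfolding leaf_def
  by (auto intro: converse_rtrancl_into_rtrancl)

lemma mem_leaf: "q \<in> leaf Y F q"
  by (simp add: leaf_def)

text \<open>Choose a countable family of foliated charts that covers \<open>Y\<close> and contains
  \<open>c\<close>. Its plaques form a graph, two plaques being adjacent iff they meet, and each
  vertex has countably many neighbours. Hence the component \<open>K\<close> of a plaque through
  \<open>p\<close> is countable. The union of \<open>K\<close> contains the leaf: along a plaque
  of an arbitrary foliated chart, membership in this union is locally constant, and plaques are
  connected.\<close>

lemma leaf_meets_countably_many_plaques:
  fixes Y :: "('p, 'a::euclidean_space) mfd"
  assumes Y: "smooth_manifold Y" and F: "integrable_distribution Y F"
    and c: "foliated_chart Y F c W" and p: "p \<in> carr Y"
  shows "countable (plaque c W ` (leaf Y F p \<inter> fst c))"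
proof -
  define \<A> where "\<A> = {d. foliated_chart Y F (fst d) (snd d)}"
  let ?dom = "\<lambda>d::('p, 'a) chart \<times> 'a set. fst (fst d)"
  have op: "openin (topol Y) (?dom d)" if "d \<in> \<A>" for d
    using that max_atlasD(1)[of "fst (fst d)" "snd (fst d)" Y] by (auto simp: \<A>_def foliated_chart_def)
  have sub: "subspace (snd d)" if "d \<in> \<A>" for d
    using that by (auto simp: \<A>_def foliated_chart_def)
  have "(\<Union>d\<in>\<A>. ?dom d) = carr Y"
  proof
    show "(\<Union>d\<in>\<A>. ?dom d) \<subseteq> carr Y" using op openin_subset by blast
    show "carr Y \<subseteq> (\<Union>d\<in>\<A>. ?dom d)"
    proof
      fix q assume "q \<in> carr Y"
      then obtain d V where "foliated_chart Y F d V" "q \<in> fst d" using F by (auto simp: integrable_distribution_def)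
      then show "q \<in> (\<Union>d\<in>\<A>. ?dom d)" by (intro UN_I[of "(d, V)"]) (auto simp: \<A>_def)
    qed
  qed
  then have "\<exists>\<V>. countable \<V> \<and> \<V> \<subseteq> ?dom ` \<A> \<and> \<Union>\<V> = carr Y"
    by (intro Lindelof_spaceD second_countable_imp_Lindelof_space smooth_manifoldD(3)[OF Y])
      (use op in auto)
  then obtain \<V> where \<V>: "countable \<V>" "\<V> \<subseteq> ?dom ` \<A>" "\<Union>\<V> = carr Y"
    by (elim exE conjE) (rule that)
  have "\<exists>\<C>. countable \<C> \<and> \<C> \<subseteq> \<A> \<and> \<V> = ?dom ` \<C>"
    using \<V>(1,2) by (intro countable_subset_image[THEN iffD1]) simp
  then obtain \<C> where \<C>: "countable \<C>" "\<C> \<subseteq> \<A>" "\<V> = ?dom ` \<C>"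
    by (elim exE conjE) (rule that)
  define \<D> where "\<D> = insert (c, W) \<C>"
  have \<D>: "countable \<D>" "\<D> \<subseteq> \<A>" using \<C> c by (auto simp: \<D>_def \<A>_def)
  define \<P> where "\<P> = {plaque (fst d) (snd d) q | d q. d \<in> \<D> \<and> q \<in> ?dom d}"
  have inP: "plaque (fst d) (snd d) q \<in> \<P>" if "d \<in> \<D>" "q \<in> ?dom d" for d q
    unfolding \<P>_def using that by blast
  define R where "R = {(P, P'). P \<in> \<P> \<and> P' \<in> \<P> \<and> P \<inter> P' \<noteq> {}}"
  have cover: "\<exists>d\<in>\<D>. q \<in> ?dom d" if "q \<in> carr Y" for q
    using that \<V>(3) \<C>(3) by (auto simp: \<D>_def)
  have cR: "countable (R `` {P})" for P
  proof (cases "P \<in> \<P>")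
    case True
    then obtain d q where d: "d \<in> \<D>" "P = plaque (fst d) (snd d) q" by (auto simp: \<P>_def)
    have "R `` {P} \<subseteq> (\<Union>d'\<in>\<D>. plaque (fst d') (snd d') ` (P \<inter> ?dom d'))"
    proof
      fix P' assume "P' \<in> R `` {P}"
      then have "P' \<in> \<P>" "\<exists>y. y \<in> P \<and> y \<in> P'" by (auto simp: R_def)
      then obtain y d' q' where y: "y \<in> P" "y \<in> P'" "d' \<in> \<D>" "P' = plaque (fst d') (snd d') q'"
        unfolding \<P>_def by blast
      have "P' = plaque (fst d') (snd d') y"
        using plaque_eq[OF sub y(2)[unfolded y(4)]] y(3,4) \<D>(2) by auto
      moreover have "y \<in> ?dom d'" using y(2,4) by (simp add: plaque_def)
      ultimately show "P' \<in> (\<Union>d'\<in>\<D>. plaque (fst d') (snd d') ` (P \<inter> ?dom d'))" using y(1,3) by blast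
    qed
    moreover have "countable (\<Union>d'\<in>\<D>. plaque (fst d') (snd d') ` (P \<inter> ?dom d'))"
    proof (rule countable_UN[OF \<D>(1)])
      fix d' assume "d' \<in> \<D>"
      then show "countable (plaque (fst d') (snd d') ` (P \<inter> ?dom d'))"
        unfolding d(2) using d(1) \<D>(2)
        by (intro countable_plaques_meeting_plaque[OF Y, of F]) (auto simp: \<A>_def)
    qed
    ultimately show ?thesis by (rule countable_subset)
  next
    case False
    then have "R `` {P} = {}" by (auto simp: R_def)
    then show ?thesis by simp
  qed
  have "countable (R `` Z)" if "countable Z" for Z
  proof -
    have "R `` Z = (\<Union>P\<in>Z. R `` {P})" by blast
    then show ?thesis using countable_UN[OF that cR] by simp
  qed
  then have cK: "countable (R\<^sup>* `` {P})" for P by (rule countable_rtrancl) simp_all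
  obtain d0 where d0: "d0 \<in> \<D>" "p \<in> ?dom d0" using cover[OF p] by blast
  define P0 where "P0 = plaque (fst d0) (snd d0) p"
  have P0: "P0 \<in> \<P>" "p \<in> P0"
    unfolding P0_def using d0 \<D>(2) by (auto intro!: inP mem_plaque sub)
  define K where "K = R\<^sup>* `` {P0}"
  have K: "P' \<in> K" if "P \<in> K" "P \<in> \<P>" "P' \<in> \<P>" "y \<in> P" "y \<in> P'" for P P' y
    using that by (auto simp: K_def R_def intro: rtrancl_into_rtrancl)
  have KP: "P \<in> \<P>" if "P \<in> K" for P
  proof -
    have "(P0, P) \<in> R\<^sup>*" using that by (simp add: K_def)
    then show ?thesis by (induction rule: rtrancl_induct) (auto simp: P0 R_def)
  qed
  have step: "q' \<in> \<Union>K" if q: "q \<in> \<Union>K" and qq: "(q, q') \<in> same_plaque Y F" for q q'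
  proof -
    obtain U \<phi> V where f: "foliated_chart Y F (U, \<phi>) V" "q \<in> U" "q' \<in> U" "\<phi> q - \<phi> q' \<in> V"
      using qq by (auto simp: same_plaque_def)
    note fD = foliated_chartD[OF f(1)]
    let ?\<gamma> = "\<lambda>t::real. \<phi> q' + t *\<^sub>R (\<phi> q - \<phi> q')"
    let ?y = "\<lambda>t. inv_into U \<phi> (?\<gamma> t)"
    have y: "?y t \<in> U" "\<phi> (?y t) = ?\<gamma> t" if "t \<in> {0..1}" for t
    proof -
      have "?\<gamma> t = (1 - t) *\<^sub>R \<phi> q' + t *\<^sub>R \<phi> q" by (simp add: algebra_simps)
      moreover have "(1 - t) *\<^sub>R \<phi> q' + t *\<^sub>R \<phi> q \<in> \<phi> ` U"
        using f(2,3) that by (intro convexD[OF fD(2)]) auto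
      ultimately have "?\<gamma> t \<in> \<phi> ` U" by simp
      then show "?y t \<in> U" "\<phi> (?y t) = ?\<gamma> t" by (auto simp: inv_into_into f_inv_into_f)
    qed
    have y01: "?y 0 = q'" "?y 1 = q"
      using f(2,3) max_atlasD(5)[OF fD(1)] by (auto simp: inv_into_f_f)
    have "?y 0 \<in> \<Union>K"
    proof (rule connected_induction_simple[where P = "\<lambda>t. ?y t \<in> \<Union>K" and S = "{0..1::real}" and a = 1])
      show "?y 1 \<in> \<Union>K" using q y01 by simp
      fix t :: real assume t: "t \<in> {0..1}"
      have "?y t \<in> carr Y" using y(1)[OF t] max_atlasD(2)[OF fD(1)] by blast
      then obtain d where d: "d \<in> \<D>" "?y t \<in> ?dom d" using cover by blast
      obtain U2 \<phi>2 V2 where d2: "d = ((U2, \<phi>2), V2)" by (metis prod.exhaust)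
      have fd: "foliated_chart Y F (U2, \<phi>2) V2" using d(1) \<D>(2) by (auto simp: \<A>_def d2)
      have yd: "?y t \<in> U2" using d(2) by (simp add: d2)
      obtain Z where Z: "openin (topol Y) Z" "?y t \<in> Z" "Z \<subseteq> U2"
        "\<And>y. y \<in> Z \<Longrightarrow> \<phi> y - \<phi> (?y t) \<in> V \<Longrightarrow> \<phi>2 y - \<phi>2 (?y t) \<in> V2"
        by (rule plaque_transition[OF Y f(1) fd y(1)[OF t] yd]) (rule that, assumption+)
      obtain B where B: "open B" "\<phi> (?y t) \<in> B" "\<And>y. y \<in> U \<Longrightarrow> \<phi> y \<in> B \<Longrightarrow> y \<in> Z"
        using chart_nbhd[OF fD(1) Z(1) y(1)[OF t] Z(2)] by blast
      let ?P = "plaque (U2, \<phi>2) V2 (?y t)"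
      have P: "?P \<in> \<P>" using inP[OF d] by (simp add: d2)
      let ?T = "{0..1} \<inter> ?\<gamma> -` B"
      have "open (?\<gamma> -` B)" by (intro open_vimage B(1) continuous_intros)
      then have T: "openin (top_of_set {0..1}) ?T" by (simp add: openin_open_Int)
      have TP: "?y s \<in> ?P" if "s \<in> ?T" for s
      proof -
        have s: "s \<in> {0..1}" "?\<gamma> s \<in> B" using that by auto
        have sZ: "?y s \<in> Z" using B(3)[OF y(1)[OF s(1)]] y(2)[OF s(1)] s(2) by simp
        have "\<phi> (?y s) - \<phi> (?y t) = (s - t) *\<^sub>R (\<phi> q - \<phi> q')"
          using y(2)[OF s(1)] y(2)[OF t] by (simp add: algebra_simps)
        then have "\<phi> (?y s) - \<phi> (?y t) \<in> V" using subspace_scale[OF fD(3) f(4)] by simp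
        then show ?thesis using Z(3,4) sZ by (auto simp: plaque_def)
      qed
      have "?y s \<in> \<Union>K" if s: "r \<in> ?T" "s \<in> ?T" "?y r \<in> \<Union>K" for r s
      proof -
        obtain P1 where P1: "P1 \<in> K" "?y r \<in> P1" using s(3) by blast
        have "?P \<in> K" by (rule K[OF P1(1) KP[OF P1(1)] P P1(2) TP[OF s(1)]])
        then show ?thesis using TP[OF s(2)] by blast
      qed
      moreover have "t \<in> ?T" using t B(2) y(2)[OF t] by simp
      ultimately show "\<exists>T. openin (top_of_set {0..1}) T \<and> t \<in> T \<and> (\<forall>x\<in>T. \<forall>z\<in>T. ?y x \<in> \<Union>K \<longrightarrow> ?y z \<in> \<Union>K)"
        using T by blast
    qed auto
    then show ?thesis using y01 by simp
  qed
  have leafK: "q \<in> \<Union>K" if "q \<in> leaf Y F p" for q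
  proof -
    have "(p, q) \<in> (same_plaque Y F)\<^sup>*" using that by (simp add: leaf_def)
    then show ?thesis
    proof (induction rule: rtrancl_induct)
      case base
      then show ?case using P0(2) by (auto simp: K_def)
    qed (use step in blast)
  qed
  have "plaque c W ` (leaf Y F p \<inter> fst c) \<subseteq> K"
  proof
    fix P assume "P \<in> plaque c W ` (leaf Y F p \<inter> fst c)"
    then obtain y where y: "y \<in> leaf Y F p" "y \<in> fst c" "P = plaque c W y" by blast
    obtain P1 where P1: "P1 \<in> K" "y \<in> P1" using leafK[OF y(1)] by blast
    have "subspace W" using c by (simp add: foliated_chart_def)
    then have "y \<in> P" unfolding y(3) using y(2) by (rule mem_plaque)
    moreover have "P \<in> \<P>" unfolding y(3) using inP[of "(c, W)" y] y(2) by (simp add: \<D>_def)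
    ultimately show "P \<in> K" by (intro K[OF P1(1) KP[OF P1(1)] _ P1(2)])
  qed
  then show ?thesis unfolding K_def by (rule countable_subset) (rule cK)
qed

section \<open>Functions that are constant on the leaves\<close>

lemma Cinf_pullback:
  assumes Y: "smooth_manifold Y" and Q: "smooth_manifold Q" and \<pi>: "smooth_map Y Q \<pi>" and h: "h \<in> Cinf Q"
  shows "h \<circ> \<pi> \<in> Cinf Y"
proof (rule CinfI[OF Y])
  fix q assume q: "q \<in> carr Y"
  have cont: "continuous_map (topol Y) (topol Q) \<pi>" using \<pi> by (simp add: smooth_map_def)
  obtain U \<phi> where c: "(U, \<phi>) \<in> atlas Y" "(U, \<phi>) \<in> max_atlas Y" "q \<in> U" using chart_at[OF Y q] .
  have "\<pi> q \<in> carr Q" using cont q by (auto simp: continuous_map_def)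
  then obtain V \<psi> where d: "(V, \<psi>) \<in> atlas Q" "(V, \<psi>) \<in> max_atlas Q" "\<pi> q \<in> V" using chart_at[OF Q] by metis
  have "smooth_on (\<phi> ` (U \<inter> \<pi> -` V)) (\<psi> \<circ> \<pi> \<circ> inv_into U \<phi>)"
    using \<pi> c(1) d(1) by (auto simp: smooth_map_def)
  then have n: "smooth_near (U, \<phi>) (\<pi> -` V) (\<lambda>y. \<psi> (\<pi> y)) q"
    using smooth_on_chart_iff[OF max_atlasD(5)[OF c(2)], of "\<pi> -` V" "\<psi> \<circ> \<pi>"] c(3) d(3)
    by (auto simp: o_def)
  have "openin (topol Y) {x \<in> carr Y. \<pi> x \<in> V}"
    by (rule openin_continuous_map_preimage[OF cont max_atlasD(1)[OF d(2)]])
  then obtain B where "open B" "\<phi> q \<in> B" "\<And>y. y \<in> U \<Longrightarrow> \<phi> y \<in> B \<Longrightarrow> y \<in> {x \<in> carr Y. \<pi> x \<in> V}"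
    using chart_nbhd[OF c(2) _ c(3)] q d(3) by blast
  then have "smooth_near (U, \<phi>) UNIV (\<lambda>y. h (\<pi> y)) q"
    by (intro smooth_near_compose_map[OF CinfD[OF Q h d(2,3)] n]) (use c d in auto)
  then show "\<exists>U \<phi>. (U, \<phi>) \<in> max_atlas Y \<and> q \<in> U \<and> smooth_near (U, \<phi>) UNIV (h \<circ> \<pi>) q"
    using c by (auto simp: o_def)
qed

text \<open>A coordinate line in a direction of \<open>W\<close> stays in one plaque, hence in one leaf.\<close>

lemma distribution_kills_leafwise_constant:
  fixes Y :: "('p, 'a::euclidean_space) mfd"
  assumes Y: "smooth_manifold Y" and c: "foliated_chart Y F (U, \<phi>) W" and q: "q \<in> U" and v: "v \<in> F q"
  shows "v (h \<circ> leaf Y F) = 0"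
proof -
  note cD = foliated_chartD[OF c]
  note m = max_atlasD[OF cD(1)]
  obtain w where w: "w \<in> W" "v = coord_vec Y (U, \<phi>) q w" using v cD(5)[OF q] by blast
  obtain A where A: "open A" "\<phi> ` U = model Y \<inter> A" using m(3) by (auto simp: openin_open)
  let ?\<gamma> = "\<lambda>t::real. \<phi> q + t *\<^sub>R w"
  have o: "open (?\<gamma> -` A)" by (intro open_vimage A(1) continuous_intros)
  have 0: "0 \<in> ?\<gamma> -` A" using A(2) q by auto
  have eq: "leaf Y F (inv_into U \<phi> (?\<gamma> t)) = leaf Y F q" if "t \<in> ?\<gamma> -` A" for t
  proof -
    have "?\<gamma> t \<in> model Y"
      using w(1) cD(4) m(4) q smooth_manifoldD(1)[OF Y] by (intro subspace_add subspace_scale) auto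
    then have "?\<gamma> t \<in> \<phi> ` U" using that A(2) by auto
    then have "inv_into U \<phi> (?\<gamma> t) \<in> U" "\<phi> (inv_into U \<phi> (?\<gamma> t)) = ?\<gamma> t"
      by (auto simp: inv_into_into f_inv_into_f)
    moreover have "\<phi> q - ?\<gamma> t \<in> W" using subspace_scale[OF cD(3) w(1), of "- t"] by simp
    ultimately have "(q, inv_into U \<phi> (?\<gamma> t)) \<in> same_plaque Y F"
      unfolding same_plaque_def using c q by (auto intro!: exI[of _ U] exI[of _ \<phi>] exI[of _ W])
    then show ?thesis by (rule leaf_eq)
  qed
  have "((\<lambda>t. h (leaf Y F q)) has_real_derivative 0) (at 0)" by simp
  then have "((\<lambda>t. h (leaf Y F (inv_into U \<phi> (?\<gamma> t)))) has_real_derivative 0) (at 0)"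
    by (rule has_field_derivative_transform_within_open[OF _ o 0]) (simp add: eq)
  then show ?thesis by (simp add: w(2) coord_vec_def o_def DERIV_imp_deriv)
qed

text \<open>Suppose that \<open>v\<close> is in the kernel of the differential of the projection, but not in
  \<open>F p\<close>. In coordinates, let \<open>\<tau>\<close> be the projection to the leaf
  space and \<open>L\<close> its derivative at \<open>p\<close>; as the projection is a
  submersion, \<open>L\<close> has a linear right inverse \<open>R\<close>. The map
  \<open>\<Phi>(x) = R(\<tau>(x)) + (x - R(L x))\<close> has the identity as its derivative at
  \<open>p\<close>, so it attains all values close to \<open>\<Phi>(p)\<close>. Moving the value
  in the kernel direction of \<open>v\<close> yields a one-parameter family of points in the leaf
  of \<open>p\<close> that lie in distinct plaques, because the direction of \<open>v\<close> is
  not in \<open>W\<close>. But the leaf meets only countably many plaques of the chart.\<close>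

lemma leaf_kernel:
  fixes Y :: "('p, 'a::euclidean_space) mfd" and Q :: "('p set, 'a) mfd"
  assumes Y: "smooth_manifold Y" and F: "integrable_distribution Y F"
    and Q: "smooth_manifold Q" and sub: "submersion Y Q (leaf Y F)"
    and p: "p \<in> carr Y" and v: "v \<in> tangent_space Y p"
    and kernel: "\<And>h. h \<in> Cinf Q \<Longrightarrow> v (h \<circ> leaf Y F) = 0"
  shows "v \<in> F p"
proof (rule ccontr)
  assume vF: "v \<notin> F p"
  let ?\<pi> = "leaf Y F"
  note SY = smooth_manifoldD(1)[OF Y] and SQ = smooth_manifoldD(1)[OF Q]
  have sm: "smooth_map Y Q ?\<pi>" and push: "push_forward Q ?\<pi> ` tangent_space Y p = tangent_space Q (?\<pi> p)"
    using sub p by (auto simp: submersion_def)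
  have cont: "continuous_map (topol Y) (topol Q) ?\<pi>" using sm by (simp add: smooth_map_def)
  obtain c0 W where "foliated_chart Y F c0 W" "p \<in> fst c0"
    using F p unfolding integrable_distribution_def by blast
  then obtain U \<phi> where c: "foliated_chart Y F (U, \<phi>) W" "p \<in> U" by (metis prod.collapse)
  note cD = foliated_chartD[OF c(1)]
  note m = max_atlasD[OF cD(1)]
  obtain x1 where x1: "x1 \<in> model Y" "v = coord_vec Y (U, \<phi>) p x1"
    using v tangent_space_coord[OF Y cD(1) c(2)] by blast
  have x1W: "x1 \<notin> W" using vF x1(2) cD(5)[OF c(2)] by blast
  have "?\<pi> p \<in> carr Q" using cont p by (auto simp: continuous_map_def)
  then obtain V \<psi> where d: "(V, \<psi>) \<in> atlas Q" "(V, \<psi>) \<in> max_atlas Q" "?\<pi> p \<in> V" using chart_at[OF Q] by metis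
  note mQ = max_atlasD[OF d(2)]
  obtain X V' where X: "\<And>b. X b \<in> Cinf Q" "openin (topol Q) V'" "?\<pi> p \<in> V'" "V' \<subseteq> V"
    "\<And>b y. y \<in> V' \<Longrightarrow> X b y = \<psi> y \<bullet> b"
    "\<And>b y x. y \<in> V' \<Longrightarrow> x \<in> model Q \<Longrightarrow> coord_vec Q (V, \<psi>) y x (X b) = x \<bullet> b"
    by (rule chart_coordinates[OF Q d(2,3) mQ(1) d(3)]) (rule that, assumption+)
  \<comment> \<open>\<open>F\<close> provides a chart of the maximal atlas, but smoothness of the projection is known in charts
    of the atlas only.\<close>
  obtain B \<tau> where B: "open B" "\<phi> p \<in> B" "smooth_in B \<tau>"
    "\<And>y. y \<in> U \<Longrightarrow> ?\<pi> y \<in> V \<Longrightarrow> \<phi> y \<in> B \<Longrightarrow> \<psi> (?\<pi> y) = \<tau> (\<phi> y)"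
  proof -
    obtain A \<alpha> where a: "(A, \<alpha>) \<in> atlas Y" "(A, \<alpha>) \<in> max_atlas Y" "p \<in> A" using chart_at[OF Y p] by metis
    have "smooth_on (\<alpha> ` (A \<inter> ?\<pi> -` V)) (\<psi> \<circ> ?\<pi> \<circ> inv_into A \<alpha>)"
      using sm a(1) d(1) unfolding smooth_map_def by blast
    then have "smooth_near (A, \<alpha>) (?\<pi> -` V) (\<psi> \<circ> ?\<pi>) p"
      using smooth_on_chart_iff[OF max_atlasD(5)[OF a(2)], of "?\<pi> -` V" "\<psi> \<circ> ?\<pi>"] a(3) d(3) by blast
    then have "smooth_near (U, \<phi>) (?\<pi> -` V) (\<psi> \<circ> ?\<pi>) p"
      by (rule smooth_near_change_chart[OF Y a(2) cD(1) a(3) c(2)])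
    then show thesis by (rule smooth_nearE) (rule that, assumption+, simp)
  qed
  have o1: "openin (topol Y) {x \<in> carr Y. ?\<pi> x \<in> V'}"
    by (rule openin_continuous_map_preimage[OF cont X(2)])
  have p1: "p \<in> {x \<in> carr Y. ?\<pi> x \<in> V'}" using p X(3) by blast
  obtain B' where B': "open B'" "\<phi> p \<in> B'" "\<And>y. y \<in> U \<Longrightarrow> \<phi> y \<in> B' \<Longrightarrow> y \<in> {x \<in> carr Y. ?\<pi> x \<in> V'}"
    by (rule chart_nbhd[OF cD(1) o1 c(2) p1]) (rule that, assumption+)
  obtain \<rho>1 where \<rho>1: "\<rho>1 > 0" "cball (\<phi> p) \<rho>1 \<inter> model Y \<subseteq> \<phi> ` (U \<inter> U)"
    using chart_ball[OF cD(1) m(1) c(2) c(2)] by blast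
  obtain \<rho>2 where \<rho>2: "\<rho>2 > 0" "ball (\<phi> p) \<rho>2 \<subseteq> B \<inter> B'"
    using B(1,2) B'(1,2) open_contains_ball[of "B \<inter> B'"] by blast
  define \<rho> where "\<rho> = min \<rho>1 \<rho>2"
  let ?B = "ball (\<phi> p) \<rho>" and ?x0 = "\<phi> p"
  have \<rho>: "\<rho> > 0" "?B \<inter> model Y \<subseteq> \<phi> ` U" "?B \<subseteq> B" "?B \<subseteq> B'"
    using \<rho>1 \<rho>2 by (auto simp: \<rho>_def subset_iff)
  have x0: "?x0 \<in> ?B" "?x0 \<in> model Y" using \<rho>(1) m(4) c(2) by auto
  have inV: "?\<pi> y \<in> V'" if "y \<in> U" "\<phi> y \<in> ?B" for y using B'(3)[OF that(1)] that(2) \<rho>(4) by blast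
  have \<tau>: "\<psi> (?\<pi> y) = \<tau> (\<phi> y)" if "y \<in> U" "\<phi> y \<in> ?B" for y
    using B(4)[OF that(1)] inV[OF that] X(4) \<rho>(3) that(2) by blast
  define L where "L = frechet_derivative \<tau> (at ?x0)"
  have dL: "(\<tau> has_derivative L) (at ?x0)"
    unfolding L_def by (rule smooth_in_has_derivative[OF B(3,2)])
  have linL: "linear L" by (rule has_derivative_linear[OF dL])
  have LX: "coord_vec Y (U, \<phi>) p x (X b \<circ> ?\<pi>) = L x \<bullet> b" if "x \<in> model Y" for x b
  proof (rule coord_vec_eqI[OF cD(1) SY c(2) that Cinf_pullback[OF Y Q sm X(1)] open_ball x0(1)])
    show "(X b \<circ> ?\<pi>) y = \<tau> (\<phi> y) \<bullet> b" if "y \<in> U" "\<phi> y \<in> ?B" for y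
      using X(5)[OF inV[OF that]] \<tau>[OF that] by simp
    show "((\<lambda>x. \<tau> x \<bullet> b) has_derivative (\<lambda>x. L x \<bullet> b)) (at ?x0)"
      using dL by (rule has_derivative_inner_left)
  qed
  have Lx1: "L x1 = 0"
  proof (rule euclidean_eqI)
    show "L x1 \<bullet> b = 0 \<bullet> b" for b using LX[OF x1(1)] kernel[OF X(1)] x1(2) by simp
  qed
  have LW: "L w = 0" if "w \<in> W" for w
  proof (rule euclidean_eqI)
    have w: "w \<in> model Y" using that cD(4) by blast
    have "coord_vec Y (U, \<phi>) p w \<in> F p" using cD(5)[OF c(2)] that by blast
    then have "coord_vec Y (U, \<phi>) p w (X b \<circ> ?\<pi>) = 0" for b
      by (rule distribution_kills_leafwise_constant[OF Y c])
    then show "L w \<bullet> b = 0 \<bullet> b" for b using LX[OF w] by simp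
  qed
  have push_coord: "z = L x" if x: "x \<in> model Y" and z: "z \<in> model Q"
    and eq: "push_forward Q ?\<pi> (coord_vec Y (U, \<phi>) p x) = coord_vec Q (V, \<psi>) (?\<pi> p) z" for x z
  proof (rule euclidean_eqI)
    fix b
    have "z \<bullet> b = coord_vec Q (V, \<psi>) (?\<pi> p) z (X b)" using X(6)[OF X(3) z] by simp
    also have "\<dots> = coord_vec Y (U, \<phi>) p x (X b \<circ> ?\<pi>)"
      unfolding eq[symmetric] push_forward_def using X(1) by simp
    also have "\<dots> = L x \<bullet> b" by (rule LX[OF x])
    finally show "z \<bullet> b = L x \<bullet> b" .
  qed
  have LQ: "L x \<in> model Q" if x: "x \<in> model Y" for x
  proof -
    have "push_forward Q ?\<pi> (coord_vec Y (U, \<phi>) p x) \<in> tangent_space Q (?\<pi> p)"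
      using push coord_vec_tangent[OF Y cD(1) c(2) x] by blast
    then obtain z where "z \<in> model Q" "push_forward Q ?\<pi> (coord_vec Y (U, \<phi>) p x) = coord_vec Q (V, \<psi>) (?\<pi> p) z"
      using tangent_space_coord[OF Q d(2,3)] by auto
    then show ?thesis using push_coord[OF x] by metis
  qed
  have surj: "z \<in> L ` model Y" if z: "z \<in> model Q" for z
  proof -
    have "coord_vec Q (V, \<psi>) (?\<pi> p) z \<in> push_forward Q ?\<pi> ` tangent_space Y p"
      using push coord_vec_tangent[OF Q d(2,3) z] by blast
    then obtain x where "x \<in> model Y" "push_forward Q ?\<pi> (coord_vec Y (U, \<phi>) p x) = coord_vec Q (V, \<psi>) (?\<pi> p) z"
      using tangent_space_coord[OF Y cD(1) c(2)] by auto
    then show ?thesis using push_coord[OF _ z] by blast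
  qed
  obtain R where R: "range R \<subseteq> model Y" "linear R" "\<And>z. z \<in> L ` model Y \<Longrightarrow> L (R z) = z"
    using linear_exists_right_inverse_on[OF linL SY] by blast
  have LR: "L (R z) = z" if "z \<in> model Q" for z using R(3) surj[OF that] by blast
  obtain P where P: "linear P" "\<And>x. P x \<in> model Y" "\<And>x. x \<in> model Y \<Longrightarrow> P x = x"
    using orthogonal_projection[OF SY] by metis
  have PR: "P (R z) = R z" for z using P(3) R(1) by blast
  define G where "G x = R (\<tau> (P x))" for x
  define A where "A x = R (L (P x))" for x
  have linA: "linear A" unfolding A_def
    by (intro linearI) (simp_all add: linear_add[OF R(2)] linear_add[OF linL] linear_add[OF P(1)]
      linear_cmul[OF R(2)] linear_cmul[OF linL] linear_cmul[OF P(1)])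
  \<comment> \<open>\<open>A\<close> is a projection with the same kernel as \<open>L\<close> on the model space, and it fixes the values of \<open>G\<close>.\<close>
  have AA: "A (A x) = A x" for x
    unfolding A_def PR using LR[OF LQ[OF P(2)]] by simp
  define T where "T = P -` ?B"
  have linP: "bounded_linear P" using P(1) by (simp add: linear_conv_bounded_linear)
  have linR: "bounded_linear R" using R(2) by (simp add: linear_conv_bounded_linear)
  have T: "open T" unfolding T_def
    by (rule open_vimage[OF open_ball]) (rule linear_continuous_on[OF linP])
  have x0T: "?x0 \<in> T" unfolding T_def using x0 P(3) by simp
  have \<tau>Q: "\<tau> x \<in> model Q \<and> (\<exists>y\<in>U. \<phi> y = x)" if "x \<in> ?B" "x \<in> model Y" for x
  proof -
    have "x \<in> \<phi> ` U" using \<rho>(2) that by blast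
    then obtain y where y: "y \<in> U" "\<phi> y = x" by blast
    then have "\<tau> x = \<psi> (?\<pi> y)" "?\<pi> y \<in> V" using \<tau> inV X(4) that(1) by auto
    then show ?thesis using mQ(4) y by auto
  qed
  have AG: "A (G x) = G x" if "x \<in> T" for x
    unfolding A_def G_def PR using LR \<tau>Q[OF _ P(2), of x] that by (simp add: T_def)
  let ?\<Phi> = "\<lambda>x. G x + (x - A x)"
  have contP: "continuous_on T P" by (rule linear_continuous_on[OF linP])
  have contG: "continuous_on T G"
  proof -
    have "continuous_on T (\<lambda>x. \<tau> (P x))"
      by (rule continuous_on_compose2[OF smooth_in_continuous_on[OF B(3)] contP]) (use \<rho>(3) in \<open>auto simp: T_def\<close>)
    then show ?thesis unfolding G_def by (rule bounded_linear.continuous_on[OF linR])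
  qed
  have contA: "continuous_on T A" using linA by (simp add: linear_continuous_on linear_conv_bounded_linear)
  have dG: "(G has_derivative A) (at ?x0)"
  proof -
    have "(P has_derivative P) (at ?x0)" by (rule bounded_linear_imp_has_derivative[OF linP])
    moreover have "(\<tau> has_derivative L) (at (P ?x0))" using dL P(3) x0(2) by simp
    ultimately have "((\<lambda>x. \<tau> (P x)) has_derivative (\<lambda>x. L (P x))) (at ?x0)"
      using diff_chain_at by (metis (no_types, lifting) comp_apply ext)
    then show ?thesis unfolding G_def A_def by (rule bounded_linear.has_derivative[OF linR])
  qed
  have "?\<Phi> ?x0 \<in> interior (?\<Phi> ` T)"
  proof (rule sussmann_open_mapping[OF T _ x0T])
    show "continuous_on T ?\<Phi>" by (intro continuous_intros contG contA)
    have "(A has_derivative A) (at ?x0)" using linA by (simp add: bounded_linear_imp_has_derivative linear_conv_bounded_linear)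
    then have "(?\<Phi> has_derivative (\<lambda>h. A h + (h - A h))) (at ?x0)"
      by (intro has_derivative_add has_derivative_diff dG has_derivative_ident)
    then show "(?\<Phi> has_derivative id) (at ?x0)" by (simp add: id_def)
    show "bounded_linear (id :: 'a \<Rightarrow> 'a)" by (simp add: id_def bounded_linear_ident)
    show "?x0 \<in> interior T" using T x0T by (simp add: interior_open)
  qed auto
  then obtain \<epsilon> where \<epsilon>: "\<epsilon> > 0" "ball (?\<Phi> ?x0) \<epsilon> \<subseteq> ?\<Phi> ` T"
    using mem_interior by blast
  \<comment> \<open>For \<open>\<bar>t\<bar> < \<delta>\<close> the point \<open>\<Phi>(x0) + t x1\<close> is still in the ball; the summand \<open>1\<close> avoids a division
    by zero.\<close>
  define \<delta> where "\<delta> = \<epsilon> / (norm x1 + 1)"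
  have \<delta>: "\<delta> > 0" using \<epsilon>(1) by (simp add: \<delta>_def add_nonneg_pos)
  have "\<exists>y. y \<in> U \<and> ?\<pi> y = ?\<pi> p \<and> \<phi> y - A (\<phi> y) = ?x0 - A ?x0 + t *\<^sub>R x1"
    if t: "t \<in> {-\<delta><..<\<delta>}" for t
  proof -
    have "norm (t *\<^sub>R x1) < \<epsilon>"
    proof -
      have "\<bar>t\<bar> * (norm x1 + 1) < \<delta> * (norm x1 + 1)"
        using t by (intro mult_strict_right_mono) (auto simp: add_nonneg_pos)
      also have "\<delta> * (norm x1 + 1) = \<epsilon>"
        unfolding \<delta>_def by (simp add: add_nonneg_eq_0_iff)
      finally show ?thesis by (simp add: distrib_left)
    qed
    then have "?\<Phi> ?x0 + t *\<^sub>R x1 \<in> ?\<Phi> ` T" using \<epsilon>(2) by (auto simp: dist_norm subset_iff)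
    then obtain x where x: "x \<in> T" "?\<Phi> x = ?\<Phi> ?x0 + t *\<^sub>R x1" by auto
    have A\<Phi>: "A (?\<Phi> z) = G z" if "z \<in> T" for z
      by (simp add: linear_add[OF linA] linear_diff[OF linA] AA AG[OF that])
    have "A x1 = 0" unfolding A_def using P(3)[OF x1(1)] Lx1 linear_0[OF R(2)] by simp
    then have "A (?\<Phi> ?x0 + t *\<^sub>R x1) = A (?\<Phi> ?x0)" by (simp only: linear_add[OF linA] linear_cmul[OF linA]) simp
    then have G: "G x = G ?x0" using A\<Phi>[OF x(1)] A\<Phi>[OF x0T] x(2) by simp
    have xA: "x - A x = ?x0 - A ?x0 + t *\<^sub>R x1" using x(2) G by simp
    have Am: "A z \<in> model Y" for z unfolding A_def using R(1) by blast
    have "?x0 - A ?x0 + t *\<^sub>R x1 + A x \<in> model Y"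
      using SY Am x0(2) x1(1) by (intro subspace_add subspace_diff subspace_scale)
    then have xm: "x \<in> model Y" unfolding xA[symmetric] by simp
    have xB: "x \<in> ?B" using x(1) P(3)[OF xm] by (simp add: T_def)
    obtain y where y: "y \<in> U" "\<phi> y = x" using \<tau>Q[OF xB xm] by blast
    have "R (\<tau> x) = R (\<tau> ?x0)" using G P(3)[OF xm] P(3)[OF x0(2)] by (simp add: G_def)
    then have "\<tau> x = \<tau> ?x0" using LR \<tau>Q[OF xB xm] \<tau>Q[OF x0] by metis
    then have "\<psi> (?\<pi> y) = \<psi> (?\<pi> p)" using \<tau>[of y] \<tau>[OF c(2) x0(1)] y xB by simp
    moreover have "?\<pi> y \<in> V" using inV[of y] y xB X(4) by auto
    ultimately have "?\<pi> y = ?\<pi> p" using mQ(5) d(3) by (auto dest: inj_onD)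
    then show ?thesis using y xA by blast
  qed
  then obtain y where y: "\<And>t. t \<in> {-\<delta><..<\<delta>} \<Longrightarrow> y t \<in> U"
    "\<And>t. t \<in> {-\<delta><..<\<delta>} \<Longrightarrow> ?\<pi> (y t) = ?\<pi> p"
    "\<And>t. t \<in> {-\<delta><..<\<delta>} \<Longrightarrow> \<phi> (y t) - A (\<phi> (y t)) = ?x0 - A ?x0 + t *\<^sub>R x1"
    by metis
  let ?I = "{-\<delta><..<\<delta>}" and ?P = "\<lambda>t. plaque (U, \<phi>) W (y t)"
  have "inj_on ?P ?I"
  proof (rule inj_onI)
    fix t s assume t: "t \<in> ?I" and s: "s \<in> ?I" and eq: "?P t = ?P s"
    have "y t \<in> ?P t" using y(1)[OF t] by (intro mem_plaque cD(3)) simp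
    then have w: "\<phi> (y t) - \<phi> (y s) \<in> W" unfolding eq by (simp add: plaque_def)
    then have "A (\<phi> (y t) - \<phi> (y s)) = 0"
      unfolding A_def using P(3) cD(4) LW linear_0[OF R(2)] by (simp add: subset_iff)
    then have "\<phi> (y t) - \<phi> (y s) = (\<phi> (y t) - A (\<phi> (y t))) - (\<phi> (y s) - A (\<phi> (y s)))"
      by (simp add: linear_diff[OF linA])
    also have "\<dots> = (t - s) *\<^sub>R x1" unfolding y(3)[OF t] y(3)[OF s] by (simp add: algebra_simps)
    finally have "(t - s) *\<^sub>R x1 \<in> W" using w by simp
    then have "(1 / (t - s)) *\<^sub>R ((t - s) *\<^sub>R x1) \<in> W" by (rule subspace_scale[OF cD(3)])
    then show "t = s" using x1W by (cases "t = s") auto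
  qed
  moreover have "countable (?P ` ?I)"
  proof (rule countable_subset)
    show "countable (plaque (U, \<phi>) W ` (leaf Y F p \<inter> fst (U, \<phi>)))"
      by (rule leaf_meets_countably_many_plaques[OF Y F c(1) p])
    have "y t \<in> leaf Y F p" if "t \<in> ?I" for t using mem_leaf[of "y t" Y F] y(2)[OF that] by simp
    then show "?P ` ?I \<subseteq> plaque (U, \<phi>) W ` (leaf Y F p \<inter> fst (U, \<phi>))" using y(1) by auto
  qed
  ultimately have "countable ?I" by (simp add: countable_image_inj_eq)
  then show False using uncountable_open_interval[of "-\<delta>" \<delta>] \<delta> by simp
qed

text \<open>The differentials at \<open>p\<close> of functions pulled back from the leaf space form a space
  of covectors whose common kernel is \<open>F p\<close>, by \<open>leaf_kernel\<close>. In finite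
  dimension such a space consists of all covectors that annihilate \<open>F p\<close>.\<close>

lemma annihilator_differential:
  fixes Y :: "('p, 'a::euclidean_space) mfd"
  assumes Y: "smooth_manifold Y" and F: "regular_integrable_distribution Y F"
    and p: "p \<in> carr Y" and \<alpha>: "\<alpha> \<in> cotangent_space Y p" "\<And>v. v \<in> F p \<Longrightarrow> \<alpha> v = 0"
  obtains g where "g \<in> Cinf_ann Y (carr Y) F" "differential Y p g = \<alpha>"
proof -
  have int: "integrable_distribution Y F" using F by (simp add: regular_integrable_distribution_def)
  obtain Q :: "('p set, 'a) mfd" where Q: "smooth_manifold Q" "submersion Y Q (leaf Y F)"
    using F unfolding regular_integrable_distribution_def by blast
  have sm: "smooth_map Y Q (leaf Y F)" using Q(2) by (simp add: submersion_def)
  let ?pull = "\<lambda>h. h \<circ> leaf Y F"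
  have pull: "?pull h \<in> Cinf Y" if "h \<in> Cinf Q" for h by (rule Cinf_pullback[OF Y Q(1) sm that])
  have ann: "?pull h \<in> Cinf_ann Y (carr Y) F" if "h \<in> Cinf Q" for h
  proof -
    have "v (?pull h) = 0" if q: "q \<in> carr Y" and v: "v \<in> F q" for q v
    proof -
      obtain d V where "foliated_chart Y F d V" "q \<in> fst d"
        using int q unfolding integrable_distribution_def by blast
      then show ?thesis
        using distribution_kills_leafwise_constant[OF Y, of F "fst d" "snd d" V q v h] v by simp
    qed
    then show ?thesis using pull[OF that] by (simp add: Cinf_ann_def differential_def)
  qed
  obtain U \<phi> where c: "(U, \<phi>) \<in> max_atlas Y" "p \<in> U" using chart_at[OF Y p] by metis
  note S = smooth_manifoldD(1)[OF Y]
  let ?\<iota> = "coord_vec Y (U, \<phi>) p"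
  define V where "V = {\<beta>. \<exists>h\<in>Cinf Q. \<forall>x\<in>model Y. ?\<iota> x (?pull h) = x \<bullet> \<beta>}"
  have \<iota>: "?\<iota> x \<in> tangent_space Y p" if "x \<in> model Y" for x by (rule coord_vec_tangent[OF Y c that])
  have subV: "subspace V"
  proof (rule subspaceI)
    show "0 \<in> V" unfolding V_def
      using tangent_zero[OF Y \<iota>] Cinf_zero[OF Q(1)] by (auto intro!: bexI[of _ 0] simp: zero_fun_def o_def)
    show "a + b \<in> V" if "a \<in> V" "b \<in> V" for a b
    proof -
      from that obtain h k where h: "h \<in> Cinf Q" "\<forall>x\<in>model Y. ?\<iota> x (?pull h) = x \<bullet> a"
        and k: "k \<in> Cinf Q" "\<forall>x\<in>model Y. ?\<iota> x (?pull k) = x \<bullet> b" unfolding V_def by blast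
      have "?pull (h + k) = ?pull h + ?pull k" by (simp add: fun_eq_iff)
      then have "?\<iota> x (?pull (h + k)) = x \<bullet> (a + b)" if "x \<in> model Y" for x
        using tangent_spaceD(1)[OF \<iota>[OF that] pull[OF h(1)] pull[OF k(1)]] h(2) k(2) that
        by (simp only: inner_add_right)
      then show ?thesis unfolding V_def using Cinf_add[OF Q(1) h(1) k(1)] by blast
    qed
    show "r *\<^sub>R a \<in> V" if "a \<in> V" for r a
    proof -
      from that obtain h where h: "h \<in> Cinf Q" "\<forall>x\<in>model Y. ?\<iota> x (?pull h) = x \<bullet> a"
        unfolding V_def by blast
      have "?pull (r *\<^sub>R h) = r *\<^sub>R ?pull h" by (simp add: fun_eq_iff)
      then have "?\<iota> x (?pull (r *\<^sub>R h)) = x \<bullet> (r *\<^sub>R a)" if "x \<in> model Y" for x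
        using tangent_spaceD(2)[OF \<iota>[OF that] pull[OF h(1)], of r] h(2) that
        by (simp only: inner_scaleR_right)
      then show ?thesis unfolding V_def using Cinf_scaleR[OF Q(1) h(1)] by blast
    qed
  qed
  obtain \<beta> where \<beta>': "\<And>x. x \<in> model Y \<Longrightarrow> \<alpha> (?\<iota> x) = x \<bullet> \<beta>"
    using covector_gradient[OF Y c \<alpha>(1)] by blast
  have "\<beta> \<in> V"
  proof (rule mem_subspace_if_orthogonal[OF subV])
    fix u assume u: "\<And>y. y \<in> V \<Longrightarrow> y \<bullet> u = 0"
    have um: "u \<in> model Y"
    proof (rule mem_subspace_if_orthogonal[OF S])
      fix z assume z: "\<And>y. y \<in> model Y \<Longrightarrow> y \<bullet> z = 0"
      have "\<forall>x\<in>model Y. ?\<iota> x (?pull 0) = x \<bullet> z"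
        using tangent_zero[OF Y \<iota>] z by (simp add: zero_fun_def o_def)
      then have "z \<in> V" unfolding V_def using Cinf_zero[OF Q(1)] by blast
      from u[OF this] show "u \<bullet> z = 0" by (simp add: inner_commute)
    qed
    have "?\<iota> u (?pull h) = 0" if h: "h \<in> Cinf Q" for h
    proof -
      obtain \<gamma> where \<gamma>: "\<And>x. x \<in> model Y \<Longrightarrow> ?\<iota> x (?pull h) = x \<bullet> \<gamma>"
        using chart_gradient[OF Y c pull[OF h]] by blast
      then have "\<gamma> \<in> V" unfolding V_def using h by blast
      from u[OF this] show ?thesis using \<gamma>[OF um] by (simp add: inner_commute)
    qed
    then have "?\<iota> u \<in> F p" by (rule leaf_kernel[OF Y int Q p \<iota>[OF um]])
    then show "\<beta> \<bullet> u = 0" using \<alpha>(2) \<beta>'[OF um] by (simp add: inner_commute)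
  qed
  then obtain h where h: "h \<in> Cinf Q" "\<And>x. x \<in> model Y \<Longrightarrow> ?\<iota> x (?pull h) = x \<bullet> \<beta>"
    unfolding V_def by blast
  have "differential Y p (?pull h) v = \<alpha> v" for v
  proof (cases "v \<in> tangent_space Y p")
    case True
    then obtain x where "x \<in> model Y" "v = ?\<iota> x" using tangent_space_coord[OF Y c] by blast
    then show ?thesis using h(2) \<beta>' True by (simp add: differential_def)
  next
    case False
    then show ?thesis using \<alpha>(1) by (simp add: differential_def cotangent_space_def linear_between_def)
  qed
  then show thesis using that[OF ann[OF h(1)]] by blast
qed

section \<open>Functions with prescribed conormal differential\<close>

lemma dim_image_plus_dim_kernel:
  fixes K :: "'a::euclidean_space \<Rightarrow> 'b::euclidean_space"
  assumes K: "linear K" and S: "subspace S"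
  shows "dim (K ` S) + dim {x \<in> S. K x = 0} = dim S"
proof -
  define A where "A = {x \<in> S. K x = 0}"
  have A: "subspace A" "A \<subseteq> S"
    using S by (auto simp: A_def subspace_def linear_0[OF K] linear_add[OF K] linear_cmul[OF K])
  define C where "C = {y \<in> S. \<forall>x\<in>A. orthogonal x y}"
  have d: "dim C + dim A = dim S"
    unfolding C_def by (rule dim_subspace_orthogonal_to_vectors[OF A(1) S A(2)])
  have C: "subspace C"
    using S by (auto simp: C_def subspace_def orthogonal_clauses)
  have "inj_on K C"
  proof (rule inj_onI)
    fix x y assume "x \<in> C" "y \<in> C" "K x = K y"
    then have "x - y \<in> C" "K (x - y) = 0"
      using subspace_diff[OF C] linear_diff[OF K] by auto
    then have "orthogonal (x - y) (x - y)" by (auto simp: C_def A_def)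
    then show "x = y" by (simp add: orthogonal_def)
  qed
  then have "dim (K ` C) = dim C" using C by (intro dim_image_eq[OF K]) (simp add: span_eq_iff[THEN iffD2])
  moreover have "K ` S = K ` C"
  proof
    show "K ` C \<subseteq> K ` S" by (auto simp: C_def)
    obtain P where P: "linear P" "\<And>x. P x \<in> A" "\<And>x y. y \<in> A \<Longrightarrow> (x - P x) \<bullet> y = 0"
      using orthogonal_projection[OF A(1)] by metis
    show "K ` S \<subseteq> K ` C"
    proof
      fix z assume "z \<in> K ` S"
      then obtain x where x: "x \<in> S" "z = K x" by blast
      have "x - P x \<in> C"
        using x(1) P(2,3) A(2) S by (auto simp: C_def orthogonal_def inner_commute intro!: subspace_diff)
      moreover have "K (x - P x) = z" using P(2)[of x] x(2) by (simp add: linear_diff[OF K] A_def)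
      ultimately show "z \<in> K ` C" by blast
    qed
  qed
  ultimately show ?thesis using d by (simp add: A_def)
qed

text \<open>Gram-Schmidt without normalisation: vector fields \<open>n\<^sub>i\<close> that are linearly
  independent at \<open>x0\<close> have smooth dual fields nearby. When a field
  \<open>n\<^sub>k\<close> is added, one takes a constant vector that is dual to it at
  \<open>x0\<close>, makes it orthogonal to the old fields by means of the old dual fields,
  divides by its product with \<open>n\<^sub>k\<close>, which is nonzero near \<open>x0\<close>,
  and corrects the old dual fields.\<close>

lemma smooth_dual_frame:
  fixes n :: "'i \<Rightarrow> 'a::euclidean_space \<Rightarrow> 'b::euclidean_space"
  assumes "finite I" "open B" "x0 \<in> B" "\<And>i. i \<in> I \<Longrightarrow> smooth_in B (n i)"
    and "\<And>j. j \<in> I \<Longrightarrow> n j x0 \<notin> span ((\<lambda>i. n i x0) ` (I - {j}))"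
  shows "\<exists>B' c. open B' \<and> x0 \<in> B' \<and> B' \<subseteq> B \<and> (\<forall>i\<in>I. smooth_in B' (c i)) \<and>
    (\<forall>x\<in>B'. \<forall>i\<in>I. \<forall>j\<in>I. c i x \<bullet> n j x = (if i = j then 1 else 0))"
  using assms(1,4,5)
proof (induction I rule: finite_induct)
  case empty
  then show ?case using assms(2,3) by auto
next
  case (insert k I)
  have ind: "n j x0 \<notin> span ((\<lambda>i. n i x0) ` (I - {j}))" if "j \<in> I" for j
  proof
    assume "n j x0 \<in> span ((\<lambda>i. n i x0) ` (I - {j}))"
    then have "n j x0 \<in> span ((\<lambda>i. n i x0) ` (insert k I - {j}))"
      by (rule subsetD[OF span_mono, rotated]) auto
    then show False using insert.prems(2)[of j] that by simp
  qed
  obtain B' c where B': "open B'" "x0 \<in> B'" "B' \<subseteq> B" "\<And>i. i \<in> I \<Longrightarrow> smooth_in B' (c i)"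
    "\<And>x i j. x \<in> B' \<Longrightarrow> i \<in> I \<Longrightarrow> j \<in> I \<Longrightarrow> c i x \<bullet> n j x = (if i = j then 1 else 0)"
    using insert.IH insert.prems(1) ind by (metis insertCI)
  have nB: "smooth_in B' (n i)" if "i \<in> insert k I" for i
    by (rule smooth_in_subset[OF insert.prems(1)[OF that] B'(3)])
  have "n k x0 \<notin> span ((\<lambda>i. n i x0) ` (insert k I - {k}))" by (rule insert.prems(2)) simp
  then have nk: "n k x0 \<notin> span ((\<lambda>i. n i x0) ` I)" using insert.hyps(2) by simp
  obtain P where P: "linear P" "\<And>x. P x \<in> span ((\<lambda>i. n i x0) ` I)"
    "\<And>x y. y \<in> span ((\<lambda>i. n i x0) ` I) \<Longrightarrow> (x - P x) \<bullet> y = 0"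
    using orthogonal_projection[OF subspace_span] by metis
  define e where "e = n k x0 - P (n k x0)"
  have e0: "e \<noteq> 0" using nk P(2)[of "n k x0"] by (auto simp: e_def)
  have ee: "e \<bullet> n k x0 = e \<bullet> e" using P(2,3) by (simp add: e_def inner_diff_right)
  define \<gamma> where "\<gamma> = (1 / (e \<bullet> e)) *\<^sub>R e"
  have \<gamma>: "\<gamma> \<bullet> n k x0 = 1" "\<And>i. i \<in> I \<Longrightarrow> \<gamma> \<bullet> n i x0 = 0"
    using e0 ee P(3) by (auto simp: \<gamma>_def e_def span_base)
  define d where "d x = \<gamma> - (\<Sum>i\<in>I. (\<gamma> \<bullet> n i x) *\<^sub>R c i x)" for x
  have sd: "smooth_in B' d"
    unfolding d_def using nB B'(1,4)
    by (intro smooth_in_diff smooth_in_sum smooth_in_scaleR smooth_in_inner smooth_in_const) auto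
  have dn: "d x \<bullet> n j x = 0" if "x \<in> B'" "j \<in> I" for x j
  proof -
    have "(\<Sum>i\<in>I. (\<gamma> \<bullet> n i x) * (c i x \<bullet> n j x)) = (\<Sum>i\<in>I. if i = j then \<gamma> \<bullet> n j x else 0)"
      using B'(5)[OF that(1) _ that(2)] by (intro sum.cong) auto
    then show ?thesis
      using insert.hyps(1) that(2) by (simp add: d_def inner_diff_left inner_sum_left)
  qed
  have d0: "d x0 = \<gamma>" using \<gamma>(2) by (simp add: d_def)
  define m where "m x = d x \<bullet> n k x" for x
  have sm: "smooth_in B' m" unfolding m_def by (intro smooth_in_inner B'(1) sd nB) simp
  define B'' where "B'' = B' \<inter> m -` (- {0})"
  have "open (- {0::real})" by (simp add: open_Compl)
  then have oB: "open B''"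
    unfolding B''_def using continuous_on_open_vimage[OF B'(1)] smooth_in_continuous_on[OF sm]
    by (metis Int_commute)
  have xB: "x0 \<in> B''" using B'(2) \<gamma>(1) d0 by (simp add: B''_def m_def)
  have sub: "B'' \<subseteq> B'" by (auto simp: B''_def)
  define ck where "ck x = (1 / m x) *\<^sub>R d x" for x
  have sck: "smooth_in B'' ck"
    unfolding ck_def
    by (intro smooth_in_scaleR oB smooth_in_divide smooth_in_const smooth_in_subset[OF sm sub] smooth_in_subset[OF sd sub])
      (simp add: B''_def)
  have ckn: "ck x \<bullet> n j x = (if j = k then 1 else 0)" if "x \<in> B''" "j \<in> insert k I" for x j
    using that dn[of x j] insert.hyps(2) by (auto simp: ck_def m_def B''_def)
  define c' where "c' i = (if i = k then ck else (\<lambda>x. c i x - (c i x \<bullet> n k x) *\<^sub>R ck x))" for i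
  have "smooth_in B'' (c' i)" if "i \<in> insert k I" for i
  proof (cases "i = k")
    case False
    then have "smooth_in B'' (c i)" "smooth_in B'' (n k)"
      using that B'(4) nB[of k] by (auto intro: smooth_in_subset[OF _ sub])
    then have "smooth_in B'' (\<lambda>x. c i x - (c i x \<bullet> n k x) *\<^sub>R ck x)"
      by (intro smooth_in_diff smooth_in_scaleR smooth_in_inner sck oB)
    then show ?thesis using False by (simp add: c'_def)
  qed (simp add: c'_def sck)
  moreover have "c' i x \<bullet> n j x = (if i = j then 1 else 0)"
    if x: "x \<in> B''" and i: "i \<in> insert k I" and j: "j \<in> insert k I" for x i j
  proof (cases "i = k")
    case True
    then show ?thesis using ckn[OF x j] by (auto simp: c'_def)
  next
    case False
    then have iI: "i \<in> I" using i by simp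
    show ?thesis
    proof (cases "j = k")
      case True
      then show ?thesis using False ckn[OF x j] by (simp add: c'_def inner_diff_left)
    next
      case False
      then have "j \<in> I" using j by simp
      moreover have "x \<in> B'" using x sub by blast
      ultimately show ?thesis
        using False \<open>i \<noteq> k\<close> ckn[OF x j] B'(5)[of x i j] iI by (simp add: c'_def inner_diff_left)
    qed
  qed
  ultimately show ?case using oB xB sub B'(3) by (intro exI[of _ B''] exI[of _ c']) auto
qed

lemma Cinf_annD:
  assumes "f \<in> Cinf_ann M N E"
  shows "f \<in> Cinf M" "\<And>p v. p \<in> N \<Longrightarrow> v \<in> E p \<Longrightarrow> E p \<subseteq> tangent_space M p \<Longrightarrow> v f = 0"
  using assms by (auto simp: Cinf_ann_def differential_def split: if_splits)

lemma Cinf_annI: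
  assumes "f \<in> Cinf M" "\<And>p v. p \<in> N \<Longrightarrow> v \<in> E p \<Longrightarrow> v f = 0"
  shows "f \<in> Cinf_ann M N E"
  using assms by (auto simp: Cinf_ann_def differential_def)

context
  fixes M :: "('p, 'a::euclidean_space) mfd" and N :: "'p set" and W :: "'a set" and Y :: "('p, 'a) mfd"
    and r s :: nat and E :: "'p \<Rightarrow> 'p tvec set"
  assumes M: "smooth_manifold M" and N: "submanifold M N W" and Y: "Y = induced_mfd M N W"
    and E: "subbundle_along M Y r E"
    and rank_F: "\<And>q. q \<in> N \<Longrightarrow> dim (tangential_part M Y E q) = s"
begin

lemma subbundleD:
  assumes "q \<in> N"
  shows "subspace (E q)" "E q \<subseteq> tangent_space M q" "dim (E q) = r"
  using E assms unfolding subbundle_along_def induced_simps(3)[OF M N Y] by blast+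

text \<open>In a slice chart at \<open>q\<close>, the fibre of \<open>E\<close> becomes a subspace of the
  model space, and the fibre of \<open>E \<inter> TN\<close> its intersection with
  \<open>W\<close>.\<close>

lemma coord_subspace:
  assumes c: "(U, \<phi>) \<in> slice_charts M N W" and q: "q \<in> U" "q \<in> N"
  defines "Eh \<equiv> {x \<in> model M. coord_vec M (U, \<phi>) q x \<in> E q}"
  shows "subspace Eh" "Eh \<subseteq> model M" "E q = coord_vec M (U, \<phi>) q ` Eh" "dim Eh = r"
    "dim (Eh \<inter> W) = s"
proof -
  note cM = slice_chartsD(1)[OF c]
  note S = smooth_manifoldD(1)[OF M]
  note ED = subbundleD[OF q(2)]
  show sub: "subspace Eh"
    unfolding Eh_def using S ED(1)
    by (intro subspaceI) (auto simp: coord_vec_zero[OF M cM q(1)] coord_vec_linear[OF M cM q(1)]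
      subspace_0 subspace_add subspace_scale)
  show Em: "Eh \<subseteq> model M" by (auto simp: Eh_def)
  show e: "E q = coord_vec M (U, \<phi>) q ` Eh"
    using ED(2) tangent_space_coord[OF M cM q(1)] by (auto simp: Eh_def)
  show "dim Eh = r" using dim_coord_vec[OF M cM q(1) sub Em] e ED(3) by simp
  have "tangential_part M Y E q = coord_vec Y (U \<inter> N, \<phi>) q ` (Eh \<inter> W)"
    unfolding tangential_part_def tangent_induced_coord[OF M N Y c q]
    using push_coord_vec[OF M N Y c q] submanifoldD(3)[OF M N Y] by (auto simp: Eh_def)
  moreover have "dim (coord_vec Y (U \<inter> N, \<phi>) q ` (Eh \<inter> W)) = dim (Eh \<inter> W)"
    by (rule dim_coord_vec[OF smooth_manifold_induced[OF M N Y] slice_chart_induced[OF M N Y c]])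
      (use q sub submanifoldD(2)[OF M N Y] in \<open>auto simp: induced_simps(2)[OF M N Y] intro: subspace_inter\<close>)
  ultimately show "dim (Eh \<inter> W) = s" using rank_F[OF q(2)] by simp
qed

text \<open>The right-hand side is independent of the point: \<open>E\<close> is tangent to \<open>N\<close>
  either everywhere or nowhere.\<close>

lemma subbundle_tangent_iff:
  assumes q: "q \<in> N"
  shows "E q \<subseteq> tangent_image M Y q \<longleftrightarrow> s = r"
proof -
  obtain U \<phi> where c: "(U, \<phi>) \<in> slice_charts M N W" "q \<in> U" using slice_chart_at[OF M N Y q] .
  note cM = slice_chartsD(1)[OF c(1)]
  define Eh where "Eh = {x \<in> model M. coord_vec M (U, \<phi>) q x \<in> E q}"
  note e = coord_subspace[OF c q, folded Eh_def]
  have "E q \<subseteq> tangent_image M Y q \<longleftrightarrow> Eh \<subseteq> W"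
    unfolding tangent_image_coord[OF M N Y c q] e(3)
    using inj_on_image_subset_iff[OF coord_vec_inj[OF M cM c(2)] e(2) submanifoldD(3)[OF M N Y]] .
  also have "\<dots> \<longleftrightarrow> Eh \<inter> W = Eh" by blast
  also have "\<dots> \<longleftrightarrow> s = r"
  proof
    assume "s = r"
    then show "Eh \<inter> W = Eh"
      using e by (intro subspace_dim_equal subspace_inter submanifoldD(2)[OF M N Y]) auto
  qed (use e in auto)
  finally show ?thesis .
qed

text \<open>A smooth section is only given by the smoothness of its values on functions; its coordinates are
  its values on the cut-off coordinate functions.\<close>

lemma local_frame:
  assumes c: "(U, \<phi>) \<in> slice_charts M N W" and p: "p \<in> U" "p \<in> N"
  obtains n :: "nat \<Rightarrow> 'a \<Rightarrow> 'a" and B V where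
    "open B" "\<phi> p \<in> B" "openin (topol M) V" "p \<in> V" "V \<subseteq> U"
    "\<And>i. i < r \<Longrightarrow> smooth_in B (n i)"
    "\<And>q. q \<in> V \<Longrightarrow> q \<in> N \<Longrightarrow> \<phi> q \<in> B \<Longrightarrow>
      {x \<in> model M. coord_vec M (U, \<phi>) q x \<in> E q} = span ((\<lambda>i. n i (\<phi> q)) ` {..<r})"
proof -
  note cM = slice_chartsD(1)[OF c]
  note S = smooth_manifoldD(1)[OF M]
  have "p \<in> carr Y" using p(2) by (simp only: induced_simps(3)[OF M N Y])
  then have "\<exists>U s. openin (topol Y) U \<and> p \<in> U \<and> (\<forall>q\<in>U. span ((\<lambda>i. s i q) ` {..<r}) = E q) \<and>
      (\<forall>i<r. \<forall>f\<in>Cinf M. smooth_fun_on Y U (\<lambda>q. s i q f))"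
    using E unfolding subbundle_along_def by (elim conjE) (erule (1) bspec)
  then obtain V0 t where V0': "openin (topol Y) V0" "p \<in> V0"
    "\<forall>q\<in>V0. span ((\<lambda>i. t i q) ` {..<r}) = E q"
    "\<forall>i<r. \<forall>f\<in>Cinf M. smooth_fun_on Y V0 (\<lambda>q. t i q f)"
    by (elim exE conjE) (rule that)
  have V0: "openin (topol Y) V0" "p \<in> V0"
    "\<And>q. q \<in> V0 \<Longrightarrow> span ((\<lambda>i. t i q) ` {..<r}) = E q"
    "\<And>i f. i < r \<Longrightarrow> f \<in> Cinf M \<Longrightarrow> smooth_fun_on Y V0 (\<lambda>q. t i q f)"
    using V0' by simp_all
  obtain V1 where V1: "openin (topol M) V1" "V0 = V1 \<inter> N"
    using V0(1) unfolding induced_simps(1)[OF M N Y] openin_subtopology by blast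
  have pV1: "p \<in> V1" using V0(2) V1(2) by blast
  obtain X V where X: "\<And>b. X b \<in> Cinf M" "openin (topol M) V" "p \<in> V" "V \<subseteq> U" "V \<subseteq> V1"
    "\<And>b y x. y \<in> V \<Longrightarrow> x \<in> model M \<Longrightarrow> coord_vec M (U, \<phi>) y x (X b) = x \<bullet> b"
    by (rule chart_coordinates[OF M cM p(1) V1(1) pV1]) (rule that, assumption+)
  have "\<exists>B g. open B \<and> \<phi> p \<in> B \<and> smooth_in B g \<and>
      (\<forall>y\<in>U \<inter> N. y \<in> V0 \<longrightarrow> \<phi> y \<in> B \<longrightarrow> t i y (X b) = g (\<phi> y))" if "i < r" for i b
  proof -
    have V0c: "V0 \<subseteq> carr Y" using V0(1) by (rule openin_subset)
    have "smooth_near (U \<inter> N, \<phi>) V0 (\<lambda>q. t i q (X b)) p"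
      using smooth_fun_on_iff(1)[OF smooth_manifold_induced[OF M N Y] V0c, of "\<lambda>q. t i q (X b)"]
        V0(2) V0(4)[OF that X(1)] slice_chart_induced[OF M N Y c] p by auto
    then show ?thesis by (rule smooth_nearE) blast
  qed
  then obtain Bf gf where Bf: "\<And>i b. i < r \<Longrightarrow> open (Bf i b)" "\<And>i b. i < r \<Longrightarrow> \<phi> p \<in> Bf i b"
    "\<And>i b. i < r \<Longrightarrow> smooth_in (Bf i b) (gf i b)"
    "\<And>i b y. i < r \<Longrightarrow> y \<in> U \<inter> N \<Longrightarrow> y \<in> V0 \<Longrightarrow> \<phi> y \<in> Bf i b \<Longrightarrow> t i y (X b) = gf i b (\<phi> y)"
    by metis
  define B where "B = (\<Inter>i\<in>{..<r}. \<Inter>b\<in>Basis. Bf i b)"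
  have oB: "open B" unfolding B_def using Bf(1) by (intro open_INT ballI finite_lessThan finite_Basis) simp
  have pB: "\<phi> p \<in> B" using Bf(2) by (simp add: B_def)
  define n where "n i x = (\<Sum>b\<in>Basis. gf i b x *\<^sub>R b)" for i x
  have "smooth_in B (n i)" if "i < r" for i
    unfolding n_def
  proof (intro smooth_in_sum smooth_in_scaleR oB smooth_in_const)
    fix b :: 'a assume "b \<in> Basis"
    then show "smooth_in B (gf i b)"
      using that by (intro smooth_in_subset[OF Bf(3)[OF that]]) (auto simp: B_def)
  qed
  moreover have "{x \<in> model M. coord_vec M (U, \<phi>) q x \<in> E q} = span ((\<lambda>i. n i (\<phi> q)) ` {..<r})"
    (is "?Eh = span ?n") if q: "q \<in> V" "q \<in> N" "\<phi> q \<in> B" for q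
  proof -
    have qU: "q \<in> U" and qV0: "q \<in> V0" using q X(4,5) V1(2) by auto
    let ?\<iota> = "coord_vec M (U, \<phi>) q"
    note e = coord_subspace[OF c qU q(2)]
    have t: "t i q = ?\<iota> (n i (\<phi> q)) \<and> n i (\<phi> q) \<in> ?Eh" if i: "i < r" for i
    proof -
      have "t i q \<in> span ((\<lambda>i. t i q) ` {..<r})" by (rule span_base) (use i in auto)
      then have "t i q \<in> ?\<iota> ` ?Eh" using V0(3)[OF qV0] e(3) by simp
      then obtain x where x: "x \<in> model M" "t i q = ?\<iota> x" "x \<in> ?Eh"
        by (elim imageE) (rule that, simp_all)
      have "gf i b (\<phi> q) = x \<bullet> b" if "b \<in> Basis" for b
        using Bf(4)[OF i _ qV0, of b] X(6)[OF q(1) x(1), of b] x(2) qU q(2,3) i that by (auto simp: B_def)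
      then have "n i (\<phi> q) = x" unfolding n_def by (simp add: euclidean_representation)
      then show ?thesis using x by simp
    qed
    have nE: "?n \<subseteq> ?Eh" using t by blast
    have sp: "span ?n \<subseteq> ?Eh" by (rule span_minimal[OF nE e(1)])
    have "?Eh \<subseteq> span ?n"
    proof
      fix x assume x: "x \<in> ?Eh"
      have "subspace (?\<iota> ` span ?n)"
      proof (rule subspaceI)
        show "0 \<in> ?\<iota> ` span ?n" using coord_vec_zero[OF M cM qU] by (intro image_eqI[of _ _ 0]) (auto simp: span_zero)
        show "v + w \<in> ?\<iota> ` span ?n" if vw: "v \<in> ?\<iota> ` span ?n" "w \<in> ?\<iota> ` span ?n" for v w
        proof -
          from vw obtain y z where y: "y \<in> span ?n" "v = ?\<iota> y" and z: "z \<in> span ?n" "w = ?\<iota> z" by blast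
          have "v + w = ?\<iota> (y + z)" unfolding y(2) z(2)
            by (rule coord_vec_linear(1)[OF M cM qU, symmetric]) (use sp y(1) z(1) in auto)
          then show ?thesis using span_add[OF y(1) z(1)] by blast
        qed
        show "a *\<^sub>R v \<in> ?\<iota> ` span ?n" if vw: "v \<in> ?\<iota> ` span ?n" for a v
        proof -
          from vw obtain y where y: "y \<in> span ?n" "v = ?\<iota> y" by blast
          have "a *\<^sub>R v = ?\<iota> (a *\<^sub>R y)" unfolding y(2)
            by (rule coord_vec_linear(2)[OF M cM qU, symmetric]) (use sp y(1) in auto)
          then show ?thesis using span_scale[OF y(1)] by blast
        qed
      qed
      moreover have "(\<lambda>i. t i q) ` {..<r} \<subseteq> ?\<iota> ` span ?n"
      proof (rule image_subsetI)
        fix i assume "i \<in> {..<r}"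
        then show "t i q \<in> ?\<iota> ` span ?n"
          using t[of i] by (intro image_eqI[of _ _ "n i (\<phi> q)"] span_base) auto
      qed
      ultimately have "span ((\<lambda>i. t i q) ` {..<r}) \<subseteq> ?\<iota> ` span ?n" by (intro span_minimal)
      then have "?\<iota> x \<in> ?\<iota> ` span ?n" using V0(3)[OF qV0] x by auto
      then obtain y where y: "y \<in> span ?n" "?\<iota> x = ?\<iota> y" by (elim imageE) (rule that)
      have "x = y" by (rule inj_onD[OF coord_vec_inj[OF M cM qU] y(2)]) (use x y(1) sp in auto)
      then show "x \<in> span ?n" using y(1) by simp
    qed
    then show ?thesis using sp by blast
  qed
  ultimately show thesis by (rule that[OF oB pB X(2,3,4)])
qed

text \<open>In a slice chart let \<open>K = 1 - P\<close> be the projection that forgets the directions of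
  \<open>N\<close>. The normal components of \<open>E\<close> span spaces of the constant
  dimension \<open>r - s\<close>, so that their annihilator has a smooth section \<open>a\<close>
  near \<open>p\<close> that represents \<open>\<alpha>\<close> at \<open>p\<close>. The function
  \<open>a(P x) \<bullet> K x\<close> vanishes on \<open>N\<close>, and its differential at a
  point \<open>x\<close> of \<open>N\<close> is \<open>a(x) \<bullet> K\<close>, which annihilates
  \<open>E\<close>. A bump function makes it global.\<close>

lemma conormal_function:
  assumes p: "p \<in> N" and \<alpha>: "\<alpha> \<in> cotangent_space M p"
    "\<And>v. v \<in> E p \<Longrightarrow> \<alpha> v = 0" "\<And>v. v \<in> tangent_image M Y p \<Longrightarrow> \<alpha> v = 0"
  obtains h where "h \<in> Cinf_ann M N E" "\<And>y. y \<in> N \<Longrightarrow> h y = 0" "differential M p h = \<alpha>"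
proof -
  obtain U \<phi> where c: "(U, \<phi>) \<in> slice_charts M N W" "p \<in> U" using slice_chart_at[OF M N Y p] .
  note cM = slice_chartsD(1)[OF c(1)]
  note inW = slice_chartsD(3)[OF c(1)]
  note S = smooth_manifoldD(1)[OF M]
  note WD = submanifoldD[OF M N Y]
  obtain P where P: "linear P" "\<And>x. P x \<in> W" "\<And>x. x \<in> W \<Longrightarrow> P x = x"
    using orthogonal_projection[OF WD(2)] by metis
  define K where "K x = x - P x" for x
  have K: "linear K" unfolding K_def
    by (intro linearI) (simp_all add: linear_add[OF P(1)] linear_cmul[OF P(1)] algebra_simps)
  have K0: "K x = 0 \<longleftrightarrow> x \<in> W" for x using P(2,3) by (auto simp: K_def) (metis P(2))
  obtain n :: "nat \<Rightarrow> 'a \<Rightarrow> 'a" and B V where n: "open B" "\<phi> p \<in> B" "openin (topol M) V" "p \<in> V" "V \<subseteq> U"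
    "\<And>i. i < r \<Longrightarrow> smooth_in B (n i)"
    "\<And>q. q \<in> V \<Longrightarrow> q \<in> N \<Longrightarrow> \<phi> q \<in> B \<Longrightarrow>
      {x \<in> model M. coord_vec M (U, \<phi>) q x \<in> E q} = span ((\<lambda>i. n i (\<phi> q)) ` {..<r})"
    by (rule local_frame[OF c p]) (rule that, assumption+)
  define Eh where "Eh q = {x \<in> model M. coord_vec M (U, \<phi>) q x \<in> E q}" for q
  have rank: "dim (K ` Eh q) + s = r" if "q \<in> U" "q \<in> N" for q
  proof -
    note e = coord_subspace[OF c(1) that, folded Eh_def]
    have "{x \<in> Eh q. K x = 0} = Eh q \<inter> W" using K0 by blast
    then show ?thesis using dim_image_plus_dim_kernel[OF K e(1)] e(4,5) by simp
  qed
  define k where "k i x = K (n i x)" for i x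
  have sk: "smooth_in B (k i)" if "i < r" for i
    unfolding k_def by (rule smooth_in_compose[OF n(1) open_UNIV _ n(6)[OF that] smooth_in_linear[OF open_UNIV K]]) simp
  have KE: "K ` Eh q = span ((\<lambda>i. k i (\<phi> q)) ` {..<r})" if "q \<in> V" "q \<in> N" "\<phi> q \<in> B" for q
    unfolding Eh_def n(7)[OF that] k_def linear_span_image[OF K, symmetric] image_image ..
  \<comment> \<open>A subfamily that is a basis of the normal components at \<open>p\<close> stays one nearby, because their
    rank is constant.\<close>
  let ?x0 = "\<phi> p"
  obtain b where b: "b \<subseteq> (\<lambda>i. k i ?x0) ` {..<r}" "independent b"
    "(\<lambda>i. k i ?x0) ` {..<r} \<subseteq> span b" "card b = dim ((\<lambda>i. k i ?x0) ` {..<r})"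
    using basis_exists by blast
  obtain I where I: "I \<subseteq> {..<r}" "inj_on (\<lambda>i. k i ?x0) I" "b = (\<lambda>i. k i ?x0) ` I"
    using b(1) unfolding subset_image_inj by blast
  have finI: "finite I" using I(1) finite_subset by blast
  have cardI: "card I = dim (K ` Eh q)" if "q \<in> U" "q \<in> N" for q
  proof -
    have "card I = dim (K ` Eh p)"
      using b(4) card_image[OF I(2)] I(3) KE[OF n(4) p n(2)] by simp
    then show ?thesis using rank[OF that] rank[OF c(2) p] by simp
  qed
  have indI: "k j ?x0 \<notin> span ((\<lambda>i. k i ?x0) ` (I - {j}))" if j: "j \<in> I" for j
  proof -
    have "(\<lambda>i. k i ?x0) ` (I - {j}) = b - {k j ?x0}"
      using I(2,3) j by (auto simp: inj_on_def)
    then show ?thesis using b(2) j I(3) by (auto simp: dependent_def)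
  qed
  have skI: "smooth_in B (k i)" if "i \<in> I" for i using sk I(1) that by blast
  obtain B' cf where B': "open B'" "?x0 \<in> B'" "B' \<subseteq> B" "\<And>i. i \<in> I \<Longrightarrow> smooth_in B' (cf i)"
    "\<And>x i j. x \<in> B' \<Longrightarrow> i \<in> I \<Longrightarrow> j \<in> I \<Longrightarrow> cf i x \<bullet> k j x = (if i = j then 1 else 0)"
    using smooth_dual_frame[OF finI n(1,2) skI indI] by metis
  have span_I: "K ` Eh q = span ((\<lambda>i. k i (\<phi> q)) ` I)" if q: "q \<in> V" "q \<in> N" "\<phi> q \<in> B'" for q
  proof -
    let ?k = "\<lambda>i. k i (\<phi> q)"
    have inj: "inj_on ?k I"
      using B'(5)[OF q(3)] by (intro inj_onI) (metis zero_neq_one)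
    have "independent (?k ` I)"
      unfolding dependent_def
    proof clarify
      fix j assume j: "j \<in> I" and "?k j \<in> span (?k ` I - {?k j})"
      moreover have "?k ` I - {?k j} \<subseteq> {y. cf j (\<phi> q) \<bullet> y = 0}"
        using B'(5)[OF q(3) j] by auto
      then have "span (?k ` I - {?k j}) \<subseteq> {y. cf j (\<phi> q) \<bullet> y = 0}"
        by (rule span_minimal[OF _ subspace_hyperplane])
      ultimately show False using B'(5)[OF q(3) j j] by auto
    qed
    then have "dim (span (?k ` I)) = card I"
      using card_image[OF inj] by (simp add: dim_eq_card_independent)
    moreover have "span (?k ` I) \<subseteq> K ` Eh q"
      unfolding KE[OF q(1,2) subsetD[OF B'(3) q(3)]] using I(1) by (intro span_mono) auto
    moreover have "subspace (K ` Eh q)"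
      using linear_subspace_image[OF K coord_subspace(1)[OF c(1), of q, folded Eh_def]] q n(5) by blast
    ultimately show ?thesis
      using cardI[of q] q(1,2) n(5) by (intro subspace_dim_equal[symmetric]) (auto simp: subspace_span)
  qed
  let ?\<iota> = "coord_vec M (U, \<phi>)"
  obtain \<beta> where \<beta>: "\<And>x. x \<in> model M \<Longrightarrow> \<alpha> (?\<iota> p x) = x \<bullet> \<beta>"
    using covector_gradient[OF M cM c(2) \<alpha>(1)] by blast
  have \<beta>P: "P x \<bullet> \<beta> = 0" for x
    using \<beta>[of "P x"] \<alpha>(3) P(2)[of x] WD(3) tangent_image_coord[OF M N Y c p] by auto
  have \<beta>k: "\<beta> \<bullet> k i ?x0 = 0" if i: "i \<in> I" for i
  proof -
    have "k i ?x0 \<in> K ` Eh p"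
      unfolding KE[OF n(4) p n(2)] using i I(1) by (intro span_base) auto
    then obtain x where x: "x \<in> Eh p" "k i ?x0 = x - P x" by (auto simp: K_def)
    have "x \<bullet> \<beta> = 0" using \<beta>[of x] \<alpha>(2) x(1) by (simp add: Eh_def)
    then show ?thesis using \<beta>P[of x] x(2) by (simp add: inner_diff_right inner_commute[of \<beta>])
  qed
  define a where "a x = \<beta> - (\<Sum>i\<in>I. (\<beta> \<bullet> k i x) *\<^sub>R cf i x)" for x
  have sa: "smooth_in B' a"
    unfolding a_def using B'(1,4) smooth_in_subset[OF skI B'(3)]
    by (intro smooth_in_diff smooth_in_sum smooth_in_scaleR smooth_in_inner smooth_in_const) auto
  have ak: "a x \<bullet> k j x = 0" if "x \<in> B'" "j \<in> I" for x j
  proof -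
    have "(\<Sum>i\<in>I. (\<beta> \<bullet> k i x) * (cf i x \<bullet> k j x)) = (\<Sum>i\<in>I. if i = j then \<beta> \<bullet> k j x else 0)"
      using B'(5)[OF that(1) _ that(2)] by (intro sum.cong) auto
    then show ?thesis using finI that(2) by (simp add: a_def inner_diff_left inner_sum_left)
  qed
  have a0: "a ?x0 = \<beta>" using \<beta>k by (simp add: a_def)
  have aK: "a (\<phi> q) \<bullet> K x = 0" if q: "q \<in> V" "q \<in> N" "\<phi> q \<in> B'" and x: "x \<in> Eh q" for q x
  proof -
    have "K x \<in> span ((\<lambda>i. k i (\<phi> q)) ` I)" using span_I[OF q] x by blast
    moreover have "span ((\<lambda>i. k i (\<phi> q)) ` I) \<subseteq> {y. a (\<phi> q) \<bullet> y = 0}"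
      using ak[OF q(3)] by (intro span_minimal subspace_hyperplane) auto
    ultimately show ?thesis by blast
  qed
  define u where "u x = a (P x) \<bullet> K x" for x
  define D where "D = P -` B'"
  have linP: "bounded_linear P" and linK: "bounded_linear K" using P(1) K by (simp_all add: linear_conv_bounded_linear)
  have oD: "open D" unfolding D_def by (rule open_vimage[OF B'(1) linear_continuous_on[OF linP]])
  have \<phi>W: "\<phi> q \<in> W" if "q \<in> U" "q \<in> N" for q using inW[OF that(1)] that(2) by simp
  have pD: "?x0 \<in> D" using P(3)[OF \<phi>W[OF c(2) p]] B'(2) by (simp add: D_def)
  have saP: "smooth_in D (\<lambda>x. a (P x))"
    by (rule smooth_in_compose[OF oD B'(1) _ smooth_in_bounded_linear[OF oD linP] sa]) (auto simp: D_def)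
  have su: "smooth_in D u"
    unfolding u_def by (rule smooth_in_inner[OF oD saP smooth_in_bounded_linear[OF oD linK]])
  have du: "frechet_derivative u (at (\<phi> q)) x = a (\<phi> q) \<bullet> K x" if q: "q \<in> U" "q \<in> N" "\<phi> q \<in> D" for q x
  proof -
    have "(u has_derivative (\<lambda>x. a (P (\<phi> q)) \<bullet> K x + frechet_derivative (\<lambda>x. a (P x)) (at (\<phi> q)) x \<bullet> K (\<phi> q))) (at (\<phi> q))"
      unfolding u_def
      by (rule has_derivative_inner[OF smooth_in_has_derivative[OF saP q(3)] bounded_linear_imp_has_derivative[OF linK]])
    then show ?thesis
      using frechet_derivative_at[symmetric] P(3)[OF \<phi>W[OF q(1,2)]] K0[of "\<phi> q"] \<phi>W[OF q(1,2)] by fastforce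
  qed
  obtain bf :: "'a \<Rightarrow> real" and C V' where bf: "closed C" "C \<subseteq> D" "\<And>x. x \<notin> C \<Longrightarrow> bf x = 0"
    "openin (topol M) V'" "p \<in> V'" "V' \<subseteq> U" "V' \<subseteq> V" "\<And>y. y \<in> V' \<Longrightarrow> bf (\<phi> y) = 1" "\<And>y. y \<in> V' \<Longrightarrow> \<phi> y \<in> D"
    "\<And>y. y \<in> U \<Longrightarrow> \<phi> y \<in> C \<Longrightarrow> y \<in> V"
    "\<And>u. smooth_in D u \<Longrightarrow> smooth_in UNIV (\<lambda>x. bf x * u x)"
    "\<And>u. smooth_in D u \<Longrightarrow> (\<lambda>y. if y \<in> U then bf (\<phi> y) * u (\<phi> y) else 0) \<in> Cinf M"
    "\<And>y. y \<in> carr M - U \<Longrightarrow> \<exists>Z. openin (topol M) Z \<and> y \<in> Z \<and> (\<forall>z\<in>Z \<inter> U. \<phi> z \<notin> C)"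
    by (rule chart_bump[OF M cM c(2) oD pD n(3,4)]) (rule that, assumption+)
  define h where "h = (\<lambda>y. if y \<in> U then bf (\<phi> y) * u (\<phi> y) else 0)"
  have hC: "h \<in> Cinf M" unfolding h_def by (rule bf(12)[OF su])
  have u0: "u (\<phi> q) = 0" if "q \<in> U" "q \<in> N" for q
    using K0[of "\<phi> q"] \<phi>W[OF that] by (simp add: u_def)
  have h0: "h y = 0" if "y \<in> N" for y using u0[of y] that by (simp add: h_def)
  let ?f = "\<lambda>x. bf x * u x"
  have dh: "?\<iota> q x h = bf (\<phi> q) * (a (\<phi> q) \<bullet> K x)" if q: "q \<in> U" "q \<in> N" and x: "x \<in> model M" for q x
  proof -
    have df: "(?f has_derivative frechet_derivative ?f (at (\<phi> q))) (at (\<phi> q))"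
      by (rule smooth_in_has_derivative[OF bf(11)[OF su] UNIV_I])
    have "?\<iota> q x h = frechet_derivative ?f (at (\<phi> q)) x"
      by (rule coord_vec_eqI[OF cM S q(1) x hC open_UNIV UNIV_I _ df]) (simp add: h_def)
    also have "\<dots> = bf (\<phi> q) * (a (\<phi> q) \<bullet> K x)"
    proof (cases "\<phi> q \<in> C")
      case True
      then have qD: "\<phi> q \<in> D" using bf(2) by blast
      have "(bf has_derivative frechet_derivative bf (at (\<phi> q))) (at (\<phi> q))"
      proof -
        have "smooth_in UNIV (\<lambda>x. bf x * 1)" by (rule bf(11)) (simp add: oD)
        then show ?thesis using smooth_in_has_derivative[of UNIV bf "\<phi> q"] by simp
      qed
      then have "(?f has_derivative (\<lambda>x. bf (\<phi> q) * frechet_derivative u (at (\<phi> q)) x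
          + frechet_derivative bf (at (\<phi> q)) x * u (\<phi> q))) (at (\<phi> q))"
        by (rule has_derivative_mult[OF _ smooth_in_has_derivative[OF su qD]])
      from fun_cong[OF frechet_derivative_at[OF this], of x] show ?thesis
        by (simp add: u0[OF q] du[OF q qD])
    next
      case False
      have "((\<lambda>x. 0) has_derivative (\<lambda>x. 0::real)) (at (\<phi> q))" by simp
      moreover have "open (- C)" using bf(1) by (simp add: open_Compl)
      ultimately have "(?f has_derivative (\<lambda>x. 0)) (at (\<phi> q))"
        by (rule has_derivative_transform_within_open[where s = "- C"]) (use False bf(3) in auto)
      from fun_cong[OF frechet_derivative_at[OF this], of x] bf(3)[OF False] show ?thesis by simp
    qed
    finally show ?thesis .
  qed
  have "h \<in> Cinf_ann M N E"
  proof (rule Cinf_annI[OF hC])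
    fix q v assume q: "q \<in> N" and v: "v \<in> E q"
    show "v h = 0"
    proof (cases "q \<in> U")
      case True
      obtain x where x: "x \<in> Eh q" "v = ?\<iota> q x"
        using coord_subspace(3)[OF c(1) True q] v by (auto simp: Eh_def)
      have "bf (\<phi> q) * (a (\<phi> q) \<bullet> K x) = 0"
      proof (cases "\<phi> q \<in> C")
        case qC: True
        have "\<phi> q \<in> B'" using bf(2) qC P(3)[OF \<phi>W[OF True q]] by (auto simp: D_def)
        then show ?thesis using aK[OF bf(10)[OF True qC] q _ x(1)] by simp
      qed (simp add: bf(3))
      then show ?thesis using dh[OF True q, of x] x by (simp add: Eh_def)
    next
      case False
      have "q \<in> carr M - U" using False q WD(1) by blast
      then obtain Z where Z: "openin (topol M) Z" "q \<in> Z" "\<forall>z\<in>Z \<inter> U. \<phi> z \<notin> C" using bf(13) by blast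
      have vT: "v \<in> tangent_space M q" using v subbundleD(2)[OF q] by blast
      have "v h = v 0"
        by (rule tangent_local[OF M vT hC Cinf_zero[OF M] Z(1,2)]) (use Z(3) bf(3) in \<open>auto simp: h_def\<close>)
      then show ?thesis using tangent_zero[OF M vT] by simp
    qed
  qed
  moreover have "differential M p h = \<alpha>"
  proof
    fix v
    show "differential M p h v = \<alpha> v"
    proof (cases "v \<in> tangent_space M p")
      case True
      then obtain x where x: "x \<in> model M" "v = ?\<iota> p x" using tangent_space_coord[OF M cM c(2)] by blast
      have "v h = \<beta> \<bullet> K x" using dh[OF c(2) p x(1)] bf(5,8) x(2) a0 by simp
      also have "\<dots> = \<alpha> v" using \<beta>[OF x(1)] \<beta>P[of x] x(2) by (simp add: K_def inner_diff_right inner_commute[of \<beta>])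
      finally show ?thesis using True by (simp add: differential_def)
    next
      case False
      then show ?thesis using \<alpha>(1) by (simp add: differential_def cotangent_space_def linear_between_def)
    qed
  qed
  ultimately show thesis using that h0 by blast
qed

end

section \<open>Lifting covectors that annihilate the subbundle\<close>

lemma Cinf_ann_add:
  assumes M: "smooth_manifold M" and fg: "f \<in> Cinf_ann M N E" "g \<in> Cinf_ann M N E"
  shows "f + g \<in> Cinf_ann M N E"
proof -
  have C: "f \<in> Cinf M" "g \<in> Cinf M" using fg by (auto simp: Cinf_ann_def)
  have "differential M p (f + g) v = 0" if "p \<in> N" "v \<in> E p" for p v
  proof -
    have "differential M p f v = 0" "differential M p g v = 0" using fg that by (auto simp: Cinf_ann_def)
    then show ?thesis
      using tangent_spaceD(1)[of v M p, OF _ C] by (cases "v \<in> tangent_space M p") (auto simp: differential_def)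
  qed
  then show ?thesis using Cinf_add[OF M C] by (simp add: Cinf_ann_def)
qed

text \<open>The restriction of \<open>\<alpha>\<close> to \<open>N\<close> annihilates \<open>F\<close>, so
  it is the differential of a leafwise constant function \<open>g\<close>, which extends to some
  \<open>f\<^sub>1\<close> in \<open>C\<^sup>\<infinity>(M)\<^sub>E\<close> by surjectivity of the
  restriction map. The difference between \<open>\<alpha>\<close> and the differential of
  \<open>f\<^sub>1\<close> annihilates both \<open>E\<close> and \<open>TN\<close>, and is the
  differential of a conormal function.\<close>

lemma annihilator_lift:
  fixes M :: "('p, 'a::euclidean_space) mfd"
  assumes M: "smooth_manifold M" and N: "submanifold M N W" and Y: "Y = induced_mfd M N W"
    and E: "subbundle_along M Y r E" and F: "F = tangential_part M Y E"
    and rank_F: "\<And>q. q \<in> N \<Longrightarrow> dim (tangential_part M Y E q) = s"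
    and reg: "regular_integrable_distribution Y F"
    and surj: "\<And>g. g \<in> Cinf_ann Y N F \<Longrightarrow> \<exists>f\<in>Cinf_ann M N E. \<forall>x\<in>N. f x = g x"
    and p: "p \<in> N" and \<alpha>: "\<alpha> \<in> cotangent_space M p" "\<And>v. v \<in> E p \<Longrightarrow> \<alpha> v = 0"
  obtains f where "f \<in> Cinf_ann M N E" "differential M p f = \<alpha>"
proof -
  note Ym = smooth_manifold_induced[OF M N Y]
  have carrY: "carr Y = N" by (rule induced_simps(3)[OF M N Y])
  note push = push_forward_tangent[OF M N Y p]
  have lin: "linear_between (tangent_space M p) UNIV \<alpha>" using \<alpha>(1) by (simp add: cotangent_space_def)
  define \<alpha>' where "\<alpha>' w = (if w \<in> tangent_space Y p then \<alpha> (push_forward M id w) else 0)" for w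
  have pa: "push_forward M id (w + w') = push_forward M id w + push_forward M id w'"
    and ps: "push_forward M id (c *\<^sub>R w) = c *\<^sub>R push_forward M id w" for w w' c
    by (auto simp: push_forward_def fun_eq_iff)
  have \<alpha>': "\<alpha>' \<in> cotangent_space Y p"
    using lin push(1) subspace_tangent_space[OF Ym, of p]
    by (auto simp: cotangent_space_def linear_between_def \<alpha>'_def pa ps subspace_add subspace_scale)
  have "\<alpha>' w = 0" if "w \<in> F p" for w
    using that \<alpha>(2) by (simp add: F tangential_part_def \<alpha>'_def)
  then obtain g where g: "g \<in> Cinf_ann Y (carr Y) F" "differential Y p g = \<alpha>'"
    using annihilator_differential[OF Ym reg _ \<alpha>'] p carrY by metis
  have gC: "g \<in> Cinf Y" using g(1) by (simp add: Cinf_ann_def)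
  obtain f1 where f1: "f1 \<in> Cinf_ann M N E" "\<forall>x\<in>N. f1 x = g x"
    using surj g(1) carrY by metis
  have f1C: "f1 \<in> Cinf M" using f1(1) by (simp add: Cinf_ann_def)
  define \<alpha>2 where "\<alpha>2 v = \<alpha> v - differential M p f1 v" for v
  have \<alpha>2: "\<alpha>2 \<in> cotangent_space M p"
    using lin subspace_tangent_space[OF M, of p]
    by (auto simp: cotangent_space_def linear_between_def \<alpha>2_def differential_def subspace_add subspace_scale algebra_simps)
  have "\<alpha>2 v = 0" if "v \<in> E p" for v
    using that \<alpha>(2) f1(1) p by (simp add: \<alpha>2_def Cinf_ann_def)
  moreover have "\<alpha>2 v = 0" if v: "v \<in> tangent_image M Y p" for v
  proof -
    obtain w where w: "w \<in> tangent_space Y p" "v = push_forward M id w" using v by (auto simp: tangent_image_def)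
    have "w f1 = w g"
      by (rule tangent_induced_extend[OF M N Y w(1) p gC Cinf_restrict[OF M N Y f1C] openin_topspace])
        (use f1(2) p submanifoldD(1)[OF M N Y] in auto)
    also have "\<dots> = \<alpha> v" using fun_cong[OF g(2), of w] w by (simp add: differential_def \<alpha>'_def)
    finally show ?thesis
      using push(1)[OF w(1)] push(2)[OF w(1) f1C] w(2) by (simp add: \<alpha>2_def differential_def)
  qed
  ultimately obtain h where h: "h \<in> Cinf_ann M N E" "differential M p h = \<alpha>2"
    using conormal_function[OF M N Y E rank_F p \<alpha>2] by metis
  have hC: "h \<in> Cinf M" using h(1) by (simp add: Cinf_ann_def)
  have "differential M p (f1 + h) v = \<alpha> v" for v
  proof (cases "v \<in> tangent_space M p")
    case True
    then show ?thesis
      using tangent_spaceD(1)[OF True f1C hC] fun_cong[OF h(2), of v] by (simp add: \<alpha>2_def differential_def)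
  next
    case False
    then show ?thesis using lin by (simp add: differential_def linear_between_def)
  qed
  then show thesis using that[OF Cinf_ann_add[OF M f1(1) h(1)]] by blast
qed

section \<open>Hamiltonian vectors along the submanifold\<close>

lemma nlists_update: "fs \<in> nlists n A \<Longrightarrow> f \<in> A \<Longrightarrow> fs[i := f] \<in> nlists n A"
  using set_update_subset_insert[of fs i f] unfolding nlists_def by (simp, blast)

context
  fixes n :: nat and M :: "('p, 'a::euclidean_space) mfd" and br :: "('p \<Rightarrow> real) list \<Rightarrow> 'p \<Rightarrow> real"
  assumes NP: "nambu_poisson n M br"
begin

lemma nambu_poissonD:
  shows "smooth_manifold M" "1 \<le> n"
    and "\<And>fs. fs \<in> nlists n (Cinf M) \<Longrightarrow> br fs \<in> Cinf M"
    and "\<And>fs i f g x. fs \<in> nlists n (Cinf M) \<Longrightarrow> i < n \<Longrightarrow> f \<in> Cinf M \<Longrightarrow> g \<in> Cinf M \<Longrightarrow> x \<in> carr M \<Longrightarrow>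
      br (fs[i := f + g]) x = br (fs[i := f]) x + br (fs[i := g]) x"
    and "\<And>fs i c f x. fs \<in> nlists n (Cinf M) \<Longrightarrow> i < n \<Longrightarrow> f \<in> Cinf M \<Longrightarrow> x \<in> carr M \<Longrightarrow>
      br (fs[i := c *\<^sub>R f]) x = c * br (fs[i := f]) x"
    and "\<And>fs i j x. fs \<in> nlists n (Cinf M) \<Longrightarrow> i < n \<Longrightarrow> j < n \<Longrightarrow> i \<noteq> j \<Longrightarrow> x \<in> carr M \<Longrightarrow>
      br (fs[i := fs ! j, j := fs ! i]) x = - br fs x"
    and "\<And>fs g h x. fs \<in> nlists (n - 1) (Cinf M) \<Longrightarrow> g \<in> Cinf M \<Longrightarrow> h \<in> Cinf M \<Longrightarrow> x \<in> carr M \<Longrightarrow>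
      br (fs @ [g * h]) x = g x * br (fs @ [h]) x + br (fs @ [g]) x * h x"
proof -
  note c1 = NP[unfolded nambu_poisson_def]
  note c2 = c1[THEN conjunct2]
  note c4 = c2[THEN conjunct2, THEN conjunct2]
  note c5 = c4[THEN conjunct2]
  note c6 = c5[THEN conjunct2]
  note c7 = c6[THEN conjunct2]
  note c8 = c7[THEN conjunct2]
  show "smooth_manifold M" "1 \<le> n" using c1 c2 by blast+
  show "br fs \<in> Cinf M" if "fs \<in> nlists n (Cinf M)" for fs
    using c4[THEN conjunct1, rule_format, OF that] .
  show "br (fs[i := f + g]) x = br (fs[i := f]) x + br (fs[i := g]) x"
    if "fs \<in> nlists n (Cinf M)" "i < n" "f \<in> Cinf M" "g \<in> Cinf M" "x \<in> carr M" for fs i f g x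
    using c5[THEN conjunct1, rule_format, OF that] .
  show "br (fs[i := c *\<^sub>R f]) x = c * br (fs[i := f]) x"
    if "fs \<in> nlists n (Cinf M)" "i < n" "f \<in> Cinf M" "x \<in> carr M" for fs i c f x
    using c6[THEN conjunct1, rule_format, OF that] .
  show "br (fs[i := fs ! j, j := fs ! i]) x = - br fs x"
    if "fs \<in> nlists n (Cinf M)" "i < n" "j < n" "i \<noteq> j" "x \<in> carr M" for fs i j x
    using c7[THEN conjunct1, rule_format, OF that] .
  show "br (fs @ [g * h]) x = g x * br (fs @ [h]) x + br (fs @ [g]) x * h x"
    if "fs \<in> nlists (n - 1) (Cinf M)" "g \<in> Cinf M" "h \<in> Cinf M" "x \<in> carr M" for fs g h x
    using c8[THEN conjunct1, rule_format, OF that] .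
qed

lemma snoc_nlists: "fs \<in> nlists (n - 1) A \<Longrightarrow> f \<in> A \<Longrightarrow> fs @ [f] \<in> nlists n A"
proof (rule nlistsI)
  assume "fs \<in> nlists (n - 1) A" "f \<in> A"
  then have fs: "length fs = n - 1" "set fs \<subseteq> A" "f \<in> A" by (simp_all only: nlistsE_length nlistsE_set)
  show "length (fs @ [f]) = n" unfolding length_append fs(1) using nambu_poissonD(2) by simp
  show "set (fs @ [f]) \<subseteq> A" using fs by simp
qed

lemma snoc_update: "fs \<in> nlists (n - 1) A \<Longrightarrow> fs @ [f] = (fs @ [g])[n - 1 := f]"
  by (simp add: list_update_append)

text \<open>The Leibniz rule is assumed in the last argument; skew-symmetry carries it to all others. Hence
  the bracket is a tangent vector in each argument, and depends on that argument only through its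
  differential.\<close>

lemma bracket_slot_tangent:
  assumes fs: "fs \<in> nlists n (Cinf M)" and i: "i < n" and p: "p \<in> carr M"
  shows "(\<lambda>f. if f \<in> Cinf M then br (fs[i := f]) p else 0) \<in> tangent_space M p"
proof (rule tangent_spaceI)
  note D = nambu_poissonD
  note M = D(1)
  have n1: "n - 1 < n" and n2: "Suc (n - 1) = n" using D(2) by linarith+
  have leib: "br (gs[n - 1 := f * g]) p = f p * br (gs[n - 1 := g]) p + g p * br (gs[n - 1 := f]) p"
    if "gs \<in> nlists n (Cinf M)" "f \<in> Cinf M" "g \<in> Cinf M" for gs f g
  proof -
    have len: "length gs = n" and set: "set gs \<subseteq> Cinf M"
      using that(1) by (rule nlistsE_length, rule nlistsE_set)
    have "gs[n - 1 := k] = take (n - 1) gs @ k # drop (Suc (n - 1)) gs" for k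
      by (rule upd_conv_take_nth_drop) (simp only: len n1)
    then have upd: "gs[n - 1 := k] = take (n - 1) gs @ [k]" for k
      using drop_all[of gs n] len n2 by simp
    have take: "take (n - 1) gs \<in> nlists (n - 1) (Cinf M)"
      using set_take_subset[of "n - 1" gs] set len by (intro nlistsI) auto
    show ?thesis
      unfolding upd using D(7)[OF take that(2,3) p] by simp
  qed
  show "(if f * g \<in> Cinf M then br (fs[i := f * g]) p else 0) =
      f p * (if g \<in> Cinf M then br (fs[i := g]) p else 0) + g p * (if f \<in> Cinf M then br (fs[i := f]) p else 0)"
    if f: "f \<in> Cinf M" and g: "g \<in> Cinf M" for f g
  proof (cases "i = n - 1")
    case True
    then show ?thesis using leib[OF fs f g] f g Cinf_mult[OF M f g] by simp
  next
    case False
    have last: "fs ! (n - 1) \<in> Cinf M" using nlistsE_nth_in[OF fs n1] .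
    have sw: "br (fs[i := k]) p = - br ((fs[i := fs ! (n - 1)])[n - 1 := k]) p" if k: "k \<in> Cinf M" for k
    proof -
      have "(fs[i := k])[i := fs[i := k] ! (n - 1), n - 1 := fs[i := k] ! i] = (fs[i := fs ! (n - 1)])[n - 1 := k]"
        using False i fs by simp
      then show ?thesis using D(6)[OF nlists_update[OF fs k] i n1 False p, of i] by simp
    qed
    show ?thesis
      using leib[OF nlists_update[OF fs last] f g, of i] sw[OF f] sw[OF g] sw[OF Cinf_mult[OF M f g]] f g Cinf_mult[OF M f g]
      by simp
  qed
  show "(if f + g \<in> Cinf M then br (fs[i := f + g]) p else 0) =
      (if f \<in> Cinf M then br (fs[i := f]) p else 0) + (if g \<in> Cinf M then br (fs[i := g]) p else 0)"
    if "f \<in> Cinf M" "g \<in> Cinf M" for f g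
    using D(4)[OF fs i that p] Cinf_add[OF M that] that by simp
  show "(if c *\<^sub>R f \<in> Cinf M then br (fs[i := c *\<^sub>R f]) p else 0) = c * (if f \<in> Cinf M then br (fs[i := f]) p else 0)"
    if "f \<in> Cinf M" for c f
    using D(5)[OF fs i that p] Cinf_scaleR[OF M that] that by simp
qed simp

definition hamiltonian :: "'p \<Rightarrow> ('p \<Rightarrow> real) list \<Rightarrow> 'p tvec"
  where "hamiltonian p fs = (\<lambda>f. if f \<in> Cinf M then br (fs @ [f]) p else 0)"

lemma hamiltonian_tangent:
  assumes "fs \<in> nlists (n - 1) (Cinf M)" "p \<in> carr M"
  shows "hamiltonian p fs \<in> tangent_space M p"
proof -
  have "fs @ [0] \<in> nlists n (Cinf M)" by (rule snoc_nlists[OF assms(1) Cinf_zero[OF nambu_poissonD(1)]])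
  moreover have "n - 1 < n" using nambu_poissonD(2) by linarith
  ultimately have "(\<lambda>f. if f \<in> Cinf M then br ((fs @ [0])[n - 1 := f]) p else 0) \<in> tangent_space M p"
    using assms(2) by (rule bracket_slot_tangent)
  then show ?thesis
    unfolding hamiltonian_def by (simp only: snoc_update[OF assms(1), of _ 0, symmetric])
qed

text \<open>Both cases apply canonicity to a bracket with a product, \<open>{.., h k} = h {.., k} + {.., h}
  k\<close>, and differentiate it along some \<open>v\<close> in \<open>E p\<close>. The product
  is in \<open>C\<^sup>\<infinity>(M)\<^sub>E\<close> although its factors need not be.\<close>

lemma bracket_vanishes:
  fixes E :: "'p \<Rightarrow> 'p tvec set"
  assumes N: "submanifold M N W" and Y: "Y = induced_mfd M N W"
    and E: "subbundle_along M Y r E" and r: "r > 0"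
    and can: "canonical_along n M br N E"
    and rank_F: "\<And>q. q \<in> N \<Longrightarrow> dim (tangential_part M Y E q) = s"
    and fs: "fs \<in> nlists (n - 1) (Cinf_ann M N E)"
    and f: "f \<in> Cinf M" "\<And>y. y \<in> N \<Longrightarrow> f y = 0" and p: "p \<in> N"
  shows "br (fs @ [f]) p = 0"
proof -
  note M = nambu_poissonD(1)
  note WD = submanifoldD[OF M N Y]
  have pM: "p \<in> carr M" using p WD(1) by blast
  have ED: "subspace (E q)" "E q \<subseteq> tangent_space M q" "dim (E q) = r" if "q \<in> N" for q
    using that by (rule subbundleD[OF M N Y E rank_F, rotated], simp)+
  have tangent_iff: "E q \<subseteq> tangent_image M Y q \<longleftrightarrow> s = r" if "q \<in> N" for q
    using that by (rule subbundle_tangent_iff[OF M N Y E rank_F, rotated]) simp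
  have fsC: "fs \<in> nlists (n - 1) (Cinf M)"
    using fs nlists_mono[of "Cinf_ann M N E" "Cinf M"] by (auto simp: Cinf_ann_def)
  let ?b = "\<lambda>k. br (fs @ [k])"
  have bC: "?b k \<in> Cinf M" if "k \<in> Cinf M" for k
    by (intro nambu_poissonD(3) snoc_nlists fsC that)
  have bE: "?b k \<in> Cinf_ann M N E" if "k \<in> Cinf_ann M N E" for k
    using can snoc_nlists[OF fs that] by (simp add: canonical_along_def)
  have kill: "v k = 0" if "k \<in> Cinf_ann M N E" "v \<in> E q" "q \<in> N" for k v q
    using Cinf_annD(2)[OF that(1) that(3,2) ED(2)[OF that(3)]] .
  have leib: "v (?b (h * k)) = h p * v (?b k) + ?b k p * v h + ?b h p * v k + k p * v (?b h)"
    if h: "h \<in> Cinf M" and k: "k \<in> Cinf M" and v: "v \<in> tangent_space M p" for h k v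
  proof -
    have "v (?b (h * k)) = v (h * ?b k + ?b h * k)"
    proof (rule tangent_local[OF M v bC[OF Cinf_mult[OF M h k]] _ openin_topspace pM])
      show "h * ?b k + ?b h * k \<in> Cinf M" by (intro Cinf_add Cinf_mult M bC h k)
      show "?b (h * k) y = (h * ?b k + ?b h * k) y" if "y \<in> carr M" for y
        using nambu_poissonD(7)[OF fsC h k that] by simp
    qed
    also have "\<dots> = v (h * ?b k) + v (?b h * k)"
      by (intro tangent_spaceD(1)[OF v] Cinf_mult M bC h k)
    also have "\<dots> = (h p * v (?b k) + ?b k p * v h) + (?b h p * v k + k p * v (?b h))"
      using tangent_spaceD(3)[OF v h bC[OF k]] tangent_spaceD(3)[OF v bC[OF h] k] by simp
    finally show ?thesis by simp
  qed
  show ?thesis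
  proof (cases "s = r")
    case True
    \<comment> \<open>\<open>E\<close> is tangent to \<open>N\<close>, so all functions vanishing on \<open>N\<close> are in \<open>C\<^sup>\<infinity>(M)\<^sub>E\<close>, among them
      \<open>f\<close> times any function.\<close>
    have vanish: "k \<in> Cinf_ann M N E" if k: "k \<in> Cinf M" "\<And>y. y \<in> N \<Longrightarrow> k y = 0" for k
    proof (rule Cinf_annI[OF k(1)])
      fix q v assume q: "q \<in> N" and v: "v \<in> E q"
      have "v \<in> tangent_image M Y q"
        using tangent_iff[OF q] True v by blast
      moreover have "v \<in> tangent_space M q" using ED(2)[OF q] v by blast
      ultimately show "v k = 0" using tangent_image_iff[OF M N Y q] k by blast
    qed
    have d0: "dim ({0} :: 'p tvec set) = 0"
      using dim_span[of "{} :: 'p tvec set"] dim_eq_card_independent[OF independent_empty] by simp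
    have "E p \<noteq> {0}"
    proof
      assume "E p = {0}"
      then have "dim (E p) = 0" by (simp only: d0)
      then show False using ED(3)[OF p] r by linarith
    qed
    then obtain v where v: "v \<in> E p" "v \<noteq> 0"
      using subspace_0[OF ED(1)[OF p]] by blast
    then obtain h where h: "v h \<noteq> 0" by (auto simp: fun_eq_iff)
    have vT: "v \<in> tangent_space M p" using ED(2)[OF p] v(1) by blast
    have hC: "h \<in> Cinf M" using h tangent_spaceD(4)[OF vT] by blast
    have fE: "f \<in> Cinf_ann M N E" using f by (intro vanish)
    have "f * h \<in> Cinf_ann M N E" using f(2) by (intro vanish Cinf_mult M f(1) hC) simp
    then have "v (?b (f * h)) = 0" using kill[OF bE v(1) p] by blast
    moreover have "v (?b f) = 0" "v f = 0" using kill[OF bE[OF fE] v(1) p] kill[OF fE v(1) p] by auto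
    ultimately show ?thesis using leib[OF f(1) hC vT] f(2)[OF p] h by simp
  next
    case False
    \<comment> \<open>A product of two functions vanishing on \<open>N\<close> has zero differential along \<open>N\<close>, so it is in
      \<open>C\<^sup>\<infinity>(M)\<^sub>E\<close>. For two equal factors this settles one \<open>f'\<close> with \<open>v f' \<noteq> 0\<close>, and then all \<open>f\<close>.\<close>
    obtain v where v: "v \<in> E p" "v \<notin> tangent_image M Y p"
      using tangent_iff[OF p] False by blast
    have vT: "v \<in> tangent_space M p" using ED(2)[OF p] v(1) by blast
    obtain f' where f': "f' \<in> Cinf M" "\<And>y. y \<in> N \<Longrightarrow> f' y = 0" "v f' \<noteq> 0"
      using tangent_image_iff[OF M N Y p vT] v(2) by blast
    have sym: "?b k p * v h + ?b h p * v k = 0"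
      if h: "h \<in> Cinf M" "\<And>y. y \<in> N \<Longrightarrow> h y = 0" and k: "k \<in> Cinf M" "\<And>y. y \<in> N \<Longrightarrow> k y = 0" for h k
    proof -
      have "h * k \<in> Cinf_ann M N E"
      proof (rule Cinf_annI[OF Cinf_mult[OF M h(1) k(1)]])
        fix q w assume q: "q \<in> N" and w: "w \<in> E q"
        have "w \<in> tangent_space M q" using ED(2)[OF q] w by blast
        from tangent_spaceD(3)[OF this h(1) k(1)] show "w (h * k) = 0" using h(2)[OF q] k(2)[OF q] by simp
      qed
      then have "v (?b (h * k)) = 0" using kill[OF bE v(1) p] by blast
      then show ?thesis using leib[OF h(1) k(1) vT] h(2)[OF p] k(2)[OF p] by simp
    qed
    have "?b f' p = 0" using sym[OF f'(1,2) f'(1,2)] f'(3) by simp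
    then show ?thesis using sym[OF f'(1,2) f] f'(3) by simp
  qed
qed

lemma hamiltonian_tangent_image:
  fixes E :: "'p \<Rightarrow> 'p tvec set"
  assumes N: "submanifold M N W" and Y: "Y = induced_mfd M N W"
    and E: "subbundle_along M Y r E" and r: "r > 0"
    and can: "canonical_along n M br N E"
    and rank_F: "\<And>q. q \<in> N \<Longrightarrow> dim (tangential_part M Y E q) = s"
    and fs: "fs \<in> nlists (n - 1) (Cinf_ann M N E)" and p: "p \<in> N"
  shows "hamiltonian p fs \<in> tangent_image M Y p"
proof -
  note M = nambu_poissonD(1)
  have fsC: "fs \<in> nlists (n - 1) (Cinf M)"
    using fs nlists_mono[of "Cinf_ann M N E" "Cinf M"] by (auto simp: Cinf_ann_def)
  have pM: "p \<in> carr M" using p submanifoldD(1)[OF M N Y] by blast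
  show ?thesis
    unfolding tangent_image_iff[OF M N Y p hamiltonian_tangent[OF fsC pM]]
    using bracket_vanishes[OF N Y E r can rank_F fs _ _ p] by (simp add: hamiltonian_def)
qed

end

section \<open>Multilinear alternating maps\<close>

definition multilinear_on :: "'v::real_vector set \<Rightarrow> nat \<Rightarrow> ('v list \<Rightarrow> real) \<Rightarrow> bool"
  where "multilinear_on V k \<mu> \<longleftrightarrow> (\<forall>vs\<in>nlists k V. \<forall>i<k.
    (\<forall>v\<in>V. \<forall>w\<in>V. \<mu> (vs[i := v + w]) = \<mu> (vs[i := v]) + \<mu> (vs[i := w])) \<and>
    (\<forall>c. \<forall>v\<in>V. \<mu> (vs[i := c *\<^sub>R v]) = c * \<mu> (vs[i := v])))"

definition alternating_on :: "'v set \<Rightarrow> nat \<Rightarrow> ('v list \<Rightarrow> real) \<Rightarrow> bool"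
  where "alternating_on V k \<mu> \<longleftrightarrow> (\<forall>vs\<in>nlists k V. \<forall>i<k. \<forall>j<k. i \<noteq> j \<longrightarrow>
    \<mu> (vs[i := vs ! j, j := vs ! i]) = - \<mu> vs)"

lemma map_nlists: "(\<And>b. b \<in> B \<Longrightarrow> e b \<in> V) \<Longrightarrow> J \<in> nlists k B \<Longrightarrow> map e J \<in> nlists k V"
proof (rule nlistsI)
  assume e: "\<And>b. b \<in> B \<Longrightarrow> e b \<in> V" and J: "J \<in> nlists k B"
  show "length (map e J) = k" using J by simp
  show "set (map e J) \<subseteq> V" unfolding set_map using e nlistsE_set[OF J] by blast
qed

lemma sum_nlists_Suc:
  "(\<Sum>J\<in>nlists (Suc k) B. g J) = (\<Sum>b\<in>B. \<Sum>J\<in>nlists k B. g (b # J))"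
proof -
  have "nlists (Suc k) B = (\<lambda>(b, J). b # J) ` (B \<times> nlists k B)"
    by (auto simp: nlists_Suc)
  then have "(\<Sum>J\<in>nlists (Suc k) B. g J) = (\<Sum>z\<in>B \<times> nlists k B. g (fst z # snd z))"
    by (simp add: sum.reindex inj_on_def split_beta)
  then show ?thesis by (simp add: sum.cartesian_product split_beta)
qed

lemma multilinear_on_sum:
  assumes \<mu>: "multilinear_on V k \<mu>" and V: "subspace V" and vs: "vs \<in> nlists k V" "i < k"
    and e: "\<And>b. b \<in> B \<Longrightarrow> e b \<in> V"
  shows "\<mu> (vs[i := (\<Sum>b\<in>B. c b *\<^sub>R e b)]) = (\<Sum>b\<in>B. c b * \<mu> (vs[i := e b]))"
proof -
  have add: "\<mu> (vs[i := v + w]) = \<mu> (vs[i := v]) + \<mu> (vs[i := w])" if "v \<in> V" "w \<in> V" for v w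
    using \<mu> vs that by (simp add: multilinear_on_def)
  have scale: "\<mu> (vs[i := a *\<^sub>R v]) = a * \<mu> (vs[i := v])" if "v \<in> V" for a v
    using \<mu> vs that by (simp add: multilinear_on_def)
  have zero: "\<mu> (vs[i := 0]) = 0" using scale[OF subspace_0[OF V], of 0] by simp
  show ?thesis
    using e
  proof (induction B rule: infinite_finite_induct)
    case (insert b B)
    have "(\<Sum>b\<in>B. c b *\<^sub>R e b) \<in> V"
      using insert.prems by (intro subspace_sum[OF V] subspace_scale[OF V]) simp
    moreover have "e b \<in> V" "c b *\<^sub>R e b \<in> V" using insert.prems by (simp_all add: subspace_scale[OF V])
    ultimately show ?case using insert by (simp add: add scale)
  qed (simp_all add: zero)
qed

text \<open>The sum ranges over all tuples of basis indices, not only the increasing ones. This keeps the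
  formulas free of orderings, at the price of the factors \<open>k!\<close> below.\<close>

lemma multilinear_expansion:
  assumes "multilinear_on V k \<mu>" and V: "subspace V" and e: "\<And>b. b \<in> B \<Longrightarrow> e b \<in> V"
    and "vs \<in> nlists k V" and "\<And>i. i < k \<Longrightarrow> vs ! i = (\<Sum>b\<in>B. c i b *\<^sub>R e b)"
  shows "\<mu> vs = (\<Sum>J\<in>nlists k B. (\<Prod>i<k. c i (J ! i)) * \<mu> (map e J))"
  using assms(1,4,5)
proof (induction k arbitrary: \<mu> vs c)
  case 0
  then show ?case by simp
next
  case (Suc k)
  obtain v ws where vs: "vs = v # ws" "v \<in> V" "ws \<in> nlists k V"
    using Suc.prems(2) by (auto simp: in_nlists_Suc_iff)
  have v: "v = (\<Sum>b\<in>B. c 0 b *\<^sub>R e b)" using Suc.prems(3)[of 0] vs(1) by simp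
  have ws: "ws ! i = (\<Sum>b\<in>B. c (Suc i) b *\<^sub>R e b)" if "i < k" for i
    using Suc.prems(3)[of "Suc i"] that vs(1) by simp
  have ml: "multilinear_on V k (\<lambda>ws. \<mu> (w # ws))" if w: "w \<in> V" for w
    unfolding multilinear_on_def
  proof (intro ballI allI impI conjI)
    fix us i assume us: "us \<in> nlists k V" and i: "i < k"
    have *: "w # us \<in> nlists (Suc k) V" "Suc i < Suc k" using w us i by simp_all
    note D = Suc.prems(1)[unfolded multilinear_on_def, rule_format, OF *]
    show "\<mu> (w # us[i := x + y]) = \<mu> (w # us[i := x]) + \<mu> (w # us[i := y])" if "x \<in> V" "y \<in> V" for x y
      using D that by simp
    show "\<mu> (w # us[i := a *\<^sub>R x]) = a * \<mu> (w # us[i := x])" if "x \<in> V" for a x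
      using D that by simp
  qed
  have "\<mu> vs = \<mu> ((v # ws)[0 := (\<Sum>b\<in>B. c 0 b *\<^sub>R e b)])" using v vs(1) by simp
  also have "\<dots> = (\<Sum>b\<in>B. c 0 b * \<mu> (e b # ws))"
    using multilinear_on_sum[OF Suc.prems(1) V _ _ e, where vs = "v # ws" and i = 0 and c = "c 0"] vs(2,3) by simp
  also have "\<dots> = (\<Sum>b\<in>B. c 0 b * (\<Sum>J\<in>nlists k B. (\<Prod>i<k. c (Suc i) (J ! i)) * \<mu> (e b # map e J)))"
    by (intro sum.cong refl arg_cong2[where f = "(*)"] Suc.IH[OF ml[OF e] vs(3) ws])
  also have "\<dots> = (\<Sum>J\<in>nlists (Suc k) B. (\<Prod>i<Suc k. c i (J ! i)) * \<mu> (map e J))"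
    unfolding sum_nlists_Suc prod.lessThan_Suc_shift
    by (simp add: sum_distrib_left mult.assoc)
  finally show ?case .
qed

lemma permutes_permutation: "\<sigma> permutes {..<k::nat} \<Longrightarrow> permutation \<sigma>"
  using permutation_permutes by blast

lemma permute_list_nlists: "\<sigma> permutes {..<k} \<Longrightarrow> vs \<in> nlists k V \<Longrightarrow> permute_list \<sigma> vs \<in> nlists k V"
  by (intro nlistsI) simp_all

lemma alternating_permute:
  assumes \<mu>: "alternating_on V k \<mu>" and \<sigma>: "\<sigma> permutes {..<k}" and vs: "vs \<in> nlists k V"
  shows "\<mu> (permute_list \<sigma> vs) = of_int (sign \<sigma>) * \<mu> vs"
  using \<sigma> finite_lessThan[of k] vs
proof (induction arbitrary: vs rule: permutes_induct)
  case id
  then show ?case by simp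
next
  case (swap a b p)
  let ?t = "Transposition.transpose a b"
  have len: "length vs = k" and st: "set vs \<subseteq> V" using swap.prems by (rule nlistsE_length, rule nlistsE_set)
  have ab: "a < k" "b < k" using swap.hyps by auto
  have t: "permute_list ?t vs = vs[a := vs ! b, b := vs ! a]"
  proof (rule nth_equalityI)
    show "length (permute_list ?t vs) = length (vs[a := vs ! b, b := vs ! a])" by simp
    fix i assume "i < length (permute_list ?t vs)"
    then have i: "i < length vs" by simp
    have "permute_list ?t vs ! i = vs ! ?t i"
      by (rule permute_list_nth[OF _ i]) (use ab len in \<open>auto intro: permutes_swap_id\<close>)
    then show "permute_list ?t vs ! i = vs[a := vs ! b, b := vs ! a] ! i"
      using i ab len swap.hyps(3) by (auto simp: Transposition.transpose_def nth_list_update)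
  qed
  have "permute_list (?t \<circ> p) vs = permute_list p (permute_list ?t vs)"
    by (rule permute_list_compose) (use swap.hyps len in simp)
  moreover have tn: "permute_list ?t vs \<in> nlists k V"
    by (rule permute_list_nlists[OF _ swap.prems]) (use ab in \<open>auto intro: permutes_swap_id\<close>)
  ultimately have "\<mu> (permute_list (?t \<circ> p) vs) = of_int (sign p) * \<mu> (permute_list ?t vs)"
    using swap.IH[OF tn] by simp
  also have "\<mu> (permute_list ?t vs) = - \<mu> vs"
    unfolding t using \<mu>[unfolded alternating_on_def, rule_format, OF swap.prems ab swap.hyps(3)] .
  finally have 1: "\<mu> (permute_list (?t \<circ> p) vs) = of_int (sign p) * - \<mu> vs" .
  have 2: "sign (?t \<circ> p) = - sign p"
    using swap.hyps(3) permutes_permutation[OF swap.hyps(4)]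
    by (simp add: sign_compose permutation_swap_id sign_swap_id)
  show ?case unfolding 1 2 by simp
qed

lemma sum_permute_nlists:
  assumes "\<sigma> permutes {..<k}"
  shows "(\<Sum>J\<in>nlists k B. g (permute_list \<sigma> J)) = (\<Sum>J\<in>nlists k B. g J)"
proof (rule sum.reindex_bij_witness[where i = "permute_list (inv \<sigma>)" and j = "permute_list \<sigma>"])
  note inv = permutes_inv[OF assms]
  show "permute_list (inv \<sigma>) (permute_list \<sigma> J) = J" if "J \<in> nlists k B" for J
  proof -
    have "permute_list (\<sigma> \<circ> inv \<sigma>) J = permute_list (inv \<sigma>) (permute_list \<sigma> J)"
      by (rule permute_list_compose) (use inv that in simp)
    then show ?thesis by (simp add: permutes_inv_o[OF assms])
  qed
  show "permute_list \<sigma> (permute_list (inv \<sigma>) J) = J" if "J \<in> nlists k B" for J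
  proof -
    have "permute_list (inv \<sigma> \<circ> \<sigma>) J = permute_list \<sigma> (permute_list (inv \<sigma>) J)"
      by (rule permute_list_compose) (use assms that in simp)
    then show ?thesis by (simp add: permutes_inv_o[OF assms])
  qed
qed (use assms permutes_inv[OF assms] in \<open>auto intro: permute_list_nlists\<close>)

lemma sign_square: "of_int (sign \<sigma>) * (of_int (sign \<sigma>) * x) = (x::real)"
  by (cases \<sigma> rule: sign_cases) simp_all

text \<open>The inner sum is the value of the wedge product of the covectors \<open>c i\<close> on the tuple
  \<open>J\<close>. After renaming \<open>J\<close> by \<open>\<sigma>\<close>, the two signs
  cancel and each of the \<open>k!\<close> permutations contributes the same expansion of
  \<open>\<mu> vs\<close>.\<close>

lemma alternating_contraction:
  assumes \<mu>: "multilinear_on V k \<mu>" "alternating_on V k \<mu>" and V: "subspace V"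
    and e: "\<And>b. b \<in> B \<Longrightarrow> e b \<in> V" and vs: "vs \<in> nlists k V"
    and c: "\<And>i. i < k \<Longrightarrow> vs ! i = (\<Sum>b\<in>B. c i b *\<^sub>R e b)"
  shows "(\<Sum>J\<in>nlists k B. (\<Sum>\<sigma> | \<sigma> permutes {..<k}. of_int (sign \<sigma>) * (\<Prod>i<k. c i (J ! \<sigma> i))) * \<mu> (map e J))
    = fact k * \<mu> vs"
proof -
  have e_nl: "map e J \<in> nlists k V" if "J \<in> nlists k B" for J
    by (rule map_nlists[OF e that])
  have "(\<Sum>J\<in>nlists k B. (\<Sum>\<sigma> | \<sigma> permutes {..<k}. of_int (sign \<sigma>) * (\<Prod>i<k. c i (J ! \<sigma> i))) * \<mu> (map e J)) =
      (\<Sum>\<sigma> | \<sigma> permutes {..<k}. \<Sum>J\<in>nlists k B. of_int (sign \<sigma>) * (\<Prod>i<k. c i (J ! \<sigma> i)) * \<mu> (map e J))"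
    by (simp only: sum_distrib_right) (rule sum.swap)
  also have "\<dots> = (\<Sum>\<sigma> | \<sigma> permutes {..<k}. \<mu> vs)"
  proof (rule sum.cong[OF refl])
    fix \<sigma> assume "\<sigma> \<in> {\<sigma>. \<sigma> permutes {..<k}}"
    then have \<sigma>: "\<sigma> permutes {..<k}" by simp
    let ?g = "\<lambda>J. (\<Prod>i<k. c i (J ! i)) * \<mu> (map e J)"
    have "of_int (sign \<sigma>) * (\<Prod>i<k. c i (J ! \<sigma> i)) * \<mu> (map e J) = ?g (permute_list \<sigma> J)"
      if J: "J \<in> nlists k B" for J
    proof -
      have len: "length J = k" using J by (rule nlistsE_length)
      have "map e (permute_list \<sigma> J) = permute_list \<sigma> (map e J)"
        by (rule permute_list_map[symmetric]) (use \<sigma> len in simp)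
      then have "\<mu> (map e (permute_list \<sigma> J)) = of_int (sign \<sigma>) * \<mu> (map e J)"
        using alternating_permute[OF \<mu>(2) \<sigma> e_nl[OF J]] by simp
      moreover have "(\<Prod>i<k. c i (permute_list \<sigma> J ! i)) = (\<Prod>i<k. c i (J ! \<sigma> i))"
        by (intro prod.cong refl) (use \<sigma> len in \<open>simp add: permute_list_nth\<close>)
      ultimately show ?thesis by simp
    qed
    then have "(\<Sum>J\<in>nlists k B. of_int (sign \<sigma>) * (\<Prod>i<k. c i (J ! \<sigma> i)) * \<mu> (map e J)) =
        (\<Sum>J\<in>nlists k B. ?g (permute_list \<sigma> J))" by (rule sum.cong[OF refl])
    also have "\<dots> = (\<Sum>J\<in>nlists k B. ?g J)" by (rule sum_permute_nlists[OF \<sigma>])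
    also have "\<dots> = \<mu> vs" by (rule multilinear_expansion[OF \<mu>(1) V e vs c, symmetric])
    finally show "(\<Sum>J\<in>nlists k B. of_int (sign \<sigma>) * (\<Prod>i<k. c i (J ! \<sigma> i)) * \<mu> (map e J)) = \<mu> vs" .
  qed
  also have "\<dots> = fact k * \<mu> vs" by (simp add: card_permutations)
  finally show ?thesis .
qed

text \<open>Dually, the inner sum is the wedge product of the covectors \<open>\<epsilon>\<close> with
  indices \<open>J\<close>, evaluated on \<open>vs\<close>: an alternating form is the combination
  of these wedge products with its values on basis tuples as coefficients.\<close>

lemma alternating_expansion:
  assumes \<mu>: "multilinear_on V k \<mu>" "alternating_on V k \<mu>" and V: "subspace V"
    and B: "B \<subseteq> V" and vs: "vs \<in> nlists k V"
    and c: "\<And>i. i < k \<Longrightarrow> vs ! i = (\<Sum>b\<in>B. \<epsilon> b (vs ! i) *\<^sub>R b)"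
  shows "(\<Sum>J\<in>nlists k B. \<mu> J * (\<Sum>\<sigma> | \<sigma> permutes {..<k}. of_int (sign \<sigma>) * (\<Prod>i<k. \<epsilon> (J ! i) (vs ! \<sigma> i))))
    = fact k * \<mu> vs"
proof -
  have len: "length vs = k" using vs by (rule nlistsE_length)
  have "(\<Sum>J\<in>nlists k B. \<mu> J * (\<Sum>\<sigma> | \<sigma> permutes {..<k}. of_int (sign \<sigma>) * (\<Prod>i<k. \<epsilon> (J ! i) (vs ! \<sigma> i)))) =
      (\<Sum>\<sigma> | \<sigma> permutes {..<k}. \<Sum>J\<in>nlists k B. \<mu> J * (of_int (sign \<sigma>) * (\<Prod>i<k. \<epsilon> (J ! i) (vs ! \<sigma> i))))"
    by (simp only: sum_distrib_left) (rule sum.swap)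
  also have "\<dots> = (\<Sum>\<sigma> | \<sigma> permutes {..<k}. \<mu> vs)"
  proof (rule sum.cong[OF refl])
    fix \<sigma> assume "\<sigma> \<in> {\<sigma>. \<sigma> permutes {..<k}}"
    then have \<sigma>: "\<sigma> permutes {..<k}" by simp
    have nth: "permute_list \<sigma> vs ! i = vs ! \<sigma> i" if "i < k" for i
      using \<sigma> len that by (simp add: permute_list_nth)
    have "\<mu> (permute_list \<sigma> vs) = (\<Sum>J\<in>nlists k B. (\<Prod>i<k. \<epsilon> (J ! i) (permute_list \<sigma> vs ! i)) * \<mu> (map (\<lambda>b. b) J))"
    proof (rule multilinear_expansion[OF \<mu>(1) V _ permute_list_nlists[OF \<sigma> vs]])
      show "permute_list \<sigma> vs ! i = (\<Sum>b\<in>B. \<epsilon> b (permute_list \<sigma> vs ! i) *\<^sub>R b)" if "i < k" for i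
        using c[of "\<sigma> i"] permutes_in_image[OF \<sigma>, of i] that by (simp add: nth)
    qed (use B in auto)
    also have "\<dots> = (\<Sum>J\<in>nlists k B. (\<Prod>i<k. \<epsilon> (J ! i) (vs ! \<sigma> i)) * \<mu> J)"
      by (intro sum.cong refl arg_cong2[where f = "(*)"] prod.cong) (simp_all add: nth)
    finally have "(\<Sum>J\<in>nlists k B. (\<Prod>i<k. \<epsilon> (J ! i) (vs ! \<sigma> i)) * \<mu> J) = of_int (sign \<sigma>) * \<mu> vs"
      using alternating_permute[OF \<mu>(2) \<sigma> vs] by simp
    then have "of_int (sign \<sigma>) * (\<Sum>J\<in>nlists k B. (\<Prod>i<k. \<epsilon> (J ! i) (vs ! \<sigma> i)) * \<mu> J) = \<mu> vs"
      by (simp add: sign_square)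
    then show "(\<Sum>J\<in>nlists k B. \<mu> J * (of_int (sign \<sigma>) * (\<Prod>i<k. \<epsilon> (J ! i) (vs ! \<sigma> i)))) = \<mu> vs"
      by (simp add: sum_distrib_left mult_ac)
  qed
  also have "\<dots> = fact k * \<mu> vs" by (simp add: card_permutations)
  finally show ?thesis .
qed

section \<open>Forms and covectors at a point\<close>

lemma forms_iff:
  "\<eta> \<in> forms M p k \<longleftrightarrow> multilinear_on (tangent_space M p) k \<eta> \<and>
    (\<forall>vs\<in>nlists k (tangent_space M p). \<forall>i<k. \<forall>j<k. i \<noteq> j \<and> vs ! i = vs ! j \<longrightarrow> \<eta> vs = 0) \<and>
    (\<forall>vs. vs \<notin> nlists k (tangent_space M p) \<longrightarrow> \<eta> vs = 0)"
  by (simp only: forms_def multilinear_on_def mem_Collect_eq ball_conj_distrib all_conj_distrib imp_conjR conj_assoc)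

text \<open>Polarisation of the condition that \<open>\<eta>\<close> vanishes on tuples with two equal
  entries.\<close>

lemma form_alternating:
  assumes \<eta>: "\<eta> \<in> forms M p k" and T: "subspace (tangent_space M p)"
  shows "alternating_on (tangent_space M p) k \<eta>"
  unfolding alternating_on_def
proof (intro ballI allI impI)
  let ?T = "tangent_space M p"
  fix vs i j assume vs: "vs \<in> nlists k ?T" and i: "i < k" and j: "j < k" and ij: "i \<noteq> j"
  have ml: "multilinear_on ?T k \<eta>"
    and z: "\<And>us. us \<in> nlists k ?T \<Longrightarrow> us ! i = us ! j \<Longrightarrow> \<eta> us = 0"
    using \<eta> i j ij unfolding forms_iff by blast+
  have len: "length vs = k" using vs by (rule nlistsE_length)
  let ?h = "\<lambda>x y. \<eta> (vs[i := x, j := y])"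
  have nl: "vs[i := x] \<in> nlists k ?T" "vs[j := x] \<in> nlists k ?T" if "x \<in> ?T" for x
    by (rule nlists_update[OF vs that])+
  have add1: "?h (x + x') y = ?h x y + ?h x' y" if "x \<in> ?T" "x' \<in> ?T" "y \<in> ?T" for x x' y
    using ml[unfolded multilinear_on_def, rule_format, OF nl(2)[OF that(3)] i, THEN conjunct1, rule_format, OF that(1,2)]
    unfolding list_update_swap[OF ij] .
  have add2: "?h x (y + y') = ?h x y + ?h x y'" if "x \<in> ?T" "y \<in> ?T" "y' \<in> ?T" for x y y'
    using ml[unfolded multilinear_on_def, rule_format, OF nl(1)[OF that(1)] j, THEN conjunct1, rule_format, OF that(2,3)] .
  have diag: "?h x x = 0" if "x \<in> ?T" for x
  proof (rule z)
    show "vs[i := x, j := x] \<in> nlists k ?T" by (rule nlists_update[OF nl(1)[OF that] that])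
    show "vs[i := x, j := x] ! i = vs[i := x, j := x] ! j" using i j len ij by simp
  qed
  have u: "vs ! i \<in> ?T" and w: "vs ! j \<in> ?T" using nlistsE_nth_in[OF vs] i j by blast+
  have uw: "vs ! i + vs ! j \<in> ?T" by (rule subspace_add[OF T u w])
  have "0 = ?h (vs ! i + vs ! j) (vs ! i + vs ! j)" using diag[OF uw] by simp
  also have "\<dots> = ?h (vs ! i) (vs ! j) + ?h (vs ! j) (vs ! i)"
    using add1[OF u w uw] add2[OF u u w] add2[OF w u w] diag[OF u] diag[OF w] by simp
  also have "vs[i := vs ! i, j := vs ! j] = vs" by simp
  finally show "\<eta> (vs[i := vs ! j, j := vs ! i]) = - \<eta> vs" by simp
qed

lemma subspace_forms: "subspace (forms M p k)"
proof (rule subspaceI)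
  show "0 \<in> forms M p k" unfolding forms_iff multilinear_on_def by simp
  show "\<eta> + \<theta> \<in> forms M p k" if \<eta>: "\<eta> \<in> forms M p k" and \<theta>: "\<theta> \<in> forms M p k" for \<eta> \<theta>
    using \<eta> \<theta> unfolding forms_iff multilinear_on_def by (simp add: algebra_simps)
  show "c *\<^sub>R \<eta> \<in> forms M p k" if \<eta>: "\<eta> \<in> forms M p k" for c \<eta>
    using \<eta> unfolding forms_iff multilinear_on_def by (simp add: algebra_simps)
qed

lemma linear_between_sum:
  assumes L: "linear_between S T L" and S: "subspace S" and x: "\<And>i. i \<in> I \<Longrightarrow> x i \<in> S"
  shows "L (\<Sum>i\<in>I. c i *\<^sub>R x i) = (\<Sum>i\<in>I. c i *\<^sub>R L (x i))"
  using x
proof (induction I rule: infinite_finite_induct)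
  case (insert i I)
  have "(\<Sum>i\<in>I. c i *\<^sub>R x i) \<in> S" "c i *\<^sub>R x i \<in> S" "x i \<in> S"
    using insert.prems by (auto intro!: subspace_sum[OF S] subspace_scale[OF S])
  then show ?case using insert L by (simp add: linear_between_def)
next
  case empty
  have "L (0 *\<^sub>R 0) = 0 *\<^sub>R L 0" using L subspace_0[OF S] unfolding linear_between_def by blast
  then show ?case by simp
next
  case (infinite I)
  have "L (0 *\<^sub>R 0) = 0 *\<^sub>R L 0" using L subspace_0[OF S] unfolding linear_between_def by blast
  then show ?case using infinite by simp
qed

text \<open>Linearity in the entry \<open>i\<close> holds because each product of the defining sum contains
  it in exactly one factor, the one with index \<open>inv \<sigma> i\<close>. If two entries
  agree, the terms for \<open>\<sigma>\<close> and for its composition with the transposition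
  cancel.\<close>

lemma wedge_forms:
  assumes \<alpha>s: "\<alpha>s \<in> nlists k (cotangent_space M p)"
  shows "wedge M p \<alpha>s \<in> forms M p k"
proof -
  let ?T = "tangent_space M p"
  have len: "length \<alpha>s = k" using \<alpha>s by (rule nlistsE_length)
  have lin: "linear_between ?T UNIV (\<alpha>s ! l)" if "l < k" for l
    using nlistsE_nth_in[OF \<alpha>s that] by (simp add: cotangent_space_def)
  let ?S = "{\<sigma>. \<sigma> permutes {..<k}}"
  let ?p = "\<lambda>vs \<sigma>. \<Prod>l<k. (\<alpha>s ! l) (vs ! \<sigma> l)"
  have W: "wedge M p \<alpha>s vs = (\<Sum>\<sigma>\<in>?S. of_int (sign \<sigma>) * ?p vs \<sigma>)" if "vs \<in> nlists k ?T" for vs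
    using that unfolding wedge_def len by (simp only: if_True)
  have split: "?p (vs[i := x]) \<sigma> =
      (\<alpha>s ! inv \<sigma> i) x * (\<Prod>l\<in>{..<k} - {inv \<sigma> i}. (\<alpha>s ! l) (vs ! \<sigma> l))"
    if \<sigma>: "\<sigma> permutes {..<k}" and vs: "vs \<in> nlists k ?T" and i: "i < k" for vs i x \<sigma>
  proof -
    have m: "inv \<sigma> i \<in> {..<k}" using permutes_in_image[OF permutes_inv[OF \<sigma>], of i] i by simp
    have \<sigma>m: "\<sigma> (inv \<sigma> i) = i" using permutes_inverses(1)[OF \<sigma>] .
    have "?p (vs[i := x]) \<sigma> = (\<alpha>s ! inv \<sigma> i) (vs[i := x] ! \<sigma> (inv \<sigma> i)) *
        (\<Prod>l\<in>{..<k} - {inv \<sigma> i}. (\<alpha>s ! l) (vs[i := x] ! \<sigma> l))"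
      by (rule prod.remove[OF finite_lessThan m])
    moreover have "vs[i := x] ! \<sigma> (inv \<sigma> i) = x" using i vs by (simp add: \<sigma>m)
    moreover have "vs[i := x] ! \<sigma> l = vs ! \<sigma> l" if "l \<in> {..<k} - {inv \<sigma> i}" for l
    proof -
      have "\<sigma> l \<noteq> i" using that permutes_inverses(2)[OF \<sigma>, of l] by auto
      then show ?thesis by simp
    qed
    ultimately show ?thesis by simp
  qed
  have "multilinear_on ?T k (wedge M p \<alpha>s)"
    unfolding multilinear_on_def
  proof (intro ballI allI impI conjI)
    fix vs i assume vs: "vs \<in> nlists k ?T" and i: "i < k"
    have inv: "inv \<sigma> i < k" if "\<sigma> permutes {..<k}" for \<sigma>
      using permutes_in_image[OF permutes_inv[OF that], of i] i by simp
    have W': "wedge M p \<alpha>s (vs[i := x]) = (\<Sum>\<sigma>\<in>?S. of_int (sign \<sigma>) *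
        ((\<alpha>s ! inv \<sigma> i) x * (\<Prod>l\<in>{..<k} - {inv \<sigma> i}. (\<alpha>s ! l) (vs ! \<sigma> l))))" if "x \<in> ?T" for x
      unfolding W[OF nlists_update[OF vs that]]
      by (rule sum.cong[OF refl]) (simp only: mem_Collect_eq split[OF _ vs i])
    show "wedge M p \<alpha>s (vs[i := v + w]) = wedge M p \<alpha>s (vs[i := v]) + wedge M p \<alpha>s (vs[i := w])"
      if v: "v \<in> ?T" and w: "w \<in> ?T" for v w
    proof -
      have vw: "v + w \<in> ?T"
        using tangent_spaceD[OF v] tangent_spaceD[OF w] by (intro tangent_spaceI) (simp_all add: algebra_simps)
      have "(\<alpha>s ! inv \<sigma> i) (v + w) = (\<alpha>s ! inv \<sigma> i) v + (\<alpha>s ! inv \<sigma> i) w" if "\<sigma> permutes {..<k}" for \<sigma>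
        using lin[OF inv[OF that]] v w unfolding linear_between_def by blast
      then show ?thesis
        unfolding W'[OF vw] W'[OF v] W'[OF w] sum.distrib[symmetric]
        by (intro sum.cong refl) (simp add: algebra_simps)
    qed
    show "wedge M p \<alpha>s (vs[i := c *\<^sub>R v]) = c * wedge M p \<alpha>s (vs[i := v])" if v: "v \<in> ?T" for c v
    proof -
      have cv: "c *\<^sub>R v \<in> ?T"
        using tangent_spaceD[OF v] by (intro tangent_spaceI) (simp_all add: algebra_simps)
      have "(\<alpha>s ! inv \<sigma> i) (c *\<^sub>R v) = c * (\<alpha>s ! inv \<sigma> i) v" if "\<sigma> permutes {..<k}" for \<sigma>
        using lin[OF inv[OF that]] v unfolding linear_between_def by simp
      then show ?thesis
        unfolding W'[OF cv] W'[OF v] sum_distrib_left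
        by (intro sum.cong refl) (simp add: algebra_simps)
    qed
  qed
  moreover have "wedge M p \<alpha>s vs = 0" if vs: "vs \<in> nlists k ?T" and ij: "i < k" "j < k" "i \<noteq> j" "vs ! i = vs ! j" for vs i j
  proof -
    let ?t = "Transposition.transpose i j"
    have t: "?t permutes {..<k}" using ij by (intro permutes_swap_id) auto
    have tt: "?t \<circ> (?t \<circ> \<sigma>) = \<sigma>" for \<sigma> by (simp add: fun_eq_iff)
    have "(\<Sum>\<sigma>\<in>?S. of_int (sign \<sigma>) * ?p vs \<sigma>) = (\<Sum>\<sigma>\<in>?S. of_int (sign (?t \<circ> \<sigma>)) * ?p vs (?t \<circ> \<sigma>))"
    proof (rule sum.reindex_bij_witness[where i = "\<lambda>\<sigma>. ?t \<circ> \<sigma>" and j = "\<lambda>\<sigma>. ?t \<circ> \<sigma>"])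
      show "?t \<circ> (?t \<circ> \<sigma>) = \<sigma>" "?t \<circ> (?t \<circ> \<sigma>) = \<sigma>" for \<sigma> by (rule tt)+
      show "of_int (sign (?t \<circ> (?t \<circ> \<sigma>))) * ?p vs (?t \<circ> (?t \<circ> \<sigma>)) = of_int (sign \<sigma>) * ?p vs \<sigma>" for \<sigma>
        by (simp only: tt)
      show "?t \<circ> \<sigma> \<in> ?S" "?t \<circ> \<sigma> \<in> ?S" if "\<sigma> \<in> ?S" for \<sigma>
        using that permutes_compose[OF _ t] by simp_all
    qed
    also have "\<dots> = (\<Sum>\<sigma>\<in>?S. - (of_int (sign \<sigma>) * ?p vs \<sigma>))"
    proof (rule sum.cong[OF refl])
      fix \<sigma> assume "\<sigma> \<in> ?S"
      then have "permutation \<sigma>" by (simp add: permutes_permutation)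
      then have s: "sign (?t \<circ> \<sigma>) = - sign \<sigma>"
        using ij(3) by (simp add: sign_compose permutation_swap_id sign_swap_id)
      have "vs ! ?t l = vs ! l" for l using ij(4) by (simp add: Transposition.transpose_def)
      then have "?p vs (?t \<circ> \<sigma>) = ?p vs \<sigma>" by (simp only: o_apply)
      then show "of_int (sign (?t \<circ> \<sigma>)) * ?p vs (?t \<circ> \<sigma>) = - (of_int (sign \<sigma>) * ?p vs \<sigma>)"
        unfolding s by simp
    qed
    finally show ?thesis unfolding W[OF vs] by (simp add: sum_negf)
  qed
  moreover have "wedge M p \<alpha>s vs = 0" if "vs \<notin> nlists k ?T" for vs
    using that unfolding wedge_def len by (simp only: if_False)
  ultimately show ?thesis unfolding forms_iff by blast
qed

lemma differential_cotangent:
  assumes "smooth_manifold M" "f \<in> Cinf M"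
  shows "differential M p f \<in> cotangent_space M p"
  using subspace_tangent_space[OF assms(1), of p]
  by (simp add: cotangent_space_def linear_between_def differential_def subspace_add subspace_scale)

lemma differential_add:
  assumes "f \<in> Cinf M" "g \<in> Cinf M"
  shows "differential M p (f + g) = differential M p f + differential M p g"
  using tangent_spaceD(1)[OF _ assms] by (fastforce simp: differential_def)

lemma differential_scaleR:
  assumes "f \<in> Cinf M"
  shows "differential M p (c *\<^sub>R f) = c *\<^sub>R differential M p f"
  using tangent_spaceD(2)[OF _ assms] by (fastforce simp: differential_def)

lemma subspace_cotangent_space: "subspace (cotangent_space M p)"
  by (rule subspaceI) (auto simp: cotangent_space_def linear_between_def algebra_simps)

lemma covectors_separate:
  assumes M: "smooth_manifold M" and v: "v \<in> tangent_space M p" and w: "w \<in> tangent_space M p"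
    and eq: "\<And>\<beta>. \<beta> \<in> cotangent_space M p \<Longrightarrow> \<beta> v = \<beta> w"
  shows "v = w"
proof
  fix f
  show "v f = w f"
  proof (cases "f \<in> Cinf M")
    case True
    then show ?thesis using eq[OF differential_cotangent[OF M True, of p]] v w by (simp add: differential_def)
  next
    case False
    then show ?thesis using tangent_spaceD(4)[OF v] tangent_spaceD(4)[OF w] by simp
  qed
qed

text \<open>The basis is adapted to \<open>E\<close>: it extends a basis of \<open>E\<close>, so that the
  dual covectors of the other basis vectors annihilate \<open>E\<close>.\<close>

lemma finite_dual_basis:
  fixes M :: "('p, 'a::euclidean_space) mfd"
  assumes M: "smooth_manifold M" and p: "p \<in> carr M" and E: "subspace E" "E \<subseteq> tangent_space M p"
  obtains B \<epsilon> where "finite B" "B \<subseteq> tangent_space M p"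
    "\<And>b. b \<in> B \<Longrightarrow> \<epsilon> b \<in> cotangent_space M p"
    "\<And>v. v \<in> tangent_space M p \<Longrightarrow> v = (\<Sum>b\<in>B. \<epsilon> b v *\<^sub>R b)"
    "\<And>b v. b \<in> B \<Longrightarrow> b \<notin> E \<Longrightarrow> v \<in> E \<Longrightarrow> \<epsilon> b v = 0"
proof -
  let ?T = "tangent_space M p"
  note T = subspace_tangent_space[OF M, of p]
  obtain U \<phi> where c: "(U, \<phi>) \<in> max_atlas M" "p \<in> U" using chart_at[OF M p] by metis
  obtain f where f: "linear f" "\<And>x. x \<in> model M \<Longrightarrow> f x = coord_vec M (U, \<phi>) p x"
    by (rule coord_vec_linear_extension[OF M c]) (rule that, assumption+)
  have "?T \<subseteq> f ` UNIV"
    unfolding tangent_space_coord[OF M c] by (rule image_subsetI) (metis f(2) rangeI)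
  also have "f ` UNIV = span (f ` Basis)"
    using linear_span_image[OF f(1), of Basis] by simp
  finally have TB: "?T \<subseteq> span (f ` Basis)" .
  obtain BE where BE: "BE \<subseteq> E" "independent BE" "E \<subseteq> span BE"
    using maximal_independent_subset by blast
  obtain B where B: "BE \<subseteq> B" "B \<subseteq> ?T" "independent B" "?T \<subseteq> span B"
    using maximal_independent_subset_extend[OF _ BE(2), of ?T] BE(1) E(2) by blast
  have fin: "finite B"
    using independent_span_bound[OF _ B(3), of "f ` Basis"] B(2) TB by auto
  define \<epsilon> where "\<epsilon> b v = (if v \<in> ?T then representation B v b else 0)" for b v
  have "\<epsilon> b \<in> cotangent_space M p" for b
  proof -
    have "v \<in> span B" if "v \<in> ?T" for v using B(4) that by blast
    then show ?thesis
      unfolding cotangent_space_def linear_between_def \<epsilon>_def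
      using T by (simp add: subspace_add subspace_scale representation_add[OF B(3)] representation_scale[OF B(3)])
  qed
  moreover have "v = (\<Sum>b\<in>B. \<epsilon> b v *\<^sub>R b)" if "v \<in> ?T" for v
    using sum_representation_eq[OF B(3) _ fin subset_refl, of v] that B(4) by (auto simp: \<epsilon>_def)
  moreover have "\<epsilon> b v = 0" if "b \<notin> E" "v \<in> E" for b v
  proof -
    have "v \<in> span BE" using that(2) BE(3) by blast
    then have "representation B v b = representation BE v b"
      by (simp add: representation_extend[OF B(3) _ B(1)])
    also have "\<dots> = 0" using representation_ne_zero[of BE v b] that(1) BE(1) by blast
    finally show ?thesis by (simp add: \<epsilon>_def)
  qed
  ultimately show thesis using that[OF fin B(2)] by blast
qed

section \<open>The map \<open>\<Pi>\<^sup>\<sharp>\<close> and the theorem\<close>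

context
  fixes n :: nat and M :: "('p, 'a::euclidean_space) mfd" and br :: "('p \<Rightarrow> real) list \<Rightarrow> 'p \<Rightarrow> real"
  assumes NP: "nambu_poisson n M br"
begin

lemmas NPD = nambu_poissonD[OF NP]

text \<open>Replace the arguments one at a time.\<close>

lemma bracket_depends_on_differentials:
  assumes p: "p \<in> carr M" and fs: "fs \<in> nlists n (Cinf M)" and gs: "gs \<in> nlists n (Cinf M)"
    and eq: "map (differential M p) fs = map (differential M p) gs"
  shows "br fs p = br gs p"
proof -
  have len: "length fs = n" "length gs = n" using fs gs by simp_all
  have nth: "differential M p (fs ! i) = differential M p (gs ! i)" if "i < n" for i
    using arg_cong[OF eq, of "\<lambda>xs. xs ! i"] that len by simp
  have "br (take m gs @ drop m fs) p = br fs p" if "m \<le> n" for m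
    using that
  proof (induction m)
    case (Suc m)
    let ?hs = "take m gs @ drop m fs"
    have m: "m < n" using Suc.prems by simp
    have set: "set fs \<subseteq> Cinf M" "set gs \<subseteq> Cinf M"
      using fs by (rule nlistsE_set) (rule nlistsE_set[OF gs])
    have hs: "?hs \<in> nlists n (Cinf M)"
    proof (rule nlistsI)
      show "length ?hs = n" using len m by simp
      show "set ?hs \<subseteq> Cinf M"
        using set set_take_subset[of m gs] set_drop_subset[of m fs] by (simp only: set_append) blast
    qed
    define D where "D = (\<lambda>f. if f \<in> Cinf M then br (?hs[m := f]) p else 0)"
    have D: "D \<in> tangent_space M p" unfolding D_def by (rule bracket_slot_tangent[OF NP hs m p])
    have C: "fs ! m \<in> Cinf M" "gs ! m \<in> Cinf M" using fs gs m by (auto intro: nlistsE_nth_in)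
    have "D (fs ! m) = D (gs ! m)" using fun_cong[OF nth[OF m], of D] D by (simp add: differential_def)
    then have "br (?hs[m := fs ! m]) p = br (?hs[m := gs ! m]) p" using C by (simp add: D_def)
    moreover have "?hs[m := fs ! m] = ?hs"
    proof -
      have "?hs ! m = fs ! m" using m len by (simp add: nth_append)
      then show ?thesis by (metis list_update_id)
    qed
    moreover have "?hs[m := gs ! m] = take (Suc m) gs @ drop (Suc m) fs"
      using m len by (simp add: list_update_append take_Suc_conv_app_nth Cons_nth_drop_Suc[symmetric])
    ultimately show ?case using Suc by simp
  qed simp
  from this[of n] show ?thesis using len by simp
qed

lemma nambu_tensor_differentials:
  assumes p: "p \<in> carr M" and fs: "fs \<in> nlists n (Cinf M)"
  shows "nambu_tensor n M br p (map (differential M p) fs) = br fs p"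
  unfolding nambu_tensor_def
proof (rule the_equality)
  show "\<exists>gs\<in>nlists n (Cinf M). map (differential M p) gs = map (differential M p) fs \<and> br gs p = br fs p"
    using fs by blast
  show "c = br fs p" if "\<exists>gs\<in>nlists n (Cinf M). map (differential M p) gs = map (differential M p) fs \<and> br gs p = c" for c
    using that bracket_depends_on_differentials[OF p _ fs] by blast
qed

lemma covectors_lift:
  assumes p: "p \<in> carr M" and \<alpha>s: "\<alpha>s \<in> nlists m (cotangent_space M p)"
  obtains fs where "fs \<in> nlists m (Cinf M)" "map (differential M p) fs = \<alpha>s"
proof -
  define lift where "lift \<alpha> = (SOME f. f \<in> Cinf M \<and> differential M p f = \<alpha>)" for \<alpha>
  have lift: "lift \<alpha> \<in> Cinf M \<and> differential M p (lift \<alpha>) = \<alpha>" if "\<alpha> \<in> cotangent_space M p" for \<alpha>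
  proof -
    obtain f where "f \<in> Cinf M \<and> differential M p f = \<alpha>"
      using covector_differential[OF NPD(1) p \<open>\<alpha> \<in> cotangent_space M p\<close>] by blast
    then show ?thesis unfolding lift_def by (rule someI[of "\<lambda>f. f \<in> Cinf M \<and> differential M p f = \<alpha>"])
  qed
  have "map lift \<alpha>s \<in> nlists m (Cinf M)" using lift by (intro map_nlists[OF _ \<alpha>s]) blast
  moreover have "map (differential M p) (map lift \<alpha>s) = \<alpha>s"
    unfolding map_map using lift nlistsE_set[OF \<alpha>s] by (intro map_idI) auto
  ultimately show thesis by (rule that)
qed

lemma
  assumes p: "p \<in> carr M" and \<beta>: "\<beta> \<in> cotangent_space M p"
  shows nambu_tensor_multilinear:
      "multilinear_on (cotangent_space M p) (n - 1) (\<lambda>\<alpha>s. nambu_tensor n M br p (\<alpha>s @ [\<beta>]))"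
    and nambu_tensor_alternating:
      "alternating_on (cotangent_space M p) (n - 1) (\<lambda>\<alpha>s. nambu_tensor n M br p (\<alpha>s @ [\<beta>]))"
proof -
  let ?d = "differential M p" and ?k = "n - 1" and ?T = "cotangent_space M p"
  note M = NPD(1)
  obtain g where g: "g \<in> Cinf M" "?d g = \<beta>" using covector_differential[OF M p \<beta>] by metis
  have kn: "i < n" if "i < ?k" for i using that by simp
  have T: "nambu_tensor n M br p (map ?d fs @ [\<beta>]) = br (fs @ [g]) p" if "fs \<in> nlists ?k (Cinf M)" for fs
    using nambu_tensor_differentials[OF p snoc_nlists[OF NP that g(1)]] g(2) by simp
  have upd: "fs[i := f] @ [g] = (fs @ [g])[i := f]" if "fs \<in> nlists ?k (Cinf M)" "i < ?k" for fs i f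
    using that by (simp add: list_update_append)
  show "multilinear_on ?T ?k (\<lambda>\<alpha>s. nambu_tensor n M br p (\<alpha>s @ [\<beta>]))"
    unfolding multilinear_on_def
  proof (intro ballI allI impI conjI)
    fix \<alpha>s i assume \<alpha>s: "\<alpha>s \<in> nlists ?k ?T" and i: "i < ?k"
    obtain fs where fs: "fs \<in> nlists ?k (Cinf M)" "map ?d fs = \<alpha>s" using covectors_lift[OF p \<alpha>s] by blast
    have X: "nambu_tensor n M br p (\<alpha>s[i := ?d f] @ [\<beta>]) = br ((fs @ [g])[i := f]) p" if "f \<in> Cinf M" for f
      using T[OF nlists_update[OF fs(1) that], of i] fs(2) upd[OF fs(1) i] by (simp add: map_update)
    note gs = snoc_nlists[OF NP fs(1) g(1)]
    show "nambu_tensor n M br p (\<alpha>s[i := a + b] @ [\<beta>]) =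
        nambu_tensor n M br p (\<alpha>s[i := a] @ [\<beta>]) + nambu_tensor n M br p (\<alpha>s[i := b] @ [\<beta>])"
      if a: "a \<in> ?T" and b: "b \<in> ?T" for a b
    proof -
      obtain fa where fa: "fa \<in> Cinf M" "?d fa = a" using covector_differential[OF M p a] by metis
      obtain fb where fb: "fb \<in> Cinf M" "?d fb = b" using covector_differential[OF M p b] by metis
      have "a + b = ?d (fa + fb)" using differential_add[OF fa(1) fb(1), of p] fa(2) fb(2) by simp
      then show ?thesis
        using X[OF Cinf_add[OF M fa(1) fb(1)]] X[OF fa(1)] X[OF fb(1)] fa(2) fb(2)
          NPD(4)[OF gs kn[OF i] fa(1) fb(1) p] by simp
    qed
    show "nambu_tensor n M br p (\<alpha>s[i := c *\<^sub>R a] @ [\<beta>]) = c * nambu_tensor n M br p (\<alpha>s[i := a] @ [\<beta>])"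
      if a: "a \<in> ?T" for c a
    proof -
      obtain fa where fa: "fa \<in> Cinf M" "?d fa = a" using covector_differential[OF M p a] by metis
      have "c *\<^sub>R a = ?d (c *\<^sub>R fa)" using differential_scaleR[OF fa(1), of p c] fa(2) by simp
      then show ?thesis
        using X[OF Cinf_scaleR[OF M fa(1)], of c] X[OF fa(1)] fa(2) NPD(5)[OF gs kn[OF i] fa(1) p, of c] by simp
    qed
  qed
  show "alternating_on ?T ?k (\<lambda>\<alpha>s. nambu_tensor n M br p (\<alpha>s @ [\<beta>]))"
    unfolding alternating_on_def
  proof (intro ballI allI impI)
    fix \<alpha>s i j assume \<alpha>s: "\<alpha>s \<in> nlists ?k ?T" and i: "i < ?k" and j: "j < ?k" and ij: "i \<noteq> j"
    obtain fs where fs: "fs \<in> nlists ?k (Cinf M)" "map ?d fs = \<alpha>s" using covectors_lift[OF p \<alpha>s] by blast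
    have len: "length fs = ?k" using fs(1) by (rule nlistsE_length)
    let ?gs = "fs[i := fs ! j, j := fs ! i]"
    have C: "fs ! i \<in> Cinf M" "fs ! j \<in> Cinf M" using nlistsE_nth_in[OF fs(1)] i j by blast+
    have gs: "?gs \<in> nlists ?k (Cinf M)" by (intro nlists_update fs(1) C)
    have "map ?d ?gs = \<alpha>s[i := \<alpha>s ! j, j := \<alpha>s ! i]"
      unfolding fs(2)[symmetric] using i j len by (simp add: map_update)
    then have "nambu_tensor n M br p (\<alpha>s[i := \<alpha>s ! j, j := \<alpha>s ! i] @ [\<beta>]) = br (?gs @ [g]) p"
      using T[OF gs] by simp
    also have "?gs @ [g] = (fs @ [g])[i := (fs @ [g]) ! j, j := (fs @ [g]) ! i]"
      using i j len by (simp add: list_update_append nth_append)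
    also have "br \<dots> p = - br (fs @ [g]) p"
      by (rule NPD(6)[OF snoc_nlists[OF NP fs(1) g(1)] kn[OF i] kn[OF j] ij p])
    also have "\<dots> = - nambu_tensor n M br p (\<alpha>s @ [\<beta>])" using T[OF fs(1)] fs(2) by simp
    finally show "nambu_tensor n M br p (\<alpha>s[i := \<alpha>s ! j, j := \<alpha>s ! i] @ [\<beta>]) = - nambu_tensor n M br p (\<alpha>s @ [\<beta>])" .
  qed
qed

text \<open>The right-hand side, as a function of \<open>\<eta>\<close>, is linear and has the values on
  decomposable forms that characterise \<open>\<Pi>\<^sup>\<sharp>\<close>; it is the only such
  map because wedge products of covectors span the forms. The two facts are the contraction and
  the expansion formula for alternating maps.\<close>

lemma nambu_sharp_eq:
  assumes p: "p \<in> carr M" and B: "finite B" "B \<subseteq> tangent_space M p"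
    and \<epsilon>: "\<And>b. b \<in> B \<Longrightarrow> \<epsilon> b \<in> cotangent_space M p"
    and rep: "\<And>v. v \<in> tangent_space M p \<Longrightarrow> v = (\<Sum>b\<in>B. \<epsilon> b v *\<^sub>R b)"
    and fb: "\<And>b. b \<in> B \<Longrightarrow> fb b \<in> Cinf M" "\<And>b. b \<in> B \<Longrightarrow> differential M p (fb b) = \<epsilon> b"
    and \<eta>: "\<eta> \<in> forms M p (n - 1)"
  shows "nambu_sharp n M br p \<eta> =
    (1 / fact (n - 1)) *\<^sub>R (\<Sum>J\<in>nlists (n - 1) B. \<eta> J *\<^sub>R hamiltonian M br p (map fb J))"
proof -
  let ?k = "n - 1" and ?T = "tangent_space M p" and ?T' = "cotangent_space M p"
  let ?\<Pi> = "nambu_tensor n M br p"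
  let ?X = "\<lambda>J. hamiltonian M br p (map fb J)"
  note M = NPD(1)
  note T = subspace_tangent_space[OF M, of p]
  define S where "S \<eta> = (if \<eta> \<in> forms M p ?k
    then (1 / fact ?k) *\<^sub>R (\<Sum>J\<in>nlists ?k B. \<eta> J *\<^sub>R ?X J) else 0)" for \<eta>
  have mapfb: "map fb J \<in> nlists ?k (Cinf M)" if "J \<in> nlists ?k B" for J
    by (rule map_nlists[OF fb(1) that])
  have mape: "map \<epsilon> J \<in> nlists ?k ?T'" if "J \<in> nlists ?k B" for J
    by (rule map_nlists[OF \<epsilon> that])
  have mapd: "map (differential M p) (map fb J) = map \<epsilon> J" if "J \<in> nlists ?k B" for J
    using fb(2) nlistsE_set[OF that] by auto
  have X: "?X J \<in> ?T" if "J \<in> nlists ?k B" for J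
    by (rule hamiltonian_tangent[OF NP mapfb[OF that] p])
  have ST: "S \<eta> \<in> ?T" for \<eta>
    unfolding S_def using X by (auto intro!: subspace_scale[OF T] subspace_sum[OF T] subspace_0[OF T])
  have lin: "linear_between (forms M p ?k) ?T S"
    unfolding linear_between_def
  proof (intro conjI ballI allI impI)
    show "S \<eta> \<in> ?T" for \<eta> by (rule ST)
    show "S (\<eta> + \<theta>) = S \<eta> + S \<theta>" if "\<eta> \<in> forms M p ?k" "\<theta> \<in> forms M p ?k" for \<eta> \<theta>
      using that subspace_add[OF subspace_forms that]
      by (simp add: S_def scaleR_add_left sum.distrib scaleR_add_right)
    show "S (c *\<^sub>R \<eta>) = c *\<^sub>R S \<eta>" if "\<eta> \<in> forms M p ?k" for c \<eta>
      using that subspace_scale[OF subspace_forms that]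
      by (simp add: S_def scaleR_sum_right mult_ac)
    show "S \<eta> = 0" if "\<eta> \<notin> forms M p ?k" for \<eta> using that by (simp add: S_def)
  qed
  have expand: "\<alpha> = (\<Sum>b\<in>B. \<alpha> b *\<^sub>R \<epsilon> b)" if \<alpha>: "\<alpha> \<in> ?T'" for \<alpha>
  proof
    fix v
    have lina: "linear_between ?T UNIV \<alpha>" using \<alpha> by (simp add: cotangent_space_def)
    show "\<alpha> v = (\<Sum>b\<in>B. \<alpha> b *\<^sub>R \<epsilon> b) v"
    proof (cases "v \<in> ?T")
      case True
      have "\<alpha> v = \<alpha> (\<Sum>b\<in>B. \<epsilon> b v *\<^sub>R b)" using rep[OF True] by simp
      also have "\<dots> = (\<Sum>b\<in>B. \<epsilon> b v *\<^sub>R \<alpha> b)" using B(2) by (intro linear_between_sum[OF lina T]) blast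
      finally show ?thesis by (simp add: sum_fun_apply mult.commute)
    next
      case False
      then show ?thesis
        using lina \<epsilon> by (simp add: sum_fun_apply cotangent_space_def linear_between_def)
    qed
  qed
  have pair: "\<beta> (S (wedge M p \<alpha>s)) = ?\<Pi> (\<alpha>s @ [\<beta>])" if \<alpha>s: "\<alpha>s \<in> nlists ?k ?T'" and \<beta>: "\<beta> \<in> ?T'" for \<alpha>s \<beta>
  proof -
    obtain g where g: "g \<in> Cinf M" "differential M p g = \<beta>" using covector_differential[OF M p \<beta>] by metis
    have Xg: "?X J g = ?\<Pi> (map \<epsilon> J @ [\<beta>])" if J: "J \<in> nlists ?k B" for J
      using nambu_tensor_differentials[OF p snoc_nlists[OF NP mapfb[OF J] g(1)]]
      by (simp only: map_append mapd[OF J] list.map g hamiltonian_def[OF NP] if_True)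
    have len: "length \<alpha>s = ?k" using \<alpha>s by (rule nlistsE_length)
    have W: "wedge M p \<alpha>s J = (\<Sum>\<sigma> | \<sigma> permutes {..<?k}. of_int (sign \<sigma>) * (\<Prod>i<?k. (\<alpha>s ! i) (J ! \<sigma> i)))"
      if "J \<in> nlists ?k B" for J
      using subsetD[OF nlists_mono[OF B(2)] that] unfolding wedge_def len by (simp only: if_True)
    have "\<beta> (S (wedge M p \<alpha>s)) = S (wedge M p \<alpha>s) g"
      using g(2) ST by (auto simp: differential_def)
    also have "\<dots> = (1 / fact ?k) * (\<Sum>J\<in>nlists ?k B. wedge M p \<alpha>s J * ?\<Pi> (map \<epsilon> J @ [\<beta>]))"
      using wedge_forms[OF \<alpha>s] Xg by (simp add: S_def sum_fun_apply)
    also have "(\<Sum>J\<in>nlists ?k B. wedge M p \<alpha>s J * ?\<Pi> (map \<epsilon> J @ [\<beta>])) = fact ?k * ?\<Pi> (\<alpha>s @ [\<beta>])"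
      using alternating_contraction[OF nambu_tensor_multilinear[OF p \<beta>] nambu_tensor_alternating[OF p \<beta>]
          subspace_cotangent_space \<epsilon> \<alpha>s, where c = "\<lambda>i b. (\<alpha>s ! i) b"] expand nlistsE_nth_in[OF \<alpha>s] W
      by simp
    finally show ?thesis by simp
  qed
  have decomp: "\<eta> = (\<Sum>J\<in>nlists ?k B. (\<eta> J / fact ?k) *\<^sub>R wedge M p (map \<epsilon> J))" if \<eta>: "\<eta> \<in> forms M p ?k" for \<eta>
  proof
    fix vs
    show "\<eta> vs = (\<Sum>J\<in>nlists ?k B. (\<eta> J / fact ?k) *\<^sub>R wedge M p (map \<epsilon> J)) vs"
    proof (cases "vs \<in> nlists ?k ?T")
      case True
      have W: "wedge M p (map \<epsilon> J) vs = (\<Sum>\<sigma> | \<sigma> permutes {..<?k}. of_int (sign \<sigma>) * (\<Prod>i<?k. \<epsilon> (J ! i) (vs ! \<sigma> i)))"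
        if "J \<in> nlists ?k B" for J
      proof -
        have len: "length (map \<epsilon> J) = ?k" "length J = ?k" using nlistsE_length[OF that] by simp_all
        have "(\<Prod>i<?k. (map \<epsilon> J ! i) (vs ! \<sigma> i)) = (\<Prod>i<?k. \<epsilon> (J ! i) (vs ! \<sigma> i))" for \<sigma> :: "nat \<Rightarrow> nat"
          using len(2) by (intro prod.cong) auto
        then show ?thesis using True unfolding wedge_def len(1) by simp
      qed
      have ml: "multilinear_on ?T ?k \<eta>" using \<eta> unfolding forms_iff by blast
      have "(\<Sum>J\<in>nlists ?k B. \<eta> J * wedge M p (map \<epsilon> J) vs) = fact ?k * \<eta> vs"
        using alternating_expansion[OF ml form_alternating[OF \<eta> T] T B(2) True, of \<epsilon>] rep nlistsE_nth_in[OF True] W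
        by simp
      then have "\<eta> vs = (\<Sum>J\<in>nlists ?k B. \<eta> J * wedge M p (map \<epsilon> J) vs) / fact ?k" by simp
      then show ?thesis by (simp add: sum_fun_apply sum_divide_distrib)
    next
      case False
      have "wedge M p (map \<epsilon> J) vs = 0" if "J \<in> nlists ?k B" for J
        using wedge_forms[OF mape[OF that]] False unfolding forms_iff by blast
      moreover have "\<eta> vs = 0" using \<eta> False unfolding forms_iff by blast
      ultimately show ?thesis by (simp add: sum_fun_apply)
    qed
  qed
  have "nambu_sharp n M br p = S"
    unfolding nambu_sharp_def
  proof (rule the_equality)
    show "linear_between (forms M p ?k) ?T S \<and> (\<forall>\<alpha>s\<in>nlists ?k ?T'. \<forall>\<beta>\<in>?T'. \<beta> (S (wedge M p \<alpha>s)) = ?\<Pi> (\<alpha>s @ [\<beta>]))"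
      using lin pair by blast
    fix S' assume "linear_between (forms M p ?k) ?T S' \<and> (\<forall>\<alpha>s\<in>nlists ?k ?T'. \<forall>\<beta>\<in>?T'. \<beta> (S' (wedge M p \<alpha>s)) = ?\<Pi> (\<alpha>s @ [\<beta>]))"
    then have lin': "linear_between (forms M p ?k) ?T S'"
      and pair': "\<And>\<alpha>s \<beta>. \<alpha>s \<in> nlists ?k ?T' \<Longrightarrow> \<beta> \<in> ?T' \<Longrightarrow> \<beta> (S' (wedge M p \<alpha>s)) = ?\<Pi> (\<alpha>s @ [\<beta>])"
      by blast+
    have w: "S' (wedge M p (map \<epsilon> J)) = S (wedge M p (map \<epsilon> J))" if J: "J \<in> nlists ?k B" for J
    proof (rule covectors_separate[OF M _ ST])
      show "S' (wedge M p (map \<epsilon> J)) \<in> ?T"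
        using lin' wedge_forms[OF mape[OF J]] unfolding linear_between_def by blast
      show "\<beta> (S' (wedge M p (map \<epsilon> J))) = \<beta> (S (wedge M p (map \<epsilon> J)))" if "\<beta> \<in> ?T'" for \<beta>
        using pair'[OF mape[OF J] that] pair[OF mape[OF J] that] by simp
    qed
    show "S' = S"
    proof
      fix \<eta>
      show "S' \<eta> = S \<eta>"
      proof (cases "\<eta> \<in> forms M p ?k")
        case True
        have wf: "wedge M p (map \<epsilon> J) \<in> forms M p ?k" if "J \<in> nlists ?k B" for J
          by (rule wedge_forms[OF mape[OF that]])
        have "S' \<eta> = S' (\<Sum>J\<in>nlists ?k B. (\<eta> J / fact ?k) *\<^sub>R wedge M p (map \<epsilon> J))"
          by (rule arg_cong[OF decomp[OF True]])
        also have "\<dots> = (\<Sum>J\<in>nlists ?k B. (\<eta> J / fact ?k) *\<^sub>R S' (wedge M p (map \<epsilon> J)))"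
          by (rule linear_between_sum[OF lin' subspace_forms wf])
        also have "\<dots> = (\<Sum>J\<in>nlists ?k B. (\<eta> J / fact ?k) *\<^sub>R S (wedge M p (map \<epsilon> J)))"
          by (rule sum.cong) (simp_all add: w)
        also have "\<dots> = S (\<Sum>J\<in>nlists ?k B. (\<eta> J / fact ?k) *\<^sub>R wedge M p (map \<epsilon> J))"
          by (rule linear_between_sum[OF lin subspace_forms wf, symmetric])
        also have "\<dots> = S \<eta>" by (rule arg_cong[OF decomp[OF True, symmetric]])
        finally show ?thesis .
      next
        case False
        then show ?thesis using lin lin' unfolding linear_between_def by simp
      qed
    qed
  qed
  then show ?thesis using \<eta> by (simp add: S_def)
qed

end

theorem proposition3p1:
  fixes n r :: nat
    and M :: "('p, 'a::euclidean_space) mfd"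
    and br :: "('p \<Rightarrow> real) list \<Rightarrow> 'p \<Rightarrow> real"
    and N :: "'p set" and W :: "'a set"
    and E F :: "'p \<Rightarrow> 'p tvec set"
    and N\<^sub>m :: "('p, 'a) mfd"
  assumes "nambu_poisson n M br"
    and "submanifold M N W"
    and N\<^sub>m: "N\<^sub>m = induced_mfd M N W"
    and "subbundle_along M N\<^sub>m r E"
    and "canonical_along n M br N E"
    and F: "F = tangential_part M N\<^sub>m E"
    and "regular_integrable_distribution N\<^sub>m F"
    and restriction_surjective:
      "\<forall>g\<in>Cinf_ann N\<^sub>m N F. \<exists>f\<in>Cinf_ann M N E. \<forall>x\<in>N. f x = g x"
  shows "(\<forall>p\<in>N. nambu_sharp n M br p ` Ann1 n M E p \<subseteq> tangent_image M N\<^sub>m p) \<or>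
    (\<forall>p\<in>N. E p = {0})"
proof -
  note NP = assms(1) and sub = assms(2) and E = assms(4) and can = assms(5) and reg = assms(7)
  note M = nambu_poissonD(1)[OF NP]
  have carrN: "carr N\<^sub>m = N" by (rule induced_simps(3)[OF M sub N\<^sub>m])
  obtain s where "subbundle_along N\<^sub>m N\<^sub>m s F"
    using reg unfolding regular_integrable_distribution_def by blast
  then have rank_F: "dim (tangential_part M N\<^sub>m E q) = s" if "q \<in> N" for q
    using that carrN unfolding F subbundle_along_def by simp
  have ED: "subspace (E q)" "E q \<subseteq> tangent_space M q" "dim (E q) = r" if "q \<in> N" for q
    using E that carrN unfolding subbundle_along_def by blast+
  note NM = submanifoldD(1)[OF M sub N\<^sub>m]
  show ?thesis
  proof (cases "r = 0")
    case True
    have "E p = {0}" if p: "p \<in> N" for p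
    proof -
      have pM: "p \<in> carr M" using p NM by blast
      obtain B where B: "B \<subseteq> E p" "independent B" "E p \<subseteq> span B"
        using maximal_independent_subset by blast
      obtain C \<epsilon> where C: "finite C" "C \<subseteq> tangent_space M p"
        "\<And>v. v \<in> tangent_space M p \<Longrightarrow> v = (\<Sum>b\<in>C. \<epsilon> b v *\<^sub>R b)"
        by (rule finite_dual_basis[OF M pM ED(1,2)[OF p]]) (rule that, assumption+)
      have "B \<subseteq> span C"
      proof
        fix v assume "v \<in> B"
        then have "v = (\<Sum>b\<in>C. \<epsilon> b v *\<^sub>R b)" using B(1) ED(2)[OF p] by (intro C(3)) blast
        moreover have "(\<Sum>b\<in>C. \<epsilon> b v *\<^sub>R b) \<in> span C" by (intro span_sum span_scale span_base)
        ultimately show "v \<in> span C" by simp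
      qed
      then have "finite B" using independent_span_bound[OF C(1) B(2)] by blast
      moreover have "card B = dim (E p)"
        by (rule dim_unique[OF B(1,3,2) refl, symmetric])
      ultimately have "B = {}" using ED(3)[OF p] True by simp
      then show "E p = {0}" using B(3) subspace_0[OF ED(1)[OF p]] by auto
    qed
    then show ?thesis by blast
  next
    case False
    then have r: "r > 0" by simp
    have "nambu_sharp n M br p \<eta> \<in> tangent_image M N\<^sub>m p" if p: "p \<in> N" and \<eta>: "\<eta> \<in> Ann1 n M E p" for p \<eta>
    proof -
      let ?k = "n - 1" and ?T = "tangent_space M p"
      have pM: "p \<in> carr M" using p NM by blast
      note T = subspace_tangent_space[OF M, of p]
      have \<eta>F: "\<eta> \<in> forms M p ?k" and \<eta>0: "\<And>v vs. v \<in> E p \<Longrightarrow> \<eta> (v # vs) = 0"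
        using \<eta> by (auto simp: Ann1_def interior_prod_def fun_eq_iff)
      obtain B \<epsilon> where B: "finite B" "B \<subseteq> ?T"
        "\<And>b. b \<in> B \<Longrightarrow> \<epsilon> b \<in> cotangent_space M p"
        "\<And>v. v \<in> ?T \<Longrightarrow> v = (\<Sum>b\<in>B. \<epsilon> b v *\<^sub>R b)"
        "\<And>b v. b \<in> B \<Longrightarrow> b \<notin> E p \<Longrightarrow> v \<in> E p \<Longrightarrow> \<epsilon> b v = 0"
        by (rule finite_dual_basis[OF M pM ED(1,2)[OF p]]) (rule that, assumption+)
      \<comment> \<open>The dual covectors of basis vectors outside \<open>E p\<close> annihilate \<open>E p\<close> and lift to \<open>C\<^sup>\<infinity>(M)\<^sub>E\<close>.\<close>
      have "\<exists>f. f \<in> Cinf M \<and> differential M p f = \<epsilon> b \<and> (b \<notin> E p \<longrightarrow> f \<in> Cinf_ann M N E)" if b: "b \<in> B" for b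
      proof (cases "b \<in> E p")
        case True
        then show ?thesis using covector_differential[OF M pM B(3)[OF b]] by metis
      next
        case False
        obtain f where "f \<in> Cinf_ann M N E" "differential M p f = \<epsilon> b"
        proof (rule annihilator_lift[OF M sub N\<^sub>m E F rank_F reg _ p B(3)[OF b] B(5)[OF b False]])
          show "\<exists>f\<in>Cinf_ann M N E. \<forall>x\<in>N. f x = g x" if "g \<in> Cinf_ann N\<^sub>m N F" for g
            using restriction_surjective that by blast
        qed
        then show ?thesis using Cinf_annD(1) by metis
      qed
      then obtain fb where fb: "\<And>b. b \<in> B \<Longrightarrow> fb b \<in> Cinf M" "\<And>b. b \<in> B \<Longrightarrow> differential M p (fb b) = \<epsilon> b"
        "\<And>b. b \<in> B \<Longrightarrow> b \<notin> E p \<Longrightarrow> fb b \<in> Cinf_ann M N E"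
        by metis
      let ?X = "\<lambda>J. hamiltonian M br p (map fb J)"
      have im: "tangent_image M N\<^sub>m p = {v \<in> ?T. \<forall>f\<in>Cinf M. (\<forall>y\<in>N. f y = 0) \<longrightarrow> v f = 0}"
      proof -
        have "tangent_image M N\<^sub>m p \<subseteq> ?T"
          unfolding tangent_image_def using push_forward_tangent(1)[OF M sub N\<^sub>m p] by blast
        then show ?thesis using tangent_image_iff[OF M sub N\<^sub>m p] by blast
      qed
      have subim: "subspace (tangent_image M N\<^sub>m p)"
        unfolding im using T by (auto simp: subspace_def)
      \<comment> \<open>A tuple containing a vector of \<open>E p\<close> has coefficient \<open>0\<close>, as \<open>\<eta>\<close> is annihilated by \<open>E p\<close>;
        all others give Hamiltonian vectors of functions in \<open>C\<^sup>\<infinity>(M)\<^sub>E\<close>.\<close>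
      have summand: "\<eta> J *\<^sub>R ?X J \<in> tangent_image M N\<^sub>m p" if J: "J \<in> nlists ?k B" for J
      proof (cases "\<exists>i<?k. J ! i \<in> E p")
        case True
        then obtain i where i: "i < ?k" "J ! i \<in> E p" by blast
        have JT: "J \<in> nlists ?k ?T" using J nlists_mono[OF B(2)] by blast
        have cons: "\<eta> K = 0" if "K \<in> nlists ?k ?T" "K ! 0 \<in> E p" for K
        proof -
          have "length K = ?k" using that(1) by (rule nlistsE_length)
          then obtain v vs where "K = v # vs" using i(1) by (cases K) auto
          then show ?thesis using \<eta>0 that(2) by simp
        qed
        have "\<eta> J = 0"
        proof (cases "i = 0")
          case True
          then show ?thesis using cons[OF JT] i(2) by simp
        next
          case False
          have k0: "0 < ?k" using i(1) by simp
          let ?K = "J[i := J ! 0, 0 := J ! i]"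
          have "?K \<in> nlists ?k ?T"
            using nlistsE_nth_in[OF JT] i(1) k0 by (intro nlists_update JT) blast+
          moreover have "?K ! 0 = J ! i" using nlistsE_length[OF J] k0 by simp
          ultimately have "\<eta> ?K = 0" using cons i(2) by simp
          moreover have "\<eta> ?K = - \<eta> J"
            using form_alternating[OF \<eta>F T, unfolded alternating_on_def, rule_format, OF JT i(1) k0 False] .
          ultimately show ?thesis by simp
        qed
        then show ?thesis using subspace_0[OF subim] by simp
      next
        case False
        have "fb b \<in> Cinf_ann M N E" if b: "b \<in> set J" for b
        proof -
          from b obtain i where i: "i < length J" "J ! i = b" unfolding in_set_conv_nth by blast
          have "i < ?k" using i(1) nlistsE_length[OF J] by simp
          then have "b \<notin> E p" using False i(2) by blast
          moreover have "b \<in> B" using nlistsE_set[OF J] b by blast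
          ultimately show ?thesis by (intro fb(3))
        qed
        then have fbJ: "map fb J \<in> nlists ?k (Cinf_ann M N E)"
          using nlistsE_length[OF J] by (intro nlistsI) auto
        have "?X J \<in> tangent_image M N\<^sub>m p"
          by (rule hamiltonian_tangent_image[OF NP sub N\<^sub>m E r can _ fbJ p]) (rule rank_F)
        then show ?thesis by (rule subspace_scale[OF subim])
      qed
      have "(1 / fact ?k) *\<^sub>R (\<Sum>J\<in>nlists ?k B. \<eta> J *\<^sub>R ?X J) \<in> tangent_image M N\<^sub>m p"
        by (rule subspace_scale[OF subim subspace_sum[OF subim]]) (rule summand)
      moreover have "nambu_sharp n M br p \<eta> = (1 / fact ?k) *\<^sub>R (\<Sum>J\<in>nlists ?k B. \<eta> J *\<^sub>R ?X J)"
        by (rule nambu_sharp_eq[OF NP pM B(1,2) _ _ _ _ \<eta>F, where \<epsilon> = \<epsilon>]) (erule B(3) B(4) fb(1) fb(2))+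
      ultimately show ?thesis by simp
    qed
    then show ?thesis by blast
  qed
qed

end
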